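(* Let $\beta>0$ and let $E\subset\mathbb{R}^2$ be a bounded convex set with nonempty interior. If $\beta\le1$, then $$\int_{\mathbb{R}^2}|x|^2\,d\mu_E+2\beta|E|\ge(1+\beta)\frac{P(E)^2}{2\pi},\qquad(\mathrm{L})$$ while if $\beta\ge\frac53$, then $$\inf_{x_0\in\mathbb{R}^2}\int_{\partial E}|x-x_0|^2\,d\mu_E+2\beta|E|\le(1+\beta)\frac{P(E)^2}{2\pi}.\qquad(\mathrm{U})$$ The thresholds $\beta=\frac53$ (for (U)) and $\beta=1$ (for (L)) are sharp: for every $0<\beta<\frac53$ there is a bounded convex set with nonempty interior for which (U) fails, and for every $\beta>1$ there is a bounded convex set with nonempty interior for which (L) fails. Moreover, for $\beta>\frac53$ (resp. $\beta<1$) equality in (U) (resp. (L)) holds if and only if $E=B_r(\overline{x})$ for some $r>0$ and $\overline{x}\in\mathbb{R}^2$.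
   Context: $|E|$ is the area and $P(E)$ the perimeter of $E$; $B_r(\overline{x})$ is the ball of radius $r$ centered at $\overline{x}$. $\mu_E$ is the curvature measure of the planar convex set $E$: the Radon measure on $\mathbb{R}^2$ supported on $\partial E$ such that $\mu_E(A)$ is the $\mathcal{H}^1$-measure ($\mathcal{H}^1$ being the one-dimensional Hausdorff measure) of the set of unit vectors that are outer normals to $E$ at some point of $A\cap\partial E$ ($A$ Borel); for $E$ of class $C^2$, $\mu_E=H_{\partial E}\,\mathcal{H}^1$ on $\partial E$ with $H_{\partial E}$ the curvature of $\partial E$.
   Formalization: Equality in (L) fails for balls not centered at 0, so it is stated as: equality in (L) iff E is a ball centered at 0, and equality in (L) for some translate of E iff E is a ball; in both (L) and (U), "E = B_r" is understood up to boundary points. *)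

theory Defs
  imports "HOL-Analysis.Analysis"
begin

text \<open>
  One-dimensional Hausdorff (outer) measure, normalised so that it is length on rectifiable curves.
  The boundedness requirement matters because \<^const>\<open>diameter\<close> is unspecified on unbounded sets.
  If there is no admissible cover the infimum is \<open>\<infinity>\<close>.
\<close>

definition hausdorff1_pre :: "real \<Rightarrow> 'a::metric_space set \<Rightarrow> ennreal" where
  "hausdorff1_pre \<delta> A =
     (INF U \<in> {U :: nat \<Rightarrow> 'a set. A \<subseteq> (\<Union>i. U i) \<and> (\<forall>i. bounded (U i) \<and> diameter (U i) \<le> \<delta>)}.
        \<Sum>i. ennreal (diameter (U i)))"

definition hausdorff1 :: "'a::metric_space set \<Rightarrow> ennreal" where
  "hausdorff1 A = (SUP \<delta> \<in> {0<..}. hausdorff1_pre \<delta> A)"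

text \<open>Only meant for planar convex sets with nonempty interior, where it is the length of the boundary.\<close>

definition perimeter :: "(real^2) set \<Rightarrow> real" where
  "perimeter E = enn2real (hausdorff1 (frontier E))"

definition outer_unit_normals :: "'a::real_inner set \<Rightarrow> 'a \<Rightarrow> 'a set" where
  "outer_unit_normals E x = {\<nu>. norm \<nu> = 1 \<and> (\<forall>y\<in>E. \<nu> \<bullet> (y - x) \<le> 0)}"

definition curvature_measure :: "(real^2) set \<Rightarrow> (real^2) measure" where
  "curvature_measure E =
     measure_of UNIV (sets borel) (\<lambda>A. hausdorff1 (\<Union>x\<in>A \<inter> frontier E. outer_unit_normals E x))"

text \<open>
  The set need be neither open nor closed, and every quantity below depends on its closure only;
  hence being a ball is understood up to boundary points.
\<close>

definition is_ball :: "(real^2) set \<Rightarrow> real^2 \<Rightarrow> real \<Rightarrow> bool" where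
  "is_ball E c r \<longleftrightarrow> ball c r \<subseteq> E \<and> E \<subseteq> cball c r"

definition bounded_convex_body :: "(real^2) set \<Rightarrow> bool" where
  "bounded_convex_body E \<longleftrightarrow> bounded E \<and> convex E \<and> interior E \<noteq> {}"

definition lhs_L :: "real \<Rightarrow> (real^2) set \<Rightarrow> real" where
  "lhs_L \<beta> E = (LINT x|curvature_measure E. (norm x)\<^sup>2) + 2 * \<beta> * measure lebesgue E"

definition lhs_U :: "real \<Rightarrow> (real^2) set \<Rightarrow> real" where
  "lhs_U \<beta> E =
     (INF x0 :: real^2. LINT x:frontier E|curvature_measure E. (norm (x - x0))\<^sup>2)
     + 2 * \<beta> * measure lebesgue E"

definition rhs_LU :: "real \<Rightarrow> (real^2) set \<Rightarrow> real" where
  "rhs_LU \<beta> E = (1 + \<beta>) * ((perimeter E)\<^sup>2 / (2 * pi))"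

end

theory Submission
  imports Defs "HOL-Real_Asymp.Real_Asymp"
begin

text \<open>
  Let \<open>dir t = (cos t, sin t)\<close> and \<open>tang t = (-sin t, cos t)\<close>, and let \<open>h\<close> be the support function of a planar
  convex body \<open>K\<close>, so that \<open>h t\<close> is the maximum of \<open>x \<bullet> dir t\<close> over \<open>x\<close> in \<open>K\<close>. For all but countably many
  angles the boundary point with outer normal \<open>dir t\<close> is unique, \<open>h\<close> is differentiable at \<open>t\<close>, and that point
  is \<open>h t dir t + h' t tang t\<close>. Three integrals over \<open>[0, 2 pi]\<close> then carry all the geometry:
  \<^item> the curvature measure is the image of Lebesgue measure under the boundary point, so its second moment
    about \<open>x\<close> is the integral of \<open>(h - x \<bullet> dir)\<^sup>2 + (h' - x \<bullet> tang)\<^sup>2\<close>;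
  \<^item> the perimeter is the integral of \<open>h\<close>;
  \<^item> twice the area is the integral of \<open>h\<^sup>2 - h'\<^sup>2\<close>.

  For the lower bound, the left-hand side is \<open>1 + \<beta>\<close> times the integral of \<open>h\<^sup>2\<close> plus \<open>1 - \<beta>\<close> times the
  integral of \<open>h'\<^sup>2\<close>. The Cauchy-Schwarz inequality bounds the first term by the right-hand side, and the
  second is nonnegative; equality makes \<open>h\<close> constant.

  For the upper bound, translations leave perimeter and area fixed, so \<open>h\<close> may be replaced by
  \<open>f = h - x \<bullet> dir\<close> for any convenient \<open>x\<close>. By the intermediate value theorem there are an \<open>x\<close>, a value
  \<open>k\<close> and four angles a quarter turn apart at which \<open>f\<close> equals \<open>k\<close> (\<open>four_contacts\<close>). On each quarter
  \<open>f - k\<close> vanishes at both ends, and the first Dirichlet eigenvalue of an interval of length \<open>pi/2\<close> is 4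
  (\<open>dirichlet_inequality_quarter\<close>). Hence the integral of \<open>f'\<^sup>2\<close> is at least 4 times that of \<open>(f - k)\<^sup>2\<close>, and
  the right-hand side exceeds the left-hand side by at least \<open>3 \<beta> - 5\<close> times the integral of \<open>(f - k)\<^sup>2\<close>. No Fourier
  expansion is involved: any \<open>x\<close> bounds the infimum from above. If \<open>\<beta> > 5/3\<close>, equality makes \<open>f\<close> constant,
  that is, the body is a disc.

  For the thresholds, take the body with support function \<open>1 + \<epsilon> cos (k t)\<close>. The left-hand side about the
  origin exceeds the right-hand side by \<open>\<epsilon>\<^sup>2 pi ((1 + \<beta>) + (1 - \<beta>) k\<^sup>2)\<close>. For \<open>k = 2\<close> this is
  \<open>\<epsilon>\<^sup>2 pi (5 - 3 \<beta>)\<close>, and moving the origin only increases the moment; for \<open>\<beta> > 1\<close> it is negative when \<open>k\<close>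
  is large.

  The three integral formulas hold for arbitrary convex bodies, corners and flat sides included. The first
  (\<open>hausdorff1_normals\<close>) reduces to the arc length of sets of directions. For the perimeter
  (\<open>hausdorff1_frontier\<close>), the boundary is cut at equally spaced normal directions into arcs that are Lipschitz
  graphs of small slope, and an Abel summation turns the projected chords into a Riemann sum of \<open>h\<close>. For the
  area (\<open>area_eq\<close>), the part of a large disc outside \<open>K\<close> is swept exactly once by tangent half-lines; in the
  coordinates (normal angle, position on the tangent line) the Jacobian is the distance to the point of contact.
\<close>

section \<open>One-dimensional Hausdorff measure\<close>

lemma hausdorff1_pre_le:
  assumes "A \<subseteq> (\<Union>i. U i)" and "\<And>i. bounded (U i)" and "\<And>i. diameter (U i) \<le> \<delta>"
  shows "hausdorff1_pre \<delta> A \<le> (\<Sum>i. ennreal (diameter (U i)))"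
  unfolding hausdorff1_pre_def using assms by (intro INF_lower) auto

lemma hausdorff1_pre_mono: "A \<subseteq> B \<Longrightarrow> hausdorff1_pre \<delta> A \<le> hausdorff1_pre \<delta> B"
  unfolding hausdorff1_pre_def by (intro INF_superset_mono) auto

lemma hausdorff1_pre_antimono: "\<delta> \<le> \<delta>' \<Longrightarrow> hausdorff1_pre \<delta>' A \<le> hausdorff1_pre \<delta> A"
  unfolding hausdorff1_pre_def by (intro INF_superset_mono) (auto intro: order_trans)

lemma hausdorff1_mono: "A \<subseteq> B \<Longrightarrow> hausdorff1 A \<le> hausdorff1 B"
  unfolding hausdorff1_def by (intro SUP_mono) (auto intro: hausdorff1_pre_mono)

lemma hausdorff1_pre_le_hausdorff1: "\<delta> > 0 \<Longrightarrow> hausdorff1_pre \<delta> A \<le> hausdorff1 A"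
  unfolding hausdorff1_def by (intro SUP_upper) auto

lemma hausdorff1_leI:
  assumes "\<And>\<delta>. \<delta> > 0 \<Longrightarrow> hausdorff1_pre \<delta> A \<le> c"
  shows "hausdorff1 A \<le> c"
  unfolding hausdorff1_def using assms by (intro SUP_least) auto

lemma hausdorff1_empty [simp]: "hausdorff1 {} = 0"
proof -
  have "hausdorff1_pre \<delta> {} \<le> 0" if "\<delta> > 0" for \<delta>
    using hausdorff1_pre_le[of "{}" "\<lambda>_. {}" \<delta>] that by simp
  then show ?thesis by (metis hausdorff1_leI le_zero_eq)
qed

lemma diameter_leI:
  assumes "0 \<le> d" and "\<And>x y. x \<in> S \<Longrightarrow> y \<in> S \<Longrightarrow> dist x y \<le> d"
  shows "diameter S \<le> d"
  using assms by (auto simp: diameter_def intro: cSUP_least)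

text \<open>
  Arbitrarily fine covers compute the measure, so it is enough that the map is Lipschitz at small scale. This
  matters for the inverse of the angle parametrisation of the circle, whose Lipschitz constant is close to 1
  only locally.
\<close>

lemma hausdorff1_image_le:
  fixes f :: "'a::metric_space \<Rightarrow> 'b::metric_space"
  assumes L: "L > 0" and \<delta>0: "\<delta>0 > 0"
    and lip: "\<And>x y. x \<in> S \<Longrightarrow> y \<in> S \<Longrightarrow> dist x y \<le> \<delta>0 \<Longrightarrow> dist (f x) (f y) \<le> L * dist x y"
  shows "hausdorff1 (f ` S) \<le> ennreal L * hausdorff1 S"
proof (rule hausdorff1_leI)
  fix \<delta> :: real assume \<delta>: "\<delta> > 0"
  define \<delta>' where "\<delta>' = min \<delta>0 (\<delta> / L)"
  have \<delta>': "\<delta>' > 0" "\<delta>' \<le> \<delta>0" "L * \<delta>' \<le> \<delta>"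
    using L \<delta>0 \<delta> by (auto simp: \<delta>'_def min_def field_simps)
  have "ennreal (1/L) * hausdorff1_pre \<delta> (f ` S) \<le> hausdorff1_pre \<delta>' S"
    unfolding hausdorff1_pre_def[of \<delta>']
  proof (rule INF_greatest)
    fix U :: "nat \<Rightarrow> 'a set"
    assume "U \<in> {U. S \<subseteq> (\<Union>i. U i) \<and> (\<forall>i. bounded (U i) \<and> diameter (U i) \<le> \<delta>')}"
    then have U: "S \<subseteq> (\<Union>i. U i)" "\<And>i. bounded (U i)" "\<And>i. diameter (U i) \<le> \<delta>'" by auto
    have d: "dist (f x) (f y) \<le> L * diameter (U i)" if "x \<in> U i \<inter> S" "y \<in> U i \<inter> S" for x y i
    proof -
      have "dist x y \<le> diameter (U i)" using U(2) that by (intro diameter_bounded_bound) auto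
      then show ?thesis
        using lip[of x y] that U(3)[of i] \<delta>' L by (smt (verit) IntD2 mult_left_mono)
    qed
    have d': "diameter (f ` (U i \<inter> S)) \<le> L * diameter (U i)" for i
      using d L diameter_ge_0[OF U(2)] by (intro diameter_leI) auto
    have "hausdorff1_pre \<delta> (f ` S) \<le> (\<Sum>i. ennreal (diameter (f ` (U i \<inter> S))))"
    proof (rule hausdorff1_pre_le)
      show "f ` S \<subseteq> (\<Union>i. f ` (U i \<inter> S))" using U(1) by blast
      show "bounded (f ` (U i \<inter> S))" for i
        unfolding bounded_two_points using d by blast
      show "diameter (f ` (U i \<inter> S)) \<le> \<delta>" for i
        using d'[of i] U(3)[of i] \<delta>' L by (smt (verit) mult_left_mono)
    qed
    also have "\<dots> \<le> (\<Sum>i. ennreal L * ennreal (diameter (U i)))"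
      using d' L by (intro suminf_le) (auto simp: ennreal_mult'[symmetric] intro: ennreal_leI)
    also have "\<dots> = ennreal L * (\<Sum>i. ennreal (diameter (U i)))" by simp
    finally have "ennreal (1/L) * hausdorff1_pre \<delta> (f ` S)
        \<le> ennreal (1/L) * (ennreal L * (\<Sum>i. ennreal (diameter (U i))))"
      by (rule mult_left_mono) simp
    also have "\<dots> = (\<Sum>i. ennreal (diameter (U i)))"
      using L by (simp add: mult.assoc[symmetric] ennreal_mult'[symmetric])
    finally show "ennreal (1/L) * hausdorff1_pre \<delta> (f ` S) \<le> (\<Sum>i. ennreal (diameter (U i)))" .
  qed
  also have "\<dots> \<le> hausdorff1 S" using \<delta>'(1) by (rule hausdorff1_pre_le_hausdorff1)
  finally have "ennreal L * (ennreal (1/L) * hausdorff1_pre \<delta> (f ` S)) \<le> ennreal L * hausdorff1 S"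
    by (rule mult_left_mono) simp
  then show "hausdorff1_pre \<delta> (f ` S) \<le> ennreal L * hausdorff1 S"
    using L by (simp add: mult.assoc[symmetric] ennreal_mult'[symmetric])
qed

lemma ennreal_le_add_INF:
  fixes X c :: ennreal
  assumes "\<And>i. i \<in> I \<Longrightarrow> X \<le> c + f i"
  shows "X \<le> c + (INF i\<in>I. f i)"
proof (cases "c = top")
  case False
  then have "X - c \<le> (INF i\<in>I. f i)"
    using assms by (intro INF_greatest) (simp add: ennreal_minus_le_iff)
  then show ?thesis using False by (simp add: ennreal_minus_le_iff)
qed simp

lemma hausdorff1_Un_le: "hausdorff1 (A \<union> B) \<le> hausdorff1 A + hausdorff1 B"
  for A B :: "'a::metric_space set"
proof (rule hausdorff1_leI)
  fix \<delta> :: real assume \<delta>: "\<delta> > 0"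
  let ?C = "\<lambda>A. {U :: nat \<Rightarrow> 'a set. A \<subseteq> (\<Union>i. U i) \<and> (\<forall>i. bounded (U i) \<and> diameter (U i) \<le> \<delta>)}"
  have *: "hausdorff1_pre \<delta> (A \<union> B) \<le> (\<Sum>i. ennreal (diameter (U i))) + (\<Sum>i. ennreal (diameter (V i)))"
    if "U \<in> ?C A" "V \<in> ?C B" for U V
  proof -
    have U: "A \<subseteq> (\<Union>i. U i)" "\<And>i. bounded (U i)" "\<And>i. diameter (U i) \<le> \<delta>"
      and V: "B \<subseteq> (\<Union>i. V i)" "\<And>i. bounded (V i)" "\<And>i. diameter (V i) \<le> \<delta>"
      using that by auto
    define W where "W k = (if even k then U (k div 2) else V (k div 2))" for k
    have "hausdorff1_pre \<delta> (A \<union> B) \<le> (\<Sum>k. ennreal (diameter (W k)))"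
    proof (rule hausdorff1_pre_le)
      have "W (2*i) = U i" "W (2*i+1) = V i" for i by (auto simp: W_def)
      then have "U i \<subseteq> (\<Union>k. W k)" "V i \<subseteq> (\<Union>k. W k)" for i
        by (metis UN_upper UNIV_I)+
      then have "(\<Union>i. U i) \<subseteq> (\<Union>k. W k)" "(\<Union>i. V i) \<subseteq> (\<Union>k. W k)"
        by (auto simp only: UN_subset_iff)
      then show "A \<union> B \<subseteq> (\<Union>k. W k)" using U(1) V(1) by (meson Un_least order_trans)
      show "bounded (W k)" "diameter (W k) \<le> \<delta>" for k
        using U V by (simp_all add: W_def)
    qed
    also have "\<dots> \<le> (\<Sum>i. ennreal (diameter (U i))) + (\<Sum>i. ennreal (diameter (V i)))"
    proof (rule suminf_le_const)
      fix n
      have "(\<Sum>k<n. ennreal (diameter (W k))) \<le> (\<Sum>k<2*n. ennreal (diameter (W k)))"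
        by (intro sum_mono2) auto
      also have "\<dots> = (\<Sum>i<n. ennreal (diameter (U i))) + (\<Sum>i<n. ennreal (diameter (V i)))"
        by (induction n) (simp_all add: W_def ac_simps)
      also have "\<dots> \<le> (\<Sum>i. ennreal (diameter (U i))) + (\<Sum>i. ennreal (diameter (V i)))"
        by (intro add_mono sum_le_suminf) auto
      finally show "(\<Sum>k<n. ennreal (diameter (W k))) \<le> \<dots>" .
    qed simp
    finally show ?thesis .
  qed
  have "hausdorff1_pre \<delta> (A \<union> B) \<le> (\<Sum>i. ennreal (diameter (U i))) + hausdorff1_pre \<delta> B"
    if "U \<in> ?C A" for U
    unfolding hausdorff1_pre_def[of \<delta> B] by (rule ennreal_le_add_INF) (rule *[OF that])
  then have "hausdorff1_pre \<delta> (A \<union> B) \<le> hausdorff1_pre \<delta> B + (\<Sum>i. ennreal (diameter (U i)))"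
    if "U \<in> ?C A" for U
    using that by (simp only: add.commute)
  then have "hausdorff1_pre \<delta> (A \<union> B) \<le> hausdorff1_pre \<delta> B + hausdorff1_pre \<delta> A"
    unfolding hausdorff1_pre_def[of \<delta> A] by (rule ennreal_le_add_INF)
  then have "hausdorff1_pre \<delta> (A \<union> B) \<le> hausdorff1_pre \<delta> A + hausdorff1_pre \<delta> B"
    by (simp add: add.commute)
  also have "\<dots> \<le> hausdorff1 A + hausdorff1 B"
    by (intro add_mono hausdorff1_pre_le_hausdorff1 \<delta>)
  finally show "hausdorff1_pre \<delta> (A \<union> B) \<le> \<dots>" .
qed

lemma hausdorff1_UN_le:
  assumes "finite I"
  shows "hausdorff1 (\<Union>i\<in>I. A i) \<le> (\<Sum>i\<in>I. hausdorff1 (A i))"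
  using assms
proof (induction rule: finite_induct)
  case (insert i I)
  then show ?case
    using order_trans[OF hausdorff1_Un_le[of "A i" "\<Union>i\<in>I. A i"] add_left_mono] by simp
qed simp

text \<open>
  A set of diameter below \<open>d\<close> cannot meet both pieces, so every fine cover of the union splits into a cover of
  \<open>A\<close> and one of \<open>B\<close>.
\<close>

lemma hausdorff1_Un_separated:
  fixes A B :: "'a::metric_space set"
  assumes d: "d > 0" and sep: "\<And>x y. x \<in> A \<Longrightarrow> y \<in> B \<Longrightarrow> d \<le> dist x y"
  shows "hausdorff1 A + hausdorff1 B \<le> hausdorff1 (A \<union> B)"
proof -
  have *: "hausdorff1_pre \<delta> A + hausdorff1_pre \<delta> B \<le> hausdorff1_pre \<delta> (A \<union> B)" if "\<delta> > 0" "\<delta> < d" for \<delta>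
    unfolding hausdorff1_pre_def[of \<delta> "A \<union> B"]
  proof (rule INF_greatest)
    fix U :: "nat \<Rightarrow> 'a set"
    assume "U \<in> {U. A \<union> B \<subseteq> (\<Union>i. U i) \<and> (\<forall>i. bounded (U i) \<and> diameter (U i) \<le> \<delta>)}"
    then have U: "A \<union> B \<subseteq> (\<Union>i. U i)" "\<And>i. bounded (U i)" "\<And>i. diameter (U i) \<le> \<delta>" by auto
    define V where "V C i = (if U i \<inter> C = {} then {} else U i)" for C i
    have V: "hausdorff1_pre \<delta> C \<le> (\<Sum>i. ennreal (diameter (V C i)))" if C: "C \<subseteq> A \<union> B" for C
    proof (rule hausdorff1_pre_le)
      show "C \<subseteq> (\<Union>i. V C i)"
      proof
        fix x assume "x \<in> C"
        then obtain i where "x \<in> U i" using U(1) C by blast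
        then have "x \<in> V C i" using \<open>x \<in> C\<close> by (auto simp: V_def)
        then show "x \<in> (\<Union>i. V C i)" by auto
      qed
    qed (use U(2,3) \<open>\<delta> > 0\<close> in \<open>simp_all add: V_def\<close>)
    have "hausdorff1_pre \<delta> A + hausdorff1_pre \<delta> B
        \<le> (\<Sum>i. ennreal (diameter (V A i))) + (\<Sum>i. ennreal (diameter (V B i)))"
      by (intro add_mono V) auto
    also have "\<dots> = (\<Sum>i. ennreal (diameter (V A i)) + ennreal (diameter (V B i)))"
      by (intro suminf_add) auto
    also have "\<dots> \<le> (\<Sum>i. ennreal (diameter (U i)))"
    proof (intro suminf_le allI)
      fix i
      have "U i \<inter> A = {} \<or> U i \<inter> B = {}"
      proof (rule ccontr)
        assume "\<not> (U i \<inter> A = {} \<or> U i \<inter> B = {})"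
        then obtain x y where "x \<in> U i" "x \<in> A" "y \<in> U i" "y \<in> B" by auto
        then have "d \<le> dist x y" "dist x y \<le> diameter (U i)"
          using sep diameter_bounded_bound[OF U(2)[of i]] by auto
        then show False using U(3)[of i] that by linarith
      qed
      then show "ennreal (diameter (V A i)) + ennreal (diameter (V B i)) \<le> ennreal (diameter (U i))"
        by (auto simp: V_def)
    qed auto
    finally show "hausdorff1_pre \<delta> A + hausdorff1_pre \<delta> B \<le> (\<Sum>i. ennreal (diameter (U i)))" .
  qed
  have **: "hausdorff1_pre \<delta>1 A + hausdorff1_pre \<delta>2 B \<le> hausdorff1 (A \<union> B)" if "\<delta>1 > 0" "\<delta>2 > 0" for \<delta>1 \<delta>2
  proof -
    define \<delta> where "\<delta> = min (d/2) (min \<delta>1 \<delta>2)"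
    have \<delta>: "\<delta> > 0" "\<delta> < d" "\<delta> \<le> \<delta>1" "\<delta> \<le> \<delta>2" using that d by (auto simp: \<delta>_def)
    have "hausdorff1_pre \<delta>1 A + hausdorff1_pre \<delta>2 B \<le> hausdorff1_pre \<delta> A + hausdorff1_pre \<delta> B"
      by (intro add_mono hausdorff1_pre_antimono \<delta>)
    also have "\<dots> \<le> hausdorff1 (A \<union> B)"
      using *[OF \<delta>(1,2)] hausdorff1_pre_le_hausdorff1[OF \<delta>(1)] by (rule order_trans)
    finally show ?thesis .
  qed
  have "hausdorff1_pre \<delta>1 A + hausdorff1 B \<le> hausdorff1 (A \<union> B)" if "\<delta>1 > 0" for \<delta>1
    unfolding hausdorff1_def[of B]
    by (subst ennreal_SUP_add_right) (use **[OF that] in \<open>auto intro!: SUP_least\<close>)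
  then have "(SUP \<delta>1\<in>{0<..}. hausdorff1_pre \<delta>1 A + hausdorff1 B) \<le> hausdorff1 (A \<union> B)"
    by (intro SUP_least) auto
  then show ?thesis
    unfolding hausdorff1_def[of A]
    by (simp add: ennreal_SUP_add_left)
qed

text \<open>
  Disjoint compact sets have positive distance. This form of additivity suffices for lower bounds on length and
  avoids the Caratheodory construction.
\<close>

lemma sum_hausdorff1_le_UN_compact:
  fixes A :: "'i \<Rightarrow> 'a::heine_borel set"
  assumes "finite I" and "\<And>i. i \<in> I \<Longrightarrow> compact (A i)"
    and "\<And>i j. i \<in> I \<Longrightarrow> j \<in> I \<Longrightarrow> i \<noteq> j \<Longrightarrow> A i \<inter> A j = {}"
  shows "(\<Sum>i\<in>I. hausdorff1 (A i)) \<le> hausdorff1 (\<Union>i\<in>I. A i)"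
  using assms
proof (induction rule: finite_induct)
  case (insert i I)
  have "compact (\<Union>j\<in>I. A j)" using insert by (intro compact_UN) auto
  moreover have "A i \<inter> (\<Union>j\<in>I. A j) = {}" using insert by auto
  ultimately have "\<exists>d>0. \<forall>x\<in>A i. \<forall>y\<in>(\<Union>j\<in>I. A j). d \<le> dist x y"
    using insert.prems(1)[of i] by (intro separate_compact_closed compact_imp_closed) auto
  then obtain d where "d > 0" "\<And>x y. x \<in> A i \<Longrightarrow> y \<in> (\<Union>j\<in>I. A j) \<Longrightarrow> d \<le> dist x y"
    by blast
  then have "hausdorff1 (A i) + hausdorff1 (\<Union>j\<in>I. A j) \<le> hausdorff1 (A i \<union> (\<Union>j\<in>I. A j))"
    by (rule hausdorff1_Un_separated)
  then have "hausdorff1 (A i) + (\<Sum>j\<in>I. hausdorff1 (A j)) \<le> hausdorff1 (A i \<union> (\<Union>j\<in>I. A j))"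
    using order_trans[OF add_left_mono[OF insert.IH]] insert.prems by simp
  then show ?case using insert.hyps by simp
qed simp

text \<open>
  A nonempty set of reals of diameter \<open>d\<close> lies between its infimum and its supremum, an interval of length at
  most \<open>d\<close>.
\<close>

lemma emeasure_le_hausdorff1:
  fixes S :: "real set"
  assumes "S \<in> sets lebesgue"
  shows "emeasure lebesgue S \<le> hausdorff1 S"
proof -
  have "emeasure lebesgue S \<le> hausdorff1_pre 1 S"
    unfolding hausdorff1_pre_def
  proof (rule INF_greatest)
    fix U :: "nat \<Rightarrow> real set"
    assume "U \<in> {U. S \<subseteq> (\<Union>i. U i) \<and> (\<forall>i. bounded (U i) \<and> diameter (U i) \<le> 1)}"
    then have U: "S \<subseteq> (\<Union>i. U i)" "\<And>i. bounded (U i)" by auto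
    define J where "J i = (if U i = {} then {} else {Inf (U i)..Sup (U i)})" for i
    have UJ: "U i \<subseteq> J i" for i
      using U(2)[of i] by (auto simp: J_def bounded_imp_bdd_above bounded_imp_bdd_below cInf_lower cSup_upper)
    have "emeasure lebesgue (J i) \<le> ennreal (diameter (U i))" for i
    proof (cases "U i = {}")
      case False
      have "Sup (U i) \<le> y + diameter (U i)" if "y \<in> U i" for y
      proof (rule cSup_least[OF False])
        fix x assume "x \<in> U i"
        then show "x \<le> y + diameter (U i)"
          using diameter_bounded_bound[OF U(2)[of i], of x y] that by (auto simp: dist_real_def)
      qed
      then have "Sup (U i) - diameter (U i) \<le> Inf (U i)"
        using False by (intro cInf_greatest) (auto simp: algebra_simps)
      moreover have "Inf (U i) \<le> Sup (U i)"
        using False U(2)[of i] by (meson bounded_imp_bdd_above bounded_imp_bdd_below cInf_le_cSup)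
      ultimately show ?thesis using False by (auto simp: J_def intro!: ennreal_leI)
    qed (simp add: J_def)
    then have *: "(\<Sum>i. emeasure lebesgue (J i)) \<le> (\<Sum>i. ennreal (diameter (U i)))"
      by (intro suminf_le) auto
    have "J i \<in> sets lebesgue" for i by (auto simp: J_def)
    moreover have "S \<subseteq> (\<Union>i. J i)" using U(1) UJ by blast
    ultimately have "emeasure lebesgue S \<le> emeasure lebesgue (\<Union>i. J i)"
      by (intro emeasure_mono) auto
    also have "\<dots> \<le> (\<Sum>i. emeasure lebesgue (J i))"
      using \<open>\<And>i. J i \<in> sets lebesgue\<close> by (intro emeasure_subadditive_countably) auto
    finally show "emeasure lebesgue S \<le> (\<Sum>i. ennreal (diameter (U i)))" using * by order
  qed
  also have "\<dots> \<le> hausdorff1 S" by (rule hausdorff1_pre_le_hausdorff1) simp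
  finally show ?thesis .
qed

text \<open>
  An open set \<open>T\<close> of almost the same measure contains \<open>S\<close>. A cover of \<open>S\<close> by nonoverlapping intervals inside
  \<open>T\<close> has total length at most the measure of \<open>T\<close>, and a suitable gauge makes the intervals as short as desired.
\<close>

lemma hausdorff1_le_emeasure:
  fixes S :: "real set"
  assumes S: "S \<in> sets lebesgue" and Sab: "S \<subseteq> {a..b}"
  shows "hausdorff1 S \<le> emeasure lebesgue S"
proof (rule hausdorff1_leI)
  fix \<delta> :: real assume \<delta>: "\<delta> > 0"
  show "hausdorff1_pre \<delta> S \<le> emeasure lebesgue S"
  proof (rule ennreal_le_epsilon)
    fix e :: real assume "e > 0"
    then obtain T where T: "open T" "S \<subseteq> T" "emeasure lebesgue (T - S) < ennreal e"
      using sets_lebesgue_outer_open[OF S] by metis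
    define \<gamma> where "\<gamma> x = (if x \<in> T then T else UNIV) \<inter> ball x (\<delta>/2)" for x
    have "gauge \<gamma>" using T(1) \<delta> by (auto simp: gauge_def \<gamma>_def)
    moreover have "S \<subseteq> cbox (min a b) (max a b + 1)" "box (min a b) (max a b + 1) \<noteq> {}"
      using Sab by auto
    ultimately obtain D where D: "countable D"
      "\<And>K. K \<in> D \<Longrightarrow> interior K \<noteq> {} \<and> (\<exists>c d. K = cbox c d)"
      "pairwise (\<lambda>A B. interior A \<inter> interior B = {}) D"
      "\<And>K. K \<in> D \<Longrightarrow> \<exists>x \<in> S \<inter> K. K \<subseteq> \<gamma> x" "S \<subseteq> \<Union>D"
      using covering_lemma[of S "min a b" "max a b + 1" \<gamma>] by (metis (no_types, lifting))
    have DT: "K \<subseteq> T" "diameter K \<le> \<delta>" if "K \<in> D" for K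
    proof -
      obtain x where x: "x \<in> S" "K \<subseteq> \<gamma> x" using D(4)[OF \<open>K \<in> D\<close>] by auto
      then have K: "K \<subseteq> T" "K \<subseteq> ball x (\<delta>/2)" using T(2) by (auto simp: \<gamma>_def split: if_splits)
      show "K \<subseteq> T" by fact
      show "diameter K \<le> \<delta>"
        using diameter_subset[OF K(2)] \<delta> by simp
    qed
    have Dm: "ennreal (diameter K) = emeasure lebesgue (interior K)" if "K \<in> D" for K
      using D(2)[OF that] by (auto simp: interior_cbox)
    \<comment> \<open>Enumerating \<open>D\<close> without repetition matters: a repeated interval would be counted twice in the sum.\<close>
    define U where "U n = (if n \<in> to_nat_on D ` D then from_nat_into D n else {})" for n
    have UD: "U n \<in> D \<or> U n = {}" for n
      unfolding U_def using from_nat_into[of D n] by auto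
    have "U (to_nat_on D K) = K" if "K \<in> D" for K
      using that D(1) by (simp add: U_def)
    then have "S \<subseteq> (\<Union>n. U n)" using D(5) by blast
    then have "hausdorff1_pre \<delta> S \<le> (\<Sum>n. ennreal (diameter (U n)))"
    proof (rule hausdorff1_pre_le)
      show "bounded (U n)" for n using UD[of n] D(2) by (metis bounded_cbox bounded_empty)
      show "diameter (U n) \<le> \<delta>" for n using UD[of n] DT(2) \<delta> by fastforce
    qed
    also have "\<dots> = (\<Sum>n. emeasure lebesgue (interior (U n)))"
    proof (rule suminf_cong)
      show "ennreal (diameter (U n)) = emeasure lebesgue (interior (U n))" for n
        using UD[of n] Dm by auto
    qed
    also have "\<dots> = emeasure lebesgue (\<Union>n. interior (U n))"
    proof (rule suminf_emeasure)
      show "disjoint_family (\<lambda>n. interior (U n))"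
        unfolding disjoint_family_on_def
      proof (intro ballI impI)
        fix m n :: nat assume "m \<noteq> n"
        have "U m \<noteq> U n" if "m \<in> to_nat_on D ` D" "n \<in> to_nat_on D ` D"
          using that \<open>m \<noteq> n\<close> D(1) by (auto simp: U_def)
        moreover have "U m \<in> D" "U n \<in> D" if "m \<in> to_nat_on D ` D" "n \<in> to_nat_on D ` D"
          using that D(1) by (auto simp: U_def)
        moreover have "U m = {} \<or> m \<in> to_nat_on D ` D" "U n = {} \<or> n \<in> to_nat_on D ` D"
          by (auto simp: U_def)
        ultimately show "interior (U m) \<inter> interior (U n) = {}"
          using D(3) unfolding pairwise_def by (metis Int_empty_left Int_empty_right interior_empty)
      qed
    qed auto
    also have "\<dots> \<le> emeasure lebesgue T"
      using UD DT(1) interior_subset T(1) by (intro emeasure_mono) (fastforce, auto)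
    also have "\<dots> \<le> emeasure lebesgue (S \<union> (T - S))"
      using T(1) S by (intro emeasure_mono) auto
    also have "\<dots> \<le> emeasure lebesgue S + emeasure lebesgue (T - S)"
      using T(1) S by (intro emeasure_subadditive) auto
    also have "\<dots> \<le> emeasure lebesgue S + ennreal e"
      using T(3) by (intro add_left_mono) auto
    finally show "hausdorff1_pre \<delta> S \<le> emeasure lebesgue S + ennreal e" .
  qed
qed

lemma hausdorff1_eq_emeasure:
  fixes S :: "real set"
  assumes "S \<in> sets lebesgue" and "S \<subseteq> {a..b}"
  shows "hausdorff1 S = emeasure lebesgue S"
  using assms by (intro antisym hausdorff1_le_emeasure emeasure_le_hausdorff1)

section \<open>Arc length on the unit circle\<close>

definition dir :: "real \<Rightarrow> real^2" where "dir t = vector [cos t, sin t]"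
definition tang :: "real \<Rightarrow> real^2" where "tang t = vector [- sin t, cos t]"

lemma inner_real2: "x \<bullet> y = x$1 * y$1 + x$2 * y$2" for x y :: "real^2"
  by (simp add: inner_vec_def sum_2)

lemma dir_nth [simp]: "dir t $ 1 = cos t" "dir t $ 2 = sin t"
  and tang_nth [simp]: "tang t $ 1 = - sin t" "tang t $ 2 = cos t"
  by (simp_all add: dir_def tang_def)

lemma inner_dir_tang [simp]:
  "dir t \<bullet> dir t = 1" "tang t \<bullet> tang t = 1" "dir t \<bullet> tang t = 0" "tang t \<bullet> dir t = 0"
  using sin_cos_squared_add3[of t] by (auto simp: inner_real2 algebra_simps)

lemma norm_dir [simp]: "norm (dir t) = 1" "norm (tang t) = 1"
  by (simp_all add: norm_eq_sqrt_inner)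

lemma frame_decomp: "x = (x \<bullet> dir t) *\<^sub>R dir t + (x \<bullet> tang t) *\<^sub>R tang t"
proof -
  have cs: "cos t * cos t + sin t * sin t = 1" by (rule sin_cos_squared_add3)
  have "x$1 = (x$1 * cos t + x$2 * sin t) * cos t + (x$2 * cos t - x$1 * sin t) * - sin t"
    using cs by algebra
  moreover have "x$2 = (x$1 * cos t + x$2 * sin t) * sin t + (x$2 * cos t - x$1 * sin t) * cos t"
    using cs by algebra
  ultimately show ?thesis by (simp add: vec_eq_iff forall_2 inner_real2)
qed

lemma frame_inner: "x \<bullet> y = (x \<bullet> dir t) * (y \<bullet> dir t) + (x \<bullet> tang t) * (y \<bullet> tang t)"
proof -
  have "x \<bullet> y = ((x \<bullet> dir t) *\<^sub>R dir t + (x \<bullet> tang t) *\<^sub>R tang t) \<bullet> y"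
    using frame_decomp[of x t] by simp
  also have "\<dots> = (x \<bullet> dir t) * (y \<bullet> dir t) + (x \<bullet> tang t) * (y \<bullet> tang t)"
    unfolding inner_add_left inner_scaleR_left by (simp add: inner_commute)
  finally show ?thesis .
qed

lemma frame_norm: "(norm x)\<^sup>2 = (x \<bullet> dir t)\<^sup>2 + (x \<bullet> tang t)\<^sup>2"
  unfolding power2_norm_eq_inner frame_inner[of x x t] by (simp add: power2_eq_square)

lemma dir_add: "dir (s + t) = cos t *\<^sub>R dir s + sin t *\<^sub>R tang s"
  and tang_add: "tang (s + t) = cos t *\<^sub>R tang s - sin t *\<^sub>R dir s"
  by (auto simp: vec_eq_iff forall_2 cos_add sin_add)

lemma dir_periodic [simp]: "dir (t + 2 * pi) = dir t" and tang_periodic [simp]: "tang (t + 2 * pi) = tang t"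
  by (simp_all add: dir_def tang_def)

lemma dir_eq_axis: "dir t = cos t *\<^sub>R axis 1 1 + sin t *\<^sub>R axis 2 1"
  and tang_eq_axis: "tang t = - sin t *\<^sub>R axis 1 1 + cos t *\<^sub>R axis 2 1"
  by (simp_all add: vec_eq_iff forall_2 axis_def)

lemma continuous_on_dir [continuous_intros]: "continuous_on A dir"
  and continuous_on_tang [continuous_intros]: "continuous_on A tang"
  unfolding dir_eq_axis[abs_def] tang_eq_axis[abs_def] by (intro continuous_intros)+

lemma unit_eq_dir:
  assumes "norm (v :: real^2) = 1"
  obtains t where "0 \<le> t" "t < 2 * pi" "v = dir t"
proof -
  have "(v$1)\<^sup>2 + (v$2)\<^sup>2 = 1"
    using assms by (simp add: norm_eq_sqrt_inner inner_real2 power2_eq_square)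
  then obtain t where "0 \<le> t" "t < 2 * pi" "v$1 = cos t" "v$2 = sin t"
    by (metis sincos_total_2pi)
  then show ?thesis using that by (auto simp: vec_eq_iff forall_2)
qed

lemma dir_inj_on: "inj_on dir {0..<2*pi}"
proof (rule inj_onI)
  fix s t assume st: "s \<in> {0..<2*pi}" "t \<in> {0..<2*pi}" "dir s = dir t"
  then have "sin s = sin t \<and> cos s = cos t" by (auto simp: vec_eq_iff forall_2)
  then obtain n :: int where n: "s = t + 2 * pi * of_int n"
    unfolding sin_cos_eq_iff by auto
  have "\<bar>s - t\<bar> < 2 * pi" using st by auto
  then have "2 * pi * \<bar>of_int n\<bar> < 2 * pi * 1" using n by (simp add: abs_mult)
  then have "n = 0" using pi_gt_zero by simp
  then show "s = t" using n by simp
qed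

lemma dist_dir: "dist (dir s) (dir t) = 2 * \<bar>sin ((s - t) / 2)\<bar>"
proof -
  have "(dist (dir s) (dir t))\<^sup>2 = (cos s - cos t)\<^sup>2 + (sin s - sin t)\<^sup>2"
    by (simp only: dist_norm power2_norm_eq_inner) (simp add: inner_real2 power2_eq_square)
  also have "\<dots> = 2 - 2 * cos (s - t)"
    using sin_cos_squared_add[of s] sin_cos_squared_add[of t]
    by (simp add: power2_diff cos_diff algebra_simps)
  also have "\<dots> = (2 * \<bar>sin ((s - t) / 2)\<bar>)\<^sup>2"
    using cos_double_sin[of "(s - t) / 2"] by (simp only: times_divide_eq_right nonzero_mult_div_cancel_left power_mult_distrib) simp
  finally show ?thesis by (rule power2_eq_imp_eq) auto
qed

lemma dist_dir_le: "dist (dir s) (dir t) \<le> dist s t"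
  using abs_sin_x_le_abs_x[of "(s - t) / 2"] by (simp add: dist_dir dist_real_def)

lemma ennreal_le_of_le_mult:
  fixes a b :: ennreal
  assumes "\<And>L. L > 1 \<Longrightarrow> a \<le> ennreal L * b" and "b < top"
  shows "a \<le> b"
proof -
  have "a < top" using assms(1)[of 2] assms(2) by (metis ennreal_less_top ennreal_mult_less_top le_less_trans one_less_numeral_iff semiring_norm(76))
  then obtain x y where xy: "a = ennreal x" "b = ennreal y" "x \<ge> 0" "y \<ge> 0"
    using assms(2) by (metis ennreal_cases less_irrefl infinity_ennreal_def)
  have "x \<le> y"
  proof (rule field_le_mult_one_interval)
    fix z :: real assume z: "0 < z" "z < 1"
    then have "x \<le> (1/z) * y"
      using assms(1)[of "1/z"] xy by (simp add: ennreal_mult'[symmetric] ennreal_le_iff)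
    then show "z * x \<le> y" using z by (simp add: field_simps)
  qed
  then show ?thesis using xy by (simp add: ennreal_leI)
qed

text \<open>
  The chord between two directions at angular distance \<open>2 u\<close> is \<open>2 sin u\<close>, which is comparable to \<open>2 u\<close> with a
  constant near 1 once the chord is short. The margin \<open>e\<close> keeps \<open>u\<close> away from \<open>pi\<close>, where a short chord does not
  mean nearby angles.
\<close>

lemma hausdorff1_dir_image_inner:
  assumes T: "T \<in> sets lebesgue" "T \<subseteq> {e..2*pi - e}" and e: "0 < e" "e < 1" and L: "L > 1"
  shows "emeasure lebesgue T \<le> ennreal L * hausdorff1 (dir ` T)"
proof -
  have "((\<lambda>u. sin u / u) \<longlongrightarrow> (1::real)) (at_right 0)" by real_asymp
  then have "eventually (\<lambda>u::real. 1/L < sin u / u) (at_right 0)"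
    using L by (intro order_tendstoD) auto
  then obtain u0 :: real where u0: "u0 > 0" "\<And>u. 0 < u \<Longrightarrow> u < u0 \<Longrightarrow> 1/L < sin u / u"
    unfolding eventually_at_right_field by auto
  \<comment> \<open>A chord shorter than \<open>sin u1\<close> forces the half-angle below \<open>u1\<close>.\<close>
  define u1 where "u1 = min u0 e"
  have u1: "0 < u1" "u1 \<le> u0" "u1 \<le> e" "u1 < 1" using u0(1) e by (auto simp: u1_def)
  have pi2: "2 < pi" using pi_gt3 by simp
  have near: "\<bar>u\<bar> \<le> L * \<bar>sin u\<bar>" if "\<bar>u\<bar> \<le> pi - e" "\<bar>sin u\<bar> < sin u1" for u
  proof -
    have *: "u \<le> L * sin u" if u: "0 < u" "u \<le> pi - e" "sin u < sin u1" for u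
    proof -
      have "u < u1"
      proof (rule ccontr)
        assume "\<not> u < u1"
        then have "sin u1 \<le> sin u"
        proof (cases "u \<le> pi/2")
          case True
          then show ?thesis using \<open>\<not> u < u1\<close> u1 pi2 by (intro sin_monotone_2pi_le) auto
        next
          case False
          have "sin u1 \<le> sin (pi - u)" using False u u1 pi2 by (intro sin_monotone_2pi_le) auto
          then show ?thesis by simp
        qed
        then show False using u(3) by simp
      qed
      then show ?thesis using u0(2)[of u] u u1 L by (auto simp: field_simps)
    qed
    consider "u = 0" | "u > 0" | "u < 0" by linarith
    then show ?thesis
    proof cases
      case 2
      then have "sin u \<ge> 0" using that e by (intro sin_ge_zero) auto
      then show ?thesis using * 2 that by auto
    next
      case 3
      then have "sin (-u) \<ge> 0" using that e by (intro sin_ge_zero) auto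
      then show ?thesis using *[of "-u"] 3 that by auto
    qed simp
  qed
  have inj: "inj_on dir T"
    by (rule inj_on_subset[OF dir_inj_on]) (use T e in auto)
  have eq: "(inv_into T dir) ` (dir ` T) = T" using inj by (simp add: inv_into_image_cancel)
  have "sin u1 > 0" using u1 pi2 by (intro sin_gt_zero) auto
  have "hausdorff1 (inv_into T dir ` (dir ` T)) \<le> ennreal L * hausdorff1 (dir ` T)"
  proof (rule hausdorff1_image_le[of L "sin u1"])
    fix x y assume xy: "x \<in> dir ` T" "y \<in> dir ` T" "dist x y \<le> sin u1"
    then obtain s t where st: "s \<in> T" "t \<in> T" "x = dir s" "y = dir t" by auto
    have "2 * \<bar>sin ((s - t) / 2)\<bar> \<le> sin u1" using xy(3) st by (simp add: dist_dir)
    moreover have "s \<in> {e..2*pi - e}" "t \<in> {e..2*pi - e}" using st T(2) by auto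
    then have "\<bar>(s - t) / 2\<bar> \<le> pi - e" by (auto simp: abs_if field_simps)
    ultimately have "\<bar>(s - t) / 2\<bar> \<le> L * \<bar>sin ((s - t) / 2)\<bar>"
      using \<open>sin u1 > 0\<close> by (intro near) auto
    then show "dist (inv_into T dir x) (inv_into T dir y) \<le> L * dist x y"
      using st inj by (simp add: dist_dir dist_real_def)
  qed (use L \<open>sin u1 > 0\<close> in auto)
  then show ?thesis using eq hausdorff1_eq_emeasure[OF T] by simp
qed

text \<open>
  \<open>dir\<close> does not increase distances, which gives one inequality. For the other, small margins at both ends of
  \<open>[0, 2 pi)\<close> are removed and then shrunk to nothing.
\<close>

lemma hausdorff1_dir_image:
  assumes T: "T \<in> sets lebesgue" "T \<subseteq> {0..<2*pi}"
  shows "hausdorff1 (dir ` T) = emeasure lebesgue T"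
proof (rule antisym)
  have T': "T \<subseteq> {0..2*pi}" using T(2) by auto
  have "hausdorff1 (dir ` T) \<le> ennreal 1 * hausdorff1 T"
    using dist_dir_le by (intro hausdorff1_image_le[of 1 1]) auto
  then show le: "hausdorff1 (dir ` T) \<le> emeasure lebesgue T"
    using hausdorff1_eq_emeasure[OF T(1) T'] by simp
  have "emeasure lebesgue T \<le> emeasure lebesgue {0..2*pi}"
    using T' T(1) by (intro emeasure_mono) auto
  also have "\<dots> < top" by simp
  finally have fin: "hausdorff1 (dir ` T) < top" using le by order
  show "emeasure lebesgue T \<le> hausdorff1 (dir ` T)"
  proof (rule ennreal_le_epsilon)
    fix e' :: real assume "e' > 0"
    define e where "e = min (1/2) (e'/2)"
    have e: "e > 0" "e < 1" "2 * e \<le> e'" using \<open>e' > 0\<close> by (auto simp: e_def)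
    let ?T = "T \<inter> {e..2*pi-e}"
    have mT: "?T \<in> sets lebesgue" using T by auto
    have Tm: "hausdorff1 (dir ` ?T) \<le> hausdorff1 (dir ` T)" by (intro hausdorff1_mono) auto
    have "emeasure lebesgue ?T \<le> hausdorff1 (dir ` ?T)"
      by (rule ennreal_le_of_le_mult[OF hausdorff1_dir_image_inner[OF mT _ e(1,2)]]) (use Tm fin in auto)
    then have T1: "emeasure lebesgue ?T \<le> hausdorff1 (dir ` T)" using Tm by (rule order_trans)
    let ?J = "{0..e} \<union> {2*pi-e..2*pi}"
    have "emeasure lebesgue ?J \<le> emeasure lebesgue {0..e} + emeasure lebesgue {2*pi-e..2*pi}"
      by (intro emeasure_subadditive) auto
    also have "\<dots> = ennreal (2 * e)" using e by (simp add: ennreal_plus[symmetric] del: ennreal_plus)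
    also have "\<dots> \<le> ennreal e'" using e by (intro ennreal_leI)
    finally have J: "emeasure lebesgue ?J \<le> ennreal e'" .
    have "emeasure lebesgue T \<le> emeasure lebesgue (?T \<union> ?J)"
      by (rule emeasure_mono) (use T(2) mT in auto)
    also have "\<dots> \<le> emeasure lebesgue ?T + emeasure lebesgue ?J"
      using mT by (intro emeasure_subadditive) auto
    also have "\<dots> \<le> hausdorff1 (dir ` T) + ennreal e'"
      by (rule add_mono[OF T1 J])
    finally show "emeasure lebesgue T \<le> hausdorff1 (dir ` T) + ennreal e'" .
  qed
qed

section \<open>Lipschitz functions and a Dirichlet inequality\<close>

text \<open>
  The exceptional set may be any null set. The difference quotients of a Lipschitz function are bounded and
  converge off a null set, while their integrals are differences of two averages of \<open>F\<close> over short intervals,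
  one to the right of \<open>b\<close> and one to the right of \<open>a\<close>; dominated convergence gives the claim.
\<close>

lemma fundamental_theorem_of_calculus_lipschitz:
  fixes F :: "real \<Rightarrow> real"
  assumes ab: "a \<le> b" and lip: "L-lipschitz_on {a..b} F" and S: "negligible S"
    and deriv: "\<And>x. x \<in> {a<..<b} - S \<Longrightarrow> (F has_real_derivative F' x) (at x)"
  shows "(F' has_integral F b - F a) {a..b}"
proof -
  have L0: "L \<ge> 0" using lip by (rule lipschitz_on_nonneg)
  \<comment> \<open>The constant extension beyond the interval makes forward differences available up to \<open>b\<close>.\<close>
  define G where "G x = F (max a (min b x))" for x
  have Glip: "\<bar>G x - G y\<bar> \<le> L * \<bar>x - y\<bar>" for x y
  proof -
    have "\<bar>G x - G y\<bar> \<le> L * \<bar>max a (min b x) - max a (min b y)\<bar>"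
      using lipschitz_onD[OF lip, of "max a (min b x)" "max a (min b y)"] ab
      by (auto simp: G_def dist_real_def)
    also have "\<dots> \<le> L * \<bar>x - y\<bar>" using L0 by (intro mult_left_mono) auto
    finally show ?thesis .
  qed
  have "L-lipschitz_on UNIV G" using Glip L0 by (intro lipschitz_onI) (auto simp: dist_real_def)
  then have Gcont: "continuous_on A G" for A
    using lipschitz_on_continuous_on continuous_on_subset by blast
  have Gint: "G integrable_on {u..v}" for u v
    by (intro integrable_continuous_interval Gcont)
  have GF: "G a = F a" "G b = F b" using ab by (auto simp: G_def)
  define c where "c n = 1 / (real n + 1)" for n
  have c: "c n > 0" "c n \<le> 1" for n by (auto simp: c_def)
  define f where "f n x = (G (x + c n) - G x) / c n" for n x
  define T where "T = S \<union> {a, b}"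
  have T: "negligible T" unfolding T_def using S by auto
  define I where "I n = (integral {b..b + c n} G - integral {a..a + c n} G) / c n" for n
  have fI: "(f n has_integral I n) {a..b}" for n
  proof -
    have "integral {a..b} (\<lambda>x. G (x + c n)) = integral {a + c n..b + c n} G"
      using integral_shift[OF Gcont, of a b "c n"] by (simp add: o_def)
    moreover have "integral {a..b} G + integral {b..b + c n} G = integral {a..b + c n} G"
      using ab c[of n] Gint by (intro Henstock_Kurzweil_Integration.integral_combine) auto
    moreover have "integral {a..a + c n} G + integral {a + c n..b + c n} G = integral {a..b + c n} G"
      using ab c[of n] Gint by (intro Henstock_Kurzweil_Integration.integral_combine) auto
    ultimately have "integral {a..b} (\<lambda>x. G (x + c n)) - integral {a..b} G
        = integral {b..b + c n} G - integral {a..a + c n} G" by linarith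
    moreover have "(\<lambda>x. G (x + c n)) integrable_on {a..b}"
      by (intro integrable_continuous_interval continuous_on_compose2[OF Gcont[of UNIV]] continuous_intros) auto
    then have "((\<lambda>x. G (x + c n) - G x) has_integral
        integral {a..b} (\<lambda>x. G (x + c n)) - integral {a..b} G) {a..b}"
      by (intro has_integral_diff integrable_integral Gint)
    ultimately have "((\<lambda>x. G (x + c n) - G x) has_integral (I n * c n)) {a..b}"
      using c[of n] by (simp add: I_def)
    from has_integral_divide[OF this, of "c n"] show ?thesis
      using c[of n] by (simp add: f_def[abs_def])
  qed
  have avg: "\<bar>integral {x..x + c n} G - G x * c n\<bar> \<le> (L * c n) * c n" for x n
  proof -
    have "((\<lambda>y. G y - G x) has_integral integral {x..x + c n} G - c n *\<^sub>R G x) {x..x + c n}"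
      using has_integral_const_real[of "G x" x "x + c n"] c[of n]
      by (intro has_integral_diff integrable_integral Gint) auto
    moreover have "\<bar>G y - G x\<bar> \<le> L * c n" if "y \<in> {x..x + c n}" for y
    proof -
      have "L * \<bar>y - x\<bar> \<le> L * c n" using L0 that by (intro mult_left_mono) auto
      then show ?thesis using Glip[of y x] by linarith
    qed
    ultimately have "norm (integral {x..x + c n} G - c n *\<^sub>R G x) \<le> (L * c n) * measure lborel {x..x + c n}"
      using L0 c[of n] by (intro has_integral_bound_real[where f = "\<lambda>y. G y - G x"]) auto
    then show ?thesis using c[of n] by (simp add: mult.commute)
  qed
  have cn: "c \<longlonglongrightarrow> 0" unfolding c_def by real_asymp
  have I: "I \<longlonglongrightarrow> F b - F a"
  proof (rule LIM_zero_cancel)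
    have "\<bar>I n - (F b - F a)\<bar> \<le> 2 * L * c n" for n
    proof -
      have "\<bar>I n - (F b - F a)\<bar> * c n = \<bar>(I n - (F b - F a)) * c n\<bar>" using c[of n] by (simp add: abs_mult)
      also have "\<dots> = \<bar>(integral {b..b + c n} G - G b * c n) - (integral {a..a + c n} G - G a * c n)\<bar>"
      proof -
        have "I n * c n = integral {b..b + c n} G - integral {a..a + c n} G"
          using c[of n] by (simp add: I_def)
        then show ?thesis by (simp add: GF algebra_simps)
      qed
      also have "\<dots> \<le> (2 * L * c n) * c n" using avg[of b n] avg[of a n] by (simp add: abs_if split: if_splits)
      finally show ?thesis using c[of n] by simp
    qed
    then show "(\<lambda>n. I n - (F b - F a)) \<longlonglongrightarrow> 0"
      by (intro Lim_null_comparison[OF _ tendsto_mult_right_zero[OF cn, of "2 * L"]]) simp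
  qed
  define f' where "f' n x = (if x \<in> T then 0 else f n x)" for n x
  define g where "g x = (if x \<in> T then 0 else F' x)" for x
  have "(g has_integral F b - F a) {a..b}"
  proof (rule has_integral_dominated_convergence)
    show "(f' n has_integral I n) {a..b}" for n
      by (rule has_integral_spike[OF T _ fI]) (auto simp: f'_def)
    show "(\<lambda>_. L) integrable_on {a..b}" by auto
    show "\<forall>x\<in>{a..b}. norm (f' n x) \<le> L" for n
    proof
      fix x
      have "\<bar>G (x + c n) - G x\<bar> \<le> L * c n" using Glip[of "x + c n" x] c[of n] by simp
      then show "norm (f' n x) \<le> L"
        using c[of n] L0 by (simp add: f'_def f_def divide_simps)
    qed
    show "\<forall>x\<in>{a..b}. (\<lambda>n. f' n x) \<longlonglongrightarrow> g x"
    proof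
      fix x assume x: "x \<in> {a..b}"
      show "(\<lambda>n. f' n x) \<longlonglongrightarrow> g x"
      proof (cases "x \<in> T")
        case False
        then have x': "x \<in> {a<..<b} - S" using x by (auto simp: T_def)
        have "(G has_real_derivative F' x) (at x)"
          by (rule has_field_derivative_transform_within_open[OF deriv[OF x'], of "{a<..<b}"])
            (use x' in \<open>auto simp: G_def\<close>)
        then have "(\<lambda>h. (G (x + h) - G x) / h) \<midarrow>0\<rightarrow> F' x"
          by (rule DERIV_D)
        moreover have "filterlim c (at 0) sequentially"
          using cn c(1) by (simp add: filterlim_at less_imp_neq[symmetric])
        ultimately have "(\<lambda>n. (G (x + c n) - G x) / c n) \<longlonglongrightarrow> F' x"
          by (rule filterlim_compose)
        then show ?thesis using False by (simp add: f'_def g_def f_def)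
      qed (simp add: f'_def g_def)
    qed
    show "I \<longlonglongrightarrow> F b - F a" by (rule I)
  qed
  from has_integral_spike[OF T _ this, of F'] show ?thesis by (simp add: g_def)
qed

definition lipschitz_fun_on :: "real set \<Rightarrow> (real \<Rightarrow> real) \<Rightarrow> bool" where
  "lipschitz_fun_on A f \<longleftrightarrow> (\<exists>L. L-lipschitz_on A f)"

lemma lipschitz_fun_on_mult:
  assumes f: "lipschitz_fun_on {a..b} f" and g: "lipschitz_fun_on {a..b} g"
  shows "lipschitz_fun_on {a..b} (\<lambda>x. f x * g x)"
proof -
  obtain L M where L: "L-lipschitz_on {a..b} f" and M: "M-lipschitz_on {a..b} g"
    using f g by (auto simp: lipschitz_fun_on_def)
  have "compact (f ` {a..b})" "compact (g ` {a..b})"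
    using L M lipschitz_on_continuous_on by (blast intro: compact_continuous_image)+
  then obtain A B where A: "\<And>x. x \<in> {a..b} \<Longrightarrow> \<bar>f x\<bar> \<le> A" and B: "\<And>x. x \<in> {a..b} \<Longrightarrow> \<bar>g x\<bar> \<le> B"
    by (metis compact_imp_bounded bounded_iff imageI real_norm_def)
  have LM: "L \<ge> 0" "M \<ge> 0" using L M lipschitz_on_nonneg by auto
  have "(\<bar>A\<bar> * M + L * \<bar>B\<bar>)-lipschitz_on {a..b} (\<lambda>x. f x * g x)"
  proof (rule lipschitz_onI)
    fix x y assume xy: "x \<in> {a..b}" "y \<in> {a..b}"
    have "\<bar>f x * g x - f y * g y\<bar> = \<bar>f x * (g x - g y) + (f x - f y) * g y\<bar>" by (simp add: algebra_simps)
    also have "\<dots> \<le> \<bar>f x\<bar> * \<bar>g x - g y\<bar> + \<bar>f x - f y\<bar> * \<bar>g y\<bar>"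
      by (metis abs_mult abs_triangle_ineq)
    also have "\<dots> \<le> \<bar>A\<bar> * (M * \<bar>x - y\<bar>) + (L * \<bar>x - y\<bar>) * \<bar>B\<bar>"
      using lipschitz_onD[OF L xy] lipschitz_onD[OF M xy] A[OF xy(1)] B[OF xy(2)] LM
      by (intro add_mono mult_mono) (auto simp: dist_real_def)
    finally show "dist (f x * g x) (f y * g y) \<le> (\<bar>A\<bar> * M + L * \<bar>B\<bar>) * dist x y"
      by (simp add: dist_real_def algebra_simps)
  qed (use LM in auto)
  then show ?thesis by (auto simp: lipschitz_fun_on_def)
qed

lemma lipschitz_fun_on_C1:
  fixes f :: "real \<Rightarrow> real"
  assumes "\<And>x. x \<in> {a..b} \<Longrightarrow> (f has_real_derivative f' x) (at x)" and "continuous_on {a..b} f'"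
  shows "lipschitz_fun_on {a..b} f"
proof -
  have "compact (f' ` {a..b})" using assms(2) by (intro compact_continuous_image) auto
  then obtain B where B: "\<And>x. x \<in> {a..b} \<Longrightarrow> \<bar>f' x\<bar> \<le> B"
    by (metis compact_imp_bounded bounded_iff imageI real_norm_def)
  have "\<bar>B\<bar>-lipschitz_on {a..b} f"
  proof (rule bounded_derivative_imp_lipschitz)
    show "(f has_derivative (*) (f' x)) (at x within {a..b})" if "x \<in> {a..b}" for x
      using assms(1)[OF that] by (simp add: has_field_derivative_def has_derivative_at_withinI)
    show "onorm ((*) (f' x)) \<le> \<bar>B\<bar>" if "x \<in> {a..b}" for x
      using B[OF that] by (intro onorm_le) (auto simp: abs_mult intro!: mult_right_mono)
  qed auto
  then show ?thesis by (auto simp: lipschitz_fun_on_def)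
qed

text \<open>
  The constant 4 is the first Dirichlet eigenvalue of an interval of length \<open>pi/2\<close>. For \<open>k < 2\<close> the function
  \<open>cos (k (t - m))\<close>, centred at the midpoint \<open>m\<close>, is positive on the closed interval. With its logarithmic
  derivative \<open>p\<close>, the integrand \<open>g\<^sup>2 - k\<^sup>2 f\<^sup>2\<close> is the square of \<open>g - p f\<close> plus the derivative of \<open>f\<^sup>2 p\<close>,
  which integrates to zero because \<open>f\<close> vanishes at both ends. Then \<open>k\<close> tends to 2.
\<close>

lemma dirichlet_inequality_quarter:
  fixes f g :: "real \<Rightarrow> real"
  assumes lip: "lipschitz_fun_on {a..a + pi/2} f" and S: "negligible S"
    and deriv: "\<And>x. x \<in> {a<..<a + pi/2} - S \<Longrightarrow> (f has_real_derivative g x) (at x)"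
    and ends: "f a = 0" "f (a + pi/2) = 0"
    and int: "(\<lambda>x. (g x)\<^sup>2) integrable_on {a..a + pi/2}"
  shows "4 * integral {a..a + pi/2} (\<lambda>x. (f x)\<^sup>2) \<le> integral {a..a + pi/2} (\<lambda>x. (g x)\<^sup>2)"
proof (rule field_le_mult_one_interval)
  fix z :: real assume z: "0 < z" "z < 1"
  define k where "k = 2 * sqrt z"
  have "sqrt z < 1" using z by simp
  then have k: "0 < k" "k < 2" "k\<^sup>2 = 4 * z" using z by (auto simp: k_def power_mult_distrib)
  define m where "m = a + pi/4"
  define p where "p t = - k * tan (k * (t - m))" for t
  define p' where "p' t = - k\<^sup>2 - (p t)\<^sup>2" for t
  let ?I = "{a..a + pi/2}"
  have cos: "cos (k * (t - m)) \<noteq> 0" if "t \<in> ?I" for t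
  proof -
    have "\<bar>t - m\<bar> \<le> pi/4" using that by (auto simp: m_def abs_if field_simps)
    then have "\<bar>k * (t - m)\<bar> \<le> k * (pi/4)" using k by (simp add: abs_mult)
    also have "\<dots> < 2 * (pi/4)" using k pi_gt_zero by (intro mult_strict_right_mono) auto
    finally have "cos (k * (t - m)) > 0" by (intro cos_gt_zero_pi) auto
    then show ?thesis by simp
  qed
  have p: "(p has_real_derivative p' t) (at t)" if "t \<in> ?I" for t
    unfolding p_def[abs_def] p'_def using cos[OF that]
    by (auto intro!: derivative_eq_intros simp: tan_sec power2_eq_square tan_def divide_simps)
  have cp: "continuous_on ?I p" using p by (meson DERIV_isCont continuous_at_imp_continuous_on)
  have "lipschitz_fun_on ?I p"
    by (rule lipschitz_fun_on_C1[OF p]) (auto simp: p'_def intro!: continuous_intros cp)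
  then have "lipschitz_fun_on ?I (\<lambda>x. (f x)\<^sup>2 * p x)"
    using lip by (auto simp: power2_eq_square intro!: lipschitz_fun_on_mult)
  then obtain L where L: "L-lipschitz_on ?I (\<lambda>x. (f x)\<^sup>2 * p x)" by (auto simp: lipschitz_fun_on_def)
  have "((\<lambda>x. 2 * f x * g x * p x + (f x)\<^sup>2 * p' x) has_integral
      (f (a + pi/2))\<^sup>2 * p (a + pi/2) - (f a)\<^sup>2 * p a) ?I"
    by (rule fundamental_theorem_of_calculus_lipschitz[OF _ L S])
      (auto intro!: derivative_eq_intros deriv p simp: algebra_simps)
  then have 1: "((\<lambda>x. 2 * f x * g x * p x + (f x)\<^sup>2 * p' x) has_integral 0) ?I"
    by (simp add: ends)
  have cf: "continuous_on ?I f" using lip lipschitz_on_continuous_on by (auto simp: lipschitz_fun_on_def)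
  have 2: "((\<lambda>x. k\<^sup>2 * (f x)\<^sup>2) has_integral k\<^sup>2 * integral ?I (\<lambda>x. (f x)\<^sup>2)) ?I"
    by (intro has_integral_mult_right integrable_integral integrable_continuous_interval continuous_intros cf)
  have "((\<lambda>x. (g x)\<^sup>2 - k\<^sup>2 * (f x)\<^sup>2 - (2 * f x * g x * p x + (f x)\<^sup>2 * p' x)) has_integral
      integral ?I (\<lambda>x. (g x)\<^sup>2) - k\<^sup>2 * integral ?I (\<lambda>x. (f x)\<^sup>2) - 0) ?I"
    by (intro has_integral_diff 1 2 integrable_integral int)
  moreover have "(g x)\<^sup>2 - k\<^sup>2 * (f x)\<^sup>2 - (2 * f x * g x * p x + (f x)\<^sup>2 * p' x) = (g x - p x * f x)\<^sup>2" for x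
    by (simp add: p'_def power2_eq_square algebra_simps)
  ultimately have "0 \<le> integral ?I (\<lambda>x. (g x)\<^sup>2) - k\<^sup>2 * integral ?I (\<lambda>x. (f x)\<^sup>2) - 0"
    using has_integral_nonneg by (metis (no_types, lifting) zero_le_power2)
  then show "z * (4 * integral ?I (\<lambda>x. (f x)\<^sup>2)) \<le> integral ?I (\<lambda>x. (g x)\<^sup>2)"
    using k(3) by simp
qed

section \<open>Support functions with a one-sided derivative\<close>

lemma bounded_borel_integrable:
  fixes f :: "real \<Rightarrow> real"
  assumes "f \<in> borel_measurable borel" and "\<And>x. x \<in> {a..b} \<Longrightarrow> \<bar>f x\<bar> \<le> B"
  shows "set_integrable lborel {a..b} f" and "f integrable_on {a..b}"
proof -
  show *: "set_integrable lborel {a..b} f"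
    unfolding set_integrable_def
  proof (rule integrableI_bounded_set[where A = "{a..b}" and B = B])
    show "(\<lambda>x. indicat_real {a..b} x *\<^sub>R f x) \<in> borel_measurable lborel" using assms(1) by simp
    show "AE x in lborel. x \<in> {a..b} \<longrightarrow> norm (indicat_real {a..b} x *\<^sub>R f x) \<le> B"
      using assms(2) by (auto intro!: AE_I2)
  qed (auto simp: emeasure_lborel_Icc_eq)
  then show "f integrable_on {a..b}" by (rule set_borel_integral_eq_integral(1))
qed

lemma integral_periodic_shift:
  fixes f :: "real \<Rightarrow> real"
  assumes per: "\<And>x. f (x + p) = f x" and c: "0 \<le> c" "c \<le> p" and int: "\<And>u v. f integrable_on {u..v}"
  shows "integral {c..c + p} f = integral {0..p} f"
proof -
  have "integral {c..c + p} f = integral {c..p} f + integral {p..c + p} f"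
    using c int by (intro Henstock_Kurzweil_Integration.integral_combine[symmetric]) auto
  also have "integral {p..c + p} f = integral {0..c} f"
    using integral_shift_real_ivl[of p p "c + p" f] per by simp
  also have "integral {c..p} f + integral {0..c} f = integral {0..p} f"
    using c int Henstock_Kurzweil_Integration.integral_combine[of 0 c p f] by (simp add: add.commute)
  finally show ?thesis .
qed

lemma one_minus_cos_le: "1 - cos x \<le> \<bar>x\<bar>" for x :: real
proof -
  have "1 - cos x = 2 * (sin (x/2))\<^sup>2" using cos_double_sin[of "x/2"] by simp
  also have "\<dots> = 2 * (\<bar>sin (x/2)\<bar> * \<bar>sin (x/2)\<bar>)" by (simp add: power2_eq_square)
  also have "\<dots> \<le> 2 * (1 * \<bar>x/2\<bar>)"
    by (intro mult_left_mono mult_mono abs_sin_x_le_abs_x) auto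
  finally show ?thesis by simp
qed

lemma abs_mult_le:
  fixes a b :: real
  assumes "\<bar>a\<bar> \<le> A" "\<bar>b\<bar> \<le> B"
  shows "a * b \<le> A * B" and "- (a * b) \<le> A * B"
proof -
  have "\<bar>a * b\<bar> \<le> A * B"
    unfolding abs_mult using assms by (intro mult_mono) auto
  then show "a * b \<le> A * B" and "- (a * b) \<le> A * B" by auto
qed

text \<open>
  An abstract support function \<open>h\<close> together with a choice \<open>g\<close> of slopes. The inequality \<open>supp\<close> says that the
  point \<open>h t dir t + g t tang t\<close> lies in every half-plane \<open>{y. y \<bullet> dir s \<le> h s}\<close>. It is the only source of
  regularity: \<open>h\<close> is Lipschitz, \<open>g\<close> is monotone up to a linear term, and \<open>g\<close> is the derivative of \<open>h\<close>
  wherever \<open>g\<close> is continuous. Working with pairs makes translations of the body available without moving sets.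
\<close>

locale support_pair =
  fixes h g :: "real \<Rightarrow> real" and R :: real
  assumes h_periodic: "h (t + 2 * pi) = h t" and g_periodic: "g (t + 2 * pi) = g t"
    and supp: "h t * cos (s - t) + g t * sin (s - t) \<le> h s"
    and h_bound: "\<bar>h t\<bar> \<le> R" and g_bound: "\<bar>g t\<bar> \<le> R"
begin

lemma R_nonneg: "R \<ge> 0" using h_bound[of 0] by linarith

lemma h_diff_lower: "h t - h s \<ge> - (2 * R * \<bar>t - s\<bar>)"
proof -
  have "h s * (1 - cos (t - s)) \<le> R * \<bar>t - s\<bar>"
    using one_minus_cos_le[of "t - s"] by (intro abs_mult_le h_bound) simp
  moreover have "- (g s * sin (t - s)) \<le> R * \<bar>t - s\<bar>"
    by (intro abs_mult_le g_bound abs_sin_x_le_abs_x)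
  ultimately show ?thesis using supp[of s t] by (simp add: algebra_simps)
qed

lemma h_lipschitz: "(2 * R)-lipschitz_on A h"
proof (rule lipschitz_onI)
  fix x y show "dist (h x) (h y) \<le> 2 * R * dist x y"
    using h_diff_lower[of x y] h_diff_lower[of y x] by (simp add: dist_real_def abs_minus_commute abs_le_iff)
qed (use R_nonneg in auto)

lemma h_continuous: "continuous_on A h"
  using h_lipschitz lipschitz_on_continuous_on by blast

text \<open>
  As the normal turns counterclockwise the boundary point moves counterclockwise. Expressed through \<open>supp\<close>,
  used once in each direction, this bounds \<open>g t\<close> from below by \<open>g s cos (t - s) - h s sin (t - s)\<close>.
\<close>

lemma g_quasi_mono_local:
  assumes "s \<le> t" "t \<le> s + pi / 2"
  shows "g s + 2 * R * s \<le> g t + 2 * R * t"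
proof (cases "s = t")
  case False
  define d where "d = t - s"
  have d: "0 < d" "d \<le> pi/2" using assms False by (auto simp: d_def)
  have sd: "sin d > 0" and cd: "cos d \<ge> 0" using d by (auto intro!: sin_gt_zero cos_ge_zero)
  have 1: "h s * cos d + g s * sin d \<le> h t" using supp[of s t] by (simp add: d_def)
  have "s - t = - d" by (simp add: d_def)
  then have "h t * cos d - g t * sin d \<le> h s" using supp[of t s] by simp
  then have "h t * cos d - h s \<le> g t * sin d" by simp
  moreover have "(h s * cos d + g s * sin d) * cos d \<le> h t * cos d" using 1 cd by (rule mult_right_mono)
  moreover have "(h s * cos d + g s * sin d) * cos d - h s = (g s * cos d - h s * sin d) * sin d"
    using sin_cos_squared_add3[of d] by algebra
  ultimately have "(g s * cos d - h s * sin d) * sin d \<le> g t * sin d" by linarith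
  then have "g s * cos d - h s * sin d \<le> g t" using sd by simp
  moreover have "g s * (1 - cos d) \<le> R * d"
    using one_minus_cos_le[of d] d by (intro abs_mult_le g_bound) simp
  moreover have "h s * sin d \<le> R * d"
    using abs_sin_x_le_abs_x[of d] d by (intro abs_mult_le h_bound) simp
  ultimately show ?thesis by (simp add: d_def algebra_simps)
qed simp

lemma g_quasi_mono: "s \<le> t \<Longrightarrow> g s + 2 * R * s \<le> g t + 2 * R * t"
proof -
  have *: "g s + 2 * R * s \<le> g t + 2 * R * t" if "s \<le> t" "t \<le> s + real n * (pi/2)" for n s t
    using that
  proof (induction n arbitrary: t)
    case (Suc n)
    show ?case
    proof (cases "t \<le> s + pi / 2")
      case False
      have "g s + 2 * R * s \<le> g (t - pi/2) + 2 * R * (t - pi/2)"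
        using False Suc.prems by (intro Suc.IH) (auto simp: field_simps)
      also have "\<dots> \<le> g t + 2 * R * t"
        by (intro g_quasi_mono_local) auto
      finally show ?thesis .
    qed (use Suc.prems g_quasi_mono_local in auto)
  qed auto
  assume "s \<le> t"
  moreover obtain n where "(t - s) / (pi/2) \<le> real n" using real_arch_simple by blast
  ultimately show ?thesis by (intro *[of s t n]) (auto simp: field_simps)
qed

lemma g_borel: "g \<in> borel_measurable borel"
proof -
  have "mono (\<lambda>t. g t + 2 * R * t)" using g_quasi_mono by (intro monoI)
  then have "(\<lambda>t. (g t + 2 * R * t) - 2 * R * t) \<in> borel_measurable borel"
    by (intro borel_measurable_diff[OF borel_measurable_mono]) auto
  then show ?thesis by simp
qed

lemma h_borel: "h \<in> borel_measurable borel"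
  by (intro borel_measurable_continuous_onI h_continuous)

text \<open>
  For the support function of a convex body, these are the normal directions of the flat sides of the body.
\<close>

definition kinks :: "real set" where "kinks = {t. \<not> isCont g t}"

lemma countable_kinks: "countable kinks"
proof -
  have "mono (\<lambda>t. g t + 2 * R * t)" using g_quasi_mono by (intro monoI)
  then have "countable {t. \<not> isCont (\<lambda>t. g t + 2 * R * t) t}" by (rule mono_ctble_discont)
  moreover have "kinks \<subseteq> {t. \<not> isCont (\<lambda>t. g t + 2 * R * t) t}"
  proof (rule subsetI, rule ccontr)
    fix t assume t: "t \<in> kinks" and "t \<notin> {t. \<not> isCont (\<lambda>t. g t + 2 * R * t) t}"
    then have "isCont (\<lambda>t. g t + 2 * R * t) t" by simp
    then have "isCont (\<lambda>t. (g t + 2 * R * t) - 2 * R * t) t"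
      by (rule isCont_diff) (intro continuous_intros)
    then have "isCont g t" by simp
    then show False using t by (simp add: kinks_def)
  qed
  ultimately show ?thesis by (rule countable_subset[rotated])
qed

lemma negligible_kinks: "negligible kinks"
  using countable_imp_null_set_lborel[OF countable_kinks] by (simp add: negligible_iff_null_sets null_sets_completionI)

text \<open>
  \<open>supp\<close> at \<open>t\<close> bounds the difference quotient from one side by \<open>g t\<close>, and \<open>supp\<close> at \<open>t + d\<close> bounds it from
  the other side by \<open>g (t + d)\<close>, up to terms that vanish with \<open>d\<close>.
\<close>

lemma h_deriv: 
  assumes "t \<notin> kinks" shows "(h has_real_derivative g t) (at t)"
proof -
  have g: "isCont g t" using assms by (simp add: kinks_def)
  let ?B = "\<lambda>d. R * ((1 - cos d) / \<bar>d\<bar>) + R * \<bar>sin d / d - 1\<bar> + \<bar>g (t + d) - g t\<bar>"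
  have bound: "\<bar>(h (t + d) - h t) / d - g t\<bar> \<le> ?B d" if "d \<noteq> 0" for d
  proof -
    have 1: "h t * cos d + g t * sin d \<le> h (t + d)" using supp[of t "t + d"] by simp
    have 2: "h (t + d) * cos d - g (t + d) * sin d \<le> h t" using supp[of "t + d" t] by simp
    have b: "h u * (1 - cos d) \<le> R * (1 - cos d)" "- (h u * (1 - cos d)) \<le> R * (1 - cos d)" for u
      by (intro abs_mult_le h_bound; simp)+
    have c: "\<bar>g t * (sin d - d)\<bar> \<le> R * \<bar>sin d - d\<bar>"
      using g_bound[of t] by (simp add: abs_mult mult_right_mono)
    have e: "\<bar>(g (t + d) - g t) * sin d\<bar> \<le> \<bar>g (t + d) - g t\<bar> * \<bar>d\<bar>"
      using abs_sin_x_le_abs_x[of d] by (simp add: abs_mult mult_left_mono)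
    have f: "0 \<le> \<bar>g (t + d) - g t\<bar> * \<bar>d\<bar>" by simp
    have "h (t + d) - h t - g t * d \<ge> - (h t * (1 - cos d)) + g t * (sin d - d)"
      using 1 by (simp add: algebra_simps)
    moreover have "h (t + d) - h t - g t * d \<le> h (t + d) * (1 - cos d) + (g (t + d) - g t) * sin d + g t * (sin d - d)"
      using 2 by (simp add: algebra_simps)
    ultimately have "\<bar>h (t + d) - h t - g t * d\<bar> \<le> R * (1 - cos d) + R * \<bar>sin d - d\<bar> + \<bar>g (t + d) - g t\<bar> * \<bar>d\<bar>"
      using b(1)[of t] b(1)[of "t + d"] c e f unfolding abs_le_iff by (elim conjE, intro conjI; linarith)
    then have "\<bar>h (t + d) - h t - g t * d\<bar> / \<bar>d\<bar> \<le> (R * (1 - cos d) + R * \<bar>sin d - d\<bar> + \<bar>g (t + d) - g t\<bar> * \<bar>d\<bar>) / \<bar>d\<bar>"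
      by (rule divide_right_mono) simp
    moreover have "\<bar>sin d - d\<bar> / \<bar>d\<bar> = \<bar>sin d / d - 1\<bar>"
      using that by (simp add: abs_divide[symmetric] diff_divide_distrib)
    moreover have "\<bar>h (t + d) - h t - g t * d\<bar> / \<bar>d\<bar> = \<bar>(h (t + d) - h t) / d - g t\<bar>"
      using that by (simp add: abs_divide[symmetric] diff_divide_distrib)
    moreover have "R * \<bar>sin d - d\<bar> / \<bar>d\<bar> = R * (\<bar>sin d - d\<bar> / \<bar>d\<bar>)" by simp
    ultimately show ?thesis using that by (simp only: add_divide_distrib) simp
  qed
  have l1: "((\<lambda>d::real. (1 - cos d) / \<bar>d\<bar>) \<longlongrightarrow> 0) (at 0)"
    by (rule filterlim_split_at) real_asymp+
  have l2: "((\<lambda>d::real. \<bar>sin d / d - 1\<bar>) \<longlongrightarrow> 0) (at 0)"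
    by (rule filterlim_split_at) real_asymp+
  have l3: "((\<lambda>d. \<bar>g (t + d) - g t\<bar>) \<longlongrightarrow> 0) (at 0)"
    using g by (intro tendsto_rabs_zero) (simp add: isCont_iff LIM_zero)
  have "(?B \<longlongrightarrow> R * 0 + R * 0 + 0) (at 0)"
    by (intro tendsto_intros l1 l2 l3)
  then have B0: "(?B \<longlongrightarrow> 0) (at 0)" by simp
  have "((\<lambda>d. (h (t + d) - h t) / d - g t) \<longlongrightarrow> 0) (at 0)"
    by (rule Lim_null_comparison[OF _ B0])
      (unfold eventually_at_filter real_norm_def, intro always_eventually allI impI bound)
  then have "(\<lambda>d. (h (t + d) - h t) / d) \<midarrow>0\<rightarrow> g t" by (rule LIM_zero_cancel)
  then show ?thesis unfolding DERIV_def .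
qed

text \<open>
  A second admissible slope \<open>c\<close> would give a function of \<open>s\<close> that touches \<open>h\<close> from below at \<open>t\<close>; at a point of
  differentiability the slopes must agree.
\<close>

lemma h_deriv_unique:
  assumes "t \<notin> kinks" "\<And>s. h t * cos (s - t) + c * sin (s - t) \<le> h s"
  shows "c = g t"
proof -
  have hd: "(h has_real_derivative g t) (at t)" using assms(1) by (rule h_deriv)
  have "((\<lambda>s. h s - (h t * cos (s - t) + c * sin (s - t))) has_real_derivative g t - c) (at t)"
    by (rule hd derivative_eq_intros refl | simp)+
  moreover have "\<forall>s. \<bar>t - s\<bar> < 1 \<longrightarrow> h t - (h t * cos (t - t) + c * sin (t - t)) \<le> h s - (h t * cos (s - t) + c * sin (s - t))"
    using assms(2) by simp
  ultimately have "g t - c = 0" by (intro DERIV_local_min[where d = 1]) auto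
  then show ?thesis by simp
qed

lemma translate: "support_pair (\<lambda>t. h t - x \<bullet> dir t) (\<lambda>t. g t - x \<bullet> tang t) (R + norm x)"
proof
  fix s t :: real
  have "dir s = cos (s - t) *\<^sub>R dir t + sin (s - t) *\<^sub>R tang t" using dir_add[of t "s - t"] by simp
  then have "x \<bullet> dir s = cos (s - t) * (x \<bullet> dir t) + sin (s - t) * (x \<bullet> tang t)" by (simp add: inner_add_right)
  then show "(h t - x \<bullet> dir t) * cos (s - t) + (g t - x \<bullet> tang t) * sin (s - t) \<le> h s - x \<bullet> dir s"
    using supp[of t s] by (simp add: algebra_simps)
  have "\<bar>x \<bullet> dir t\<bar> \<le> norm x" "\<bar>x \<bullet> tang t\<bar> \<le> norm x"
    using Cauchy_Schwarz_ineq2[of x "dir t"] Cauchy_Schwarz_ineq2[of x "tang t"] by auto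
  then show "\<bar>h t - x \<bullet> dir t\<bar> \<le> R + norm x" "\<bar>g t - x \<bullet> tang t\<bar> \<le> R + norm x"
    using h_bound[of t] g_bound[of t] by linarith+
qed (simp_all add: h_periodic g_periodic)

lemma h_pow_integrable: "(\<lambda>t. (h t - c)\<^sup>2) integrable_on {a..b}" "h integrable_on {a..b}"
  by (intro integrable_continuous_interval continuous_intros h_continuous)+

lemma g_pow_integrable: "(\<lambda>t. (g t)\<^sup>2) integrable_on {a..b}"
proof (rule bounded_borel_integrable)
  show "(\<lambda>t. (g t)\<^sup>2) \<in> borel_measurable borel" using g_borel by measurable
  show "\<bar>(g t)\<^sup>2\<bar> \<le> R\<^sup>2" for t using g_bound[of t] by (simp add: abs_le_square_iff[symmetric])
qed

lemma dirichlet_interval: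
  assumes "h a = c" "h (a + pi/2) = c"
  shows "4 * integral {a..a + pi/2} (\<lambda>t. (h t - c)\<^sup>2) \<le> integral {a..a + pi/2} (\<lambda>t. (g t)\<^sup>2)"
proof (rule dirichlet_inequality_quarter[OF _ negligible_kinks])
  have "(2 * R + 0)-lipschitz_on {a..a + pi/2} (\<lambda>t. h t - c)"
    by (intro lipschitz_on_diff h_lipschitz lipschitz_on_constant)
  then show "lipschitz_fun_on {a..a + pi/2} (\<lambda>t. h t - c)"
    by (auto simp: lipschitz_fun_on_def)
  show "((\<lambda>t. h t - c) has_real_derivative g t) (at t)" if "t \<in> {a<..<a + pi/2} - kinks" for t
    using h_deriv[of t] that by (auto intro!: derivative_eq_intros)
qed (use assms g_pow_integrable in auto)

lemma dirichlet_period: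
  assumes c: "0 \<le> c" "c \<le> 2 * pi"
    and hc: "h c = k" "h (c + pi/2) = k" "h (c + pi) = k" "h (c + 3 * pi/2) = k"
  shows "4 * integral {0..2*pi} (\<lambda>t. (h t - k)\<^sup>2) \<le> integral {0..2*pi} (\<lambda>t. (g t)\<^sup>2)"
proof -
  have split: "integral {0..2*pi} F = integral {c..c + pi/2} F + integral {c + pi/2..c + pi/2 + pi/2} F
      + integral {c + pi..c + pi + pi/2} F + integral {c + 3 * pi/2..c + 3 * pi/2 + pi/2} F"
    if F: "\<And>u v. F integrable_on {u..v}" and per: "\<And>t. F (t + 2 * pi) = F t" for F :: "real \<Rightarrow> real"
  proof -
    have comb: "integral {u..w} F = integral {u..v} F + integral {v..w} F" if "u \<le> v" "v \<le> w" for u v w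
      using that F Henstock_Kurzweil_Integration.integral_combine[of u v w F] by simp
    have "integral {0..2*pi} F = integral {c..c + 2*pi} F"
      using integral_periodic_shift[of F "2*pi" c] per c F by simp
    also have "\<dots> = integral {c..c + pi/2} F + (integral {c + pi/2..c + pi} F
        + (integral {c + pi..c + 3*pi/2} F + integral {c + 3*pi/2..c + 2*pi} F))"
      by (simp add: comb[of c "c + pi/2" "c + 2*pi"] comb[of "c + pi/2" "c + pi" "c + 2*pi"]
          comb[of "c + pi" "c + 3*pi/2" "c + 2*pi"])
    finally show ?thesis by (simp add: algebra_simps)
  qed
  have "4 * integral {c..c + pi/2} (\<lambda>t. (h t - k)\<^sup>2) \<le> integral {c..c + pi/2} (\<lambda>t. (g t)\<^sup>2)"
    "4 * integral {c + pi/2..c + pi/2 + pi/2} (\<lambda>t. (h t - k)\<^sup>2) \<le> integral {c + pi/2..c + pi/2 + pi/2} (\<lambda>t. (g t)\<^sup>2)"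
    "4 * integral {c + pi..c + pi + pi/2} (\<lambda>t. (h t - k)\<^sup>2) \<le> integral {c + pi..c + pi + pi/2} (\<lambda>t. (g t)\<^sup>2)"
    "4 * integral {c + 3 * pi/2..c + 3 * pi/2 + pi/2} (\<lambda>t. (h t - k)\<^sup>2) \<le> integral {c + 3 * pi/2..c + 3 * pi/2 + pi/2} (\<lambda>t. (g t)\<^sup>2)"
    using hc h_periodic[of c] by (intro dirichlet_interval; simp add: algebra_simps)+
  then show ?thesis
    using split[OF h_pow_integrable(1)[of k]] split[OF g_pow_integrable] h_periodic g_periodic by simp
qed

text \<open>
  Subtracting \<open>x \<bullet> dir\<close> and a constant \<open>k\<close> leaves three parameters for four interpolation conditions. The one
  remaining condition is that the two sums of values at opposite angles agree. Their difference \<open>D\<close> changes sign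
  under a quarter turn, so it vanishes at some angle \<open>c\<close>.
\<close>

lemma four_contacts:
  obtains x k where "4 * integral {0..2*pi} (\<lambda>t. (h t - x \<bullet> dir t - k)\<^sup>2) \<le> integral {0..2*pi} (\<lambda>t. (g t - x \<bullet> tang t)\<^sup>2)"
proof -
  define D where "D c = h c + h (c + pi) - h (c + pi/2) - h (c + 3*pi/2)" for c
  have "D (pi/2) = - D 0"
    using h_periodic[of 0] by (simp add: D_def algebra_simps)
  have Dc: "continuous_on {0..pi/2} D"
    unfolding D_def
    by (intro continuous_intros continuous_on_compose2[OF h_continuous[of UNIV]]) auto
  have "\<exists>c\<in>{0..pi/2}. D c = 0"
  proof (cases "D 0 \<le> 0")
    case True
    then show ?thesis
      using IVT'[OF _ _ _ Dc, of 0] \<open>D (pi/2) = - D 0\<close> by auto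
  next
    case False
    then show ?thesis
      using IVT2'[OF _ _ _ Dc, of 0] \<open>D (pi/2) = - D 0\<close> by auto
  qed
  then obtain c where c: "0 \<le> c" "c \<le> pi/2" "D c = 0" by auto
  \<comment> \<open>The halves of the differences at opposite angles are the components of \<open>x\<close>; half of either common sum is \<open>k\<close>.\<close>
  define p q k where "p = (h c - h (c + pi)) / 2" and "q = (h (c + pi/2) - h (c + 3*pi/2)) / 2"
    and "k = (h c + h (c + pi)) / 2"
  define x where "x = p *\<^sub>R dir c + q *\<^sub>R tang c"
  have x: "x \<bullet> dir (c + d) = p * cos d + q * sin d" for d
    by (simp add: x_def dir_add inner_add_left inner_add_right algebra_simps)
  have s3: "sin (3 * pi / 2) = -1" "cos (3 * pi / 2) = 0"
    using sin_add[of pi "pi/2"] cos_add[of pi "pi/2"] by (auto simp: algebra_simps)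
  have k: "k = (h (c + pi/2) + h (c + 3*pi/2)) / 2" using c(3) by (simp add: k_def D_def field_simps)
  interpret T: support_pair "\<lambda>t. h t - x \<bullet> dir t" "\<lambda>t. g t - x \<bullet> tang t" "R + norm x"
    by (rule translate)
  show ?thesis
  proof (rule that[of x k], rule T.dirichlet_period[of c])
    show "h c - x \<bullet> dir c = k" using x[of 0] by (simp add: p_def k_def field_simps)
    show "h (c + pi/2) - x \<bullet> dir (c + pi/2) = k" using x[of "pi/2"] by (simp add: q_def k field_simps)
    show "h (c + pi) - x \<bullet> dir (c + pi) = k" using x[of pi] by (simp add: p_def k_def field_simps)
    show "h (c + 3*pi/2) - x \<bullet> dir (c + 3*pi/2) = k" using x[of "3*pi/2"] s3 by (simp add: q_def k field_simps)
  qed (use c in auto)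
qed

end

section \<open>The two inequalities for a support function\<close>

lemma inner_dir_eq: "x \<bullet> dir t = x$1 * cos t + x$2 * sin t"
  and inner_tang_eq: "x \<bullet> tang t = - x$1 * sin t + x$2 * cos t"
  by (simp_all add: inner_real2)

lemma inner_dir_deriv: "((\<lambda>t. x \<bullet> dir t) has_real_derivative x \<bullet> tang t) (at t within A)"
  and inner_tang_deriv: "((\<lambda>t. x \<bullet> tang t) has_real_derivative - (x \<bullet> dir t)) (at t within A)"
  unfolding inner_dir_eq inner_tang_eq by (auto intro!: derivative_eq_intros)

lemma has_integral_periodic_derivative:
  fixes F :: "real \<Rightarrow> real"
  assumes "\<And>t. (F has_real_derivative F' t) (at t)" and "F (2 * pi) = F 0"
  shows "(F' has_integral 0) {0..2*pi}"
proof -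
  have "(F' has_integral F (2 * pi) - F 0) {0..2*pi}"
    using assms(1) by (intro fundamental_theorem_of_calculus)
      (auto simp: has_real_derivative_iff_has_vector_derivative[symmetric] intro: has_field_derivative_at_within)
  then show ?thesis using assms(2) by simp
qed

lemma dir_2pi: "dir (2 * pi) = dir 0" "tang (2 * pi) = tang 0"
  using dir_periodic[of 0] tang_periodic[of 0] by simp_all

lemma has_integral_inner_dir: "((\<lambda>t. x \<bullet> dir t) has_integral 0) {0..2*pi}"
  by (rule has_integral_periodic_derivative[of "\<lambda>t. - (x \<bullet> tang t)"])
    (auto intro!: derivative_eq_intros inner_tang_deriv simp: dir_2pi)

lemma has_integral_inner_dir_sq_diff:
  "((\<lambda>t. (x \<bullet> dir t)\<^sup>2 - (x \<bullet> tang t)\<^sup>2) has_integral 0) {0..2*pi}"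
  by (rule has_integral_periodic_derivative[of "\<lambda>t. - ((x \<bullet> dir t) * (x \<bullet> tang t))"])
    (auto intro!: derivative_eq_intros inner_tang_deriv inner_dir_deriv simp: dir_2pi power2_eq_square)

context support_pair
begin

text \<open>
  For a convex body these are the perimeter, the two integrals whose half-difference is the area, and the
  second moment of the curvature measure about \<open>x\<close>.
\<close>

definition len :: real where "len = integral {0..2*pi} h"
definition int_h2 :: real where "int_h2 = integral {0..2*pi} (\<lambda>t. (h t)\<^sup>2)"
definition int_g2 :: real where "int_g2 = integral {0..2*pi} (\<lambda>t. (g t)\<^sup>2)"
definition moment :: "real^2 \<Rightarrow> real" where
  "moment x = integral {0..2*pi} (\<lambda>t. (h t - x \<bullet> dir t)\<^sup>2 + (g t - x \<bullet> tang t)\<^sup>2)"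

lemma has_integral_h: "(h has_integral len) {0..2*pi}"
  unfolding len_def using h_pow_integrable by (intro integrable_integral)

lemma has_integral_h2: "((\<lambda>t. (h t)\<^sup>2) has_integral int_h2) {0..2*pi}"
  unfolding int_h2_def using h_pow_integrable(1)[of 0] by (intro integrable_integral) simp

lemma has_integral_g2: "((\<lambda>t. (g t)\<^sup>2) has_integral int_g2) {0..2*pi}"
  unfolding int_g2_def using g_pow_integrable by (intro integrable_integral)

text \<open>
  The integrand is the derivative of \<open>h (x \<bullet> tang)\<close>, a periodic Lipschitz function. This identity is why
  translations do not change the area.
\<close>

lemma has_integral_cross:
  "((\<lambda>t. g t * (x \<bullet> tang t) - h t * (x \<bullet> dir t)) has_integral 0) {0..2*pi}"
proof -
  have "lipschitz_fun_on {0..2*pi} h" using h_lipschitz by (auto simp: lipschitz_fun_on_def)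
  moreover have "lipschitz_fun_on {0..2*pi} (\<lambda>t. x \<bullet> tang t)"
    by (rule lipschitz_fun_on_C1[OF inner_tang_deriv]) (intro continuous_intros)
  ultimately obtain L where L: "L-lipschitz_on {0..2*pi} (\<lambda>t. h t * (x \<bullet> tang t))"
    using lipschitz_fun_on_mult by (metis lipschitz_fun_on_def)
  have "((\<lambda>t. g t * (x \<bullet> tang t) - h t * (x \<bullet> dir t)) has_integral
      h (2*pi) * (x \<bullet> tang (2*pi)) - h 0 * (x \<bullet> tang 0)) {0..2*pi}"
    by (rule fundamental_theorem_of_calculus_lipschitz[OF _ L negligible_kinks])
      (auto intro!: derivative_eq_intros h_deriv inner_tang_deriv)
  then show ?thesis using h_periodic[of 0] by (simp add: dir_2pi)
qed

lemma len_translate: "integral {0..2*pi} (\<lambda>t. h t - x \<bullet> dir t) = len"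
  using has_integral_diff[OF has_integral_h has_integral_inner_dir[of x]] by (simp add: integral_unique)

lemma area_translate:
  "((\<lambda>t. (h t - x \<bullet> dir t)\<^sup>2 - (g t - x \<bullet> tang t)\<^sup>2) has_integral (int_h2 - int_g2)) {0..2*pi}"
proof -
  have "((\<lambda>t. ((h t)\<^sup>2 - (g t)\<^sup>2) + 2 * (g t * (x \<bullet> tang t) - h t * (x \<bullet> dir t))
      + ((x \<bullet> dir t)\<^sup>2 - (x \<bullet> tang t)\<^sup>2)) has_integral (int_h2 - int_g2) + 2 * 0 + 0) {0..2*pi}"
    by (intro has_integral_add has_integral_diff has_integral_mult_right has_integral_h2 has_integral_g2
        has_integral_cross has_integral_inner_dir_sq_diff)
  then show ?thesis by (simp add: power2_eq_square algebra_simps)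
qed

lemma variance_eq: "integral {0..2*pi} (\<lambda>t. (h t - k)\<^sup>2) = int_h2 - 2 * k * len + 2 * pi * k\<^sup>2"
proof -
  have "((\<lambda>t. (h t)\<^sup>2 - 2 * k * h t + k\<^sup>2) has_integral int_h2 - 2 * k * len + (2 * pi - 0) *\<^sub>R k\<^sup>2) {0..2*pi}"
    by (intro has_integral_add has_integral_diff has_integral_mult_right has_integral_h2 has_integral_h
        has_integral_const_real[THEN has_integral_eq_rhs]) auto
  then have "((\<lambda>t. (h t - k)\<^sup>2) has_integral int_h2 - 2 * k * len + 2 * pi * k\<^sup>2) {0..2*pi}"
    by (simp add: power2_diff algebra_simps)
  then show ?thesis by (rule integral_unique)
qed

lemma variance_mean: "integral {0..2*pi} (\<lambda>t. (h t - len / (2*pi))\<^sup>2) = int_h2 - len\<^sup>2 / (2 * pi)"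
  unfolding variance_eq by (simp add: power2_eq_square field_simps)

text \<open>
  The mean value minimises the quadratic deviation.
\<close>

lemma variance_mean_le: "int_h2 - len\<^sup>2 / (2 * pi) \<le> integral {0..2*pi} (\<lambda>t. (h t - k)\<^sup>2)"
proof -
  have "0 \<le> (len - 2 * pi * k)\<^sup>2 / (2 * pi)" by simp
  also have "\<dots> = len\<^sup>2 / (2 * pi) - 2 * k * len + 2 * pi * k\<^sup>2"
    by (simp add: power2_eq_square field_simps)
  finally show ?thesis unfolding variance_eq by simp
qed

lemma variance_nonneg: "0 \<le> integral {0..2*pi} (\<lambda>t. (h t - k)\<^sup>2)"
  by (intro integral_nonneg h_pow_integrable) auto

lemma const_of_variance_zero:
  assumes "integral {0..2*pi} (\<lambda>t. (h t - k)\<^sup>2) = 0"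
  shows "h t = k"
proof -
  have 0: "h s = k" if "s \<in> {0..2*pi}" for s
  proof -
    have "((\<lambda>t. (h t - k)\<^sup>2) has_integral 0) (cbox 0 (2*pi))"
      using integrable_integral[OF h_pow_integrable(1)] assms by (metis cbox_interval)
    then have "(h s - k)\<^sup>2 = 0"
      by (rule has_integral_0_cbox_imp_0[rotated 2])
        (use that pi_gt_zero in \<open>auto intro!: continuous_intros h_continuous simp: box_real simp del: pi_gt_zero\<close>)
    then show ?thesis by simp
  qed
  have per: "h (s + 2 * pi * of_int n) = h s" for s and n :: int
  proof (induction n rule: int_induct[where k = 0])
    case (step1 i) then show ?case using h_periodic[of "s + 2 * pi * of_int i"] by (simp add: algebra_simps)
  next
    case (step2 i) then show ?case using h_periodic[of "s + 2 * pi * of_int (i - 1)"] by (simp add: algebra_simps)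
  qed simp
  define n where "n = \<lfloor>t / (2*pi)\<rfloor>"
  have "of_int n \<le> t / (2*pi)" "t / (2*pi) < of_int n + 1" by (auto simp: n_def)
  then have "t + 2 * pi * of_int (- n) \<in> {0..2*pi}" by (auto simp: field_simps)
  then show ?thesis using 0 per[of t "-n"] by metis
qed

lemma moment_0: "moment 0 = int_h2 + int_g2"
  using has_integral_add[OF has_integral_h2 has_integral_g2] by (simp add: moment_def integral_unique)

lemma int_g2_nonneg: "0 \<le> int_g2"
  unfolding int_g2_def by (intro integral_nonneg g_pow_integrable) auto

text \<open>
  The integral of \<open>h\<^sup>2\<close> is at least \<open>len\<^sup>2 / (2 pi)\<close>, and the coefficient \<open>1 - \<beta>\<close> of \<open>int_g2\<close> is nonnegative.
\<close>

lemma moment_lower_bound: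
  assumes "\<beta> > 0" "\<beta> \<le> 1"
  shows "(1 + \<beta>) * (len\<^sup>2 / (2 * pi)) \<le> moment 0 + \<beta> * (int_h2 - int_g2)"
proof -
  have "len\<^sup>2 / (2 * pi) \<le> int_h2" using variance_nonneg[of "len / (2*pi)"] variance_mean by simp
  then have "(1 + \<beta>) * (len\<^sup>2 / (2 * pi)) \<le> (1 + \<beta>) * int_h2" using assms by (intro mult_left_mono) auto
  moreover have "0 \<le> (1 - \<beta>) * int_g2" using assms int_g2_nonneg by simp
  ultimately show ?thesis by (simp add: moment_0 algebra_simps)
qed

lemma moment_lower_bound_eq:
  assumes "\<beta> > 0" "\<beta> \<le> 1" and eq: "moment 0 + \<beta> * (int_h2 - int_g2) = (1 + \<beta>) * (len\<^sup>2 / (2 * pi))"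
  shows "h t = len / (2 * pi)"
proof (rule const_of_variance_zero)
  have "(1 + \<beta>) * (int_h2 - len\<^sup>2 / (2 * pi)) + (1 - \<beta>) * int_g2 = 0"
    using eq by (simp add: moment_0 algebra_simps)
  moreover have "0 \<le> (1 - \<beta>) * int_g2" using assms int_g2_nonneg by simp
  ultimately have "(1 + \<beta>) * (int_h2 - len\<^sup>2 / (2 * pi)) \<le> 0" by linarith
  then have "int_h2 - len\<^sup>2 / (2 * pi) \<le> 0" using assms by (simp add: mult_le_0_iff)
  then show "integral {0..2*pi} (\<lambda>t. (h t - len / (2 * pi))\<^sup>2) = 0"
    using variance_nonneg[of "len / (2*pi)"] variance_mean by simp
qed

text \<open>
  With \<open>V\<close> the quadratic deviation of \<open>h - x \<bullet> dir\<close> from \<open>k\<close>, the four contacts bound the integral of the squared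
  derivative below by \<open>4 V\<close>, while the integral of the square is at most \<open>len\<^sup>2 / (2 pi) + V\<close>. The total
  coefficient of \<open>V\<close> is \<open>(1 + \<beta>) - 4 (\<beta> - 1) = 5 - 3 \<beta>\<close>.
\<close>

lemma moment_upper_bound:
  assumes "\<beta> \<ge> 5/3"
  obtains x k where "moment x + \<beta> * (int_h2 - int_g2)
      \<le> (1 + \<beta>) * (len\<^sup>2 / (2 * pi)) - (3 * \<beta> - 5) * integral {0..2*pi} (\<lambda>t. (h t - x \<bullet> dir t - k)\<^sup>2)"
proof -
  obtain x k where x: "4 * integral {0..2*pi} (\<lambda>t. (h t - x \<bullet> dir t - k)\<^sup>2) \<le> integral {0..2*pi} (\<lambda>t. (g t - x \<bullet> tang t)\<^sup>2)"
    using four_contacts .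
  interpret T: support_pair "\<lambda>t. h t - x \<bullet> dir t" "\<lambda>t. g t - x \<bullet> tang t" "R + norm x"
    by (rule translate)
  define V where "V = integral {0..2*pi} (\<lambda>t. (h t - x \<bullet> dir t - k)\<^sup>2)"
  have "T.len = len" using len_translate by (simp add: T.len_def)
  have m: "moment x = T.int_h2 + T.int_g2" using T.moment_0 by (simp add: moment_def T.moment_def)
  have a: "int_h2 - int_g2 = T.int_h2 - T.int_g2"
    using has_integral_unique[OF area_translate[of x] has_integral_diff[OF T.has_integral_h2 T.has_integral_g2]] .
  have v: "T.int_h2 \<le> len\<^sup>2 / (2 * pi) + V"
    using T.variance_mean_le[of k] \<open>T.len = len\<close> by (simp add: V_def)
  have g: "4 * V \<le> T.int_g2" using x by (simp add: V_def T.int_g2_def)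
  have "moment x + \<beta> * (int_h2 - int_g2) = (1 + \<beta>) * T.int_h2 - (\<beta> - 1) * T.int_g2"
    by (simp add: m a algebra_simps)
  also have "\<dots> \<le> (1 + \<beta>) * (len\<^sup>2 / (2 * pi) + V) - (\<beta> - 1) * (4 * V)"
    using v g assms by (intro diff_mono mult_left_mono) auto
  also have "\<dots> = (1 + \<beta>) * (len\<^sup>2 / (2 * pi)) - (3 * \<beta> - 5) * V" by (simp add: algebra_simps)
  finally show ?thesis unfolding V_def by (rule that)
qed

lemma moment_upper_bound_weak:
  assumes "\<beta> \<ge> 5/3"
  obtains x where "moment x + \<beta> * (int_h2 - int_g2) \<le> (1 + \<beta>) * (len\<^sup>2 / (2 * pi))"
proof -
  obtain x k where *: "moment x + \<beta> * (int_h2 - int_g2)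
      \<le> (1 + \<beta>) * (len\<^sup>2 / (2 * pi)) - (3 * \<beta> - 5) * integral {0..2*pi} (\<lambda>t. (h t - x \<bullet> dir t - k)\<^sup>2)"
    using moment_upper_bound[OF assms] .
  interpret T: support_pair "\<lambda>t. h t - x \<bullet> dir t" "\<lambda>t. g t - x \<bullet> tang t" "R + norm x"
    by (rule translate)
  have "0 \<le> (3 * \<beta> - 5) * integral {0..2*pi} (\<lambda>t. (h t - x \<bullet> dir t - k)\<^sup>2)"
    using T.variance_nonneg[of k] assms by (intro mult_nonneg_nonneg) auto
  then show ?thesis using * that[of x] by linarith
qed

lemma moment_upper_bound_eq:
  assumes "\<beta> > 5/3" and le: "\<And>x. (1 + \<beta>) * (len\<^sup>2 / (2 * pi)) \<le> moment x + \<beta> * (int_h2 - int_g2)"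
  obtains x k where "\<And>t. h t = x \<bullet> dir t + k"
proof -
  obtain x k where *: "moment x + \<beta> * (int_h2 - int_g2)
      \<le> (1 + \<beta>) * (len\<^sup>2 / (2 * pi)) - (3 * \<beta> - 5) * integral {0..2*pi} (\<lambda>t. (h t - x \<bullet> dir t - k)\<^sup>2)"
    using moment_upper_bound[OF less_imp_le[OF assms(1)]] .
  interpret T: support_pair "\<lambda>t. h t - x \<bullet> dir t" "\<lambda>t. g t - x \<bullet> tang t" "R + norm x"
    by (rule translate)
  have "(3 * \<beta> - 5) * integral {0..2*pi} (\<lambda>t. (h t - x \<bullet> dir t - k)\<^sup>2) \<le> 0"
    using * le[of x] by linarith
  then have "integral {0..2*pi} (\<lambda>t. (h t - x \<bullet> dir t - k)\<^sup>2) \<le> 0"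
    using assms(1) by (simp add: mult_le_0_iff)
  then have "integral {0..2*pi} (\<lambda>t. (h t - x \<bullet> dir t - k)\<^sup>2) = 0"
    using T.variance_nonneg[of k] by linarith
  then have "h t - x \<bullet> dir t = k" for t by (rule T.const_of_variance_zero)
  then show ?thesis by (intro that[of x k]) (simp add: algebra_simps)
qed

text \<open>
  The mixed terms \<open>h (x \<bullet> dir)\<close> and \<open>g (x \<bullet> tang)\<close> have the same integral, so the moment about \<open>x\<close> depends on
  the first harmonics of \<open>h\<close> alone.
\<close>

lemma moment_expand:
  assumes c: "((\<lambda>t. h t * (x \<bullet> dir t)) has_integral c) {0..2*pi}"
  shows "moment x = int_h2 + int_g2 + 2 * pi * (norm x)\<^sup>2 - 4 * c"
proof -
  have n: "(x \<bullet> dir t)\<^sup>2 + (x \<bullet> tang t)\<^sup>2 = (norm x)\<^sup>2" for t using frame_norm[of x t] by simp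
  have "((\<lambda>t. (h t)\<^sup>2 + (g t)\<^sup>2 + (norm x)\<^sup>2 - 2 * (g t * (x \<bullet> tang t) - h t * (x \<bullet> dir t))
      - 4 * (h t * (x \<bullet> dir t))) has_integral int_h2 + int_g2 + (2 * pi - 0) *\<^sub>R (norm x)\<^sup>2 - 2 * 0 - 4 * c) {0..2*pi}"
    by (intro has_integral_add has_integral_diff has_integral_mult_right has_integral_h2 has_integral_g2
        has_integral_cross c has_integral_const_real[THEN has_integral_eq_rhs]) auto
  moreover have "(h t)\<^sup>2 + (g t)\<^sup>2 + (norm x)\<^sup>2 - 2 * (g t * (x \<bullet> tang t) - h t * (x \<bullet> dir t))
      - 4 * (h t * (x \<bullet> dir t)) = (h t - x \<bullet> dir t)\<^sup>2 + (g t - x \<bullet> tang t)\<^sup>2" for t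
    unfolding n[of t, symmetric] by (simp add: power2_eq_square algebra_simps)
  ultimately show ?thesis by (simp add: moment_def integral_unique)
qed

lemma ball_functionals:
  assumes h: "\<And>t. h t = c \<bullet> dir t + r"
  shows "len = 2 * pi * r" "int_h2 - int_g2 = 2 * pi * r\<^sup>2"
    "moment x = 2 * pi * r\<^sup>2 + 2 * pi * (norm (x - c))\<^sup>2"
proof -
  interpret T: support_pair "\<lambda>t. h t - c \<bullet> dir t" "\<lambda>t. g t - c \<bullet> tang t" "R + norm c"
    by (rule translate)
  have g: "g t - c \<bullet> tang t = 0" if "t \<notin> kinks" for t
  proof -
    have "(h has_real_derivative c \<bullet> tang t + 0) (at t)"
      unfolding h[abs_def] by (intro derivative_intros inner_dir_deriv)
    then show ?thesis using DERIV_unique[OF h_deriv[OF that]] by simp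
  qed
  have "T.len = 2 * pi * r" unfolding T.len_def by (simp add: h)
  then show len: "len = 2 * pi * r" using len_translate[of c] unfolding T.len_def by simp
  have h2: "T.int_h2 = 2 * pi * r\<^sup>2" unfolding T.int_h2_def by (simp add: h)
  have "((\<lambda>t. (g t - c \<bullet> tang t)\<^sup>2) has_integral 0) {0..2*pi}"
    by (rule has_integral_spike[OF negligible_kinks, of _ _ "\<lambda>_. 0"]) (auto simp: g)
  then have g2: "T.int_g2 = 0" unfolding T.int_g2_def by (rule integral_unique)
  show "int_h2 - int_g2 = 2 * pi * r\<^sup>2"
    using has_integral_unique[OF area_translate[of c] has_integral_diff[OF T.has_integral_h2 T.has_integral_g2]] h2 g2
    by simp
  have "((\<lambda>t. r * ((x - c) \<bullet> dir t)) has_integral r * 0) {0..2*pi}"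
    by (intro has_integral_mult_right has_integral_inner_dir)
  then have "((\<lambda>t. (h t - c \<bullet> dir t) * ((x - c) \<bullet> dir t)) has_integral 0) {0..2*pi}"
    by (simp add: h)
  from T.moment_expand[OF this] have "T.moment (x - c) = 2 * pi * r\<^sup>2 + 2 * pi * (norm (x - c))\<^sup>2"
    using h2 g2 by simp
  moreover have "T.moment (x - c) = moment x"
    unfolding T.moment_def moment_def by (simp add: inner_diff_left)
  ultimately show "moment x = 2 * pi * r\<^sup>2 + 2 * pi * (norm (x - c))\<^sup>2" by simp
qed

end

section \<open>Planar convex bodies and their curvature measure\<close>

locale planar_body =
  fixes K :: "(real^2) set"
  assumes compact_K: "compact K" and convex_K: "convex K" and interior_K: "interior K \<noteq> {}"
begin

lemma K_nonempty: "K \<noteq> {}" using interior_K interior_subset by blast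

text \<open>
  Among the points of the body with outer normal \<open>dir t\<close>, \<open>pt t\<close> is the last one in counterclockwise order. On
  a flat side this choice matters: it keeps arcs with different normals apart in the computation of the
  perimeter, and it starts the tangent half-lines at the far end of the side in that of the area.
\<close>

definition h :: "real \<Rightarrow> real" where "h t = (SUP x\<in>K. x \<bullet> dir t)"
definition face :: "real \<Rightarrow> (real^2) set" where "face t = {x \<in> K. x \<bullet> dir t = h t}"
definition pt :: "real \<Rightarrow> real^2" where "pt t = (SOME x. x \<in> face t \<and> (\<forall>y\<in>face t. y \<bullet> tang t \<le> x \<bullet> tang t))"
definition g :: "real \<Rightarrow> real" where "g t = pt t \<bullet> tang t"
definition radius :: real where "radius = (SUP x\<in>K. norm x)"

lemma norm_le_radius: "x \<in> K \<Longrightarrow> norm x \<le> radius"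
  unfolding radius_def using compact_imp_bounded[OF compact_K]
  by (intro cSUP_upper) (auto simp: bounded_iff intro: bdd_aboveI2)

lemma inner_le_h: "x \<in> K \<Longrightarrow> x \<bullet> dir t \<le> h t"
  unfolding h_def
proof (rule cSUP_upper)
  have "compact ((\<lambda>x. x \<bullet> dir t) ` K)" by (intro compact_continuous_image continuous_intros compact_K)
  then show "bdd_above ((\<lambda>x. x \<bullet> dir t) ` K)" by (intro bounded_imp_bdd_above compact_imp_bounded)
qed

lemma compact_face: "compact (face t)"
proof -
  have "face t = K \<inter> {x. dir t \<bullet> x = h t}" by (auto simp: face_def inner_commute)
  then show ?thesis using compact_Int_closed[OF compact_K closed_hyperplane] by metis
qed

lemma face_nonempty: "face t \<noteq> {}"
proof -
  have "continuous_on K (\<lambda>x. x \<bullet> dir t)" by (intro continuous_intros)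
  then obtain x where x: "x \<in> K" "\<And>y. y \<in> K \<Longrightarrow> y \<bullet> dir t \<le> x \<bullet> dir t"
    using continuous_attains_sup[OF compact_K K_nonempty] by metis
  then have "h t \<le> x \<bullet> dir t" unfolding h_def using K_nonempty by (intro cSUP_least)
  then have "x \<in> face t" using x(1) inner_le_h[OF x(1), of t] by (auto simp: face_def)
  then show ?thesis by auto
qed

lemma pt_in_face: "pt t \<in> face t" and pt_extreme: "y \<in> face t \<Longrightarrow> y \<bullet> tang t \<le> g t"
proof -
  have "continuous_on (face t) (\<lambda>x. x \<bullet> tang t)" by (intro continuous_intros)
  then have "\<exists>x. x \<in> face t \<and> (\<forall>y\<in>face t. y \<bullet> tang t \<le> x \<bullet> tang t)"
    using continuous_attains_sup[OF compact_face face_nonempty] by blast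
  then have *: "pt t \<in> face t \<and> (\<forall>y\<in>face t. y \<bullet> tang t \<le> pt t \<bullet> tang t)"
    unfolding pt_def by (rule someI_ex)
  then show "pt t \<in> face t" "y \<in> face t \<Longrightarrow> y \<bullet> tang t \<le> g t" by (auto simp: g_def)
qed

lemma pt_in_K: "pt t \<in> K" and pt_dir: "pt t \<bullet> dir t = h t" and pt_tang: "pt t \<bullet> tang t = g t"
  using pt_in_face[of t] by (auto simp: face_def g_def)

lemma pt_eq: "pt t = h t *\<^sub>R dir t + g t *\<^sub>R tang t"
  using frame_decomp[of "pt t" t] by (simp add: pt_dir pt_tang)

lemma norm_pt: "(norm (pt t))\<^sup>2 = (h t)\<^sup>2 + (g t)\<^sup>2"
  using frame_norm[of "pt t" t] by (simp add: pt_dir pt_tang)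

lemma inner_dir_rotate: "x \<bullet> dir s = (x \<bullet> dir t) * cos (s - t) + (x \<bullet> tang t) * sin (s - t)"
  using dir_add[of t "s - t"] by (simp add: inner_add_right mult.commute)

sublocale support_pair h g radius
proof
  fix s t :: real
  show "h (t + 2 * pi) = h t" by (simp add: h_def)
  then have "pt (t + 2 * pi) = pt t" by (simp add: pt_def face_def)
  then show "g (t + 2 * pi) = g t" by (simp add: g_def)
  show "h t * cos (s - t) + g t * sin (s - t) \<le> h s"
    using inner_le_h[OF pt_in_K, of t s] inner_dir_rotate[of "pt t" s t] by (simp add: pt_dir pt_tang)
  have "\<bar>h t\<bar> \<le> norm (pt t)" "\<bar>g t\<bar> \<le> norm (pt t)"
    using Cauchy_Schwarz_ineq2[of "pt t" "dir t"] Cauchy_Schwarz_ineq2[of "pt t" "tang t"]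
    by (auto simp: pt_dir pt_tang)
  then show "\<bar>h t\<bar> \<le> radius" "\<bar>g t\<bar> \<le> radius" using norm_le_radius[OF pt_in_K[of t]] by auto
qed

lemma mem_iff_inner_le: "y \<in> K \<longleftrightarrow> (\<forall>t. y \<bullet> dir t \<le> h t)"
proof
  assume *: "\<forall>t. y \<bullet> dir t \<le> h t"
  show "y \<in> K"
  proof (rule ccontr)
    assume "y \<notin> K"
    then obtain a b where ab: "a \<bullet> y < b" "\<And>x. x \<in> K \<Longrightarrow> b < a \<bullet> x"
      using separating_hyperplane_closed_point[OF convex_K compact_imp_closed[OF compact_K]] by metis
    have "a \<noteq> 0"
      using ab K_nonempty by force
    define v where "v = - (1 / norm a) *\<^sub>R a"
    have "norm v = 1" using \<open>a \<noteq> 0\<close> by (simp add: v_def)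
    then obtain t where t: "v = dir t" using unit_eq_dir by metis
    have "- (a \<bullet> pt t) / norm a < - (a \<bullet> y) / norm a"
      using ab(1) ab(2)[OF pt_in_K[of t]] \<open>a \<noteq> 0\<close> by (intro divide_strict_right_mono) auto
    then have "pt t \<bullet> v < y \<bullet> v" by (simp add: v_def inner_commute)
    then show False using *[rule_format, of t] pt_dir[of t] by (simp add: t)
  qed
qed (auto intro: inner_le_h)

text \<open>
  If \<open>x \<bullet> dir t < h t\<close> for all \<open>t\<close>, then by compactness the gap has a positive minimum \<open>m\<close>, and the ball of
  radius \<open>m\<close> about \<open>x\<close> satisfies all inequalities that define \<open>K\<close>.
\<close>

lemma exists_normal: 
  assumes "x \<in> frontier K" shows "\<exists>t. 0 \<le> t \<and> t < 2 * pi \<and> x \<in> face t"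
proof (rule ccontr)
  assume no: "\<not> ?thesis"
  have x: "x \<in> K" "x \<notin> interior K"
    using assms compact_imp_closed[OF compact_K] by (auto simp: frontier_def)
  have "continuous_on {0..2*pi} (\<lambda>t. h t - x \<bullet> dir t)" by (intro continuous_intros h_continuous)
  then have "\<exists>t0\<in>{0..2*pi}. \<forall>t\<in>{0..2*pi}. h t0 - x \<bullet> dir t0 \<le> h t - x \<bullet> dir t"
    by (intro continuous_attains_inf) auto
  then obtain t0 where t0: "\<And>t. t \<in> {0..2*pi} \<Longrightarrow> h t0 - x \<bullet> dir t0 \<le> h t - x \<bullet> dir t"
    by blast
  obtain t1 where t1: "0 \<le> t1" "t1 < 2 * pi" "dir t0 = dir t1" using unit_eq_dir norm_dir by metis
  define m where "m = h t0 - x \<bullet> dir t0"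
  have "h t0 = h t1" using t1 by (simp add: h_def)
  then have "m \<noteq> 0" using no t1 x(1) by (auto simp: m_def face_def)
  moreover have "m \<ge> 0" using inner_le_h[OF x(1)] by (simp add: m_def)
  ultimately have "m > 0" by simp
  have "ball x m \<subseteq> K"
  proof
    fix y assume y: "y \<in> ball x m"
    show "y \<in> K" unfolding mem_iff_inner_le
    proof
      fix t
      obtain s where s: "0 \<le> s" "s < 2 * pi" "dir t = dir s" using unit_eq_dir norm_dir by metis
      have "(y - x) \<bullet> dir t \<le> norm (y - x)"
        using Cauchy_Schwarz_ineq2[of "y - x" "dir t"] by simp
      also have "\<dots> \<le> m" using y by (simp add: dist_norm norm_minus_commute)
      also have "m \<le> h s - x \<bullet> dir s" using t0(1)[of s] s by (simp add: m_def)
      also have "h s = h t" using s by (simp add: h_def)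
      finally show "y \<bullet> dir t \<le> h t" using s by (simp add: inner_diff_left)
    qed
  qed
  then have "x \<in> interior K" using \<open>m > 0\<close> by (meson centre_in_ball interior_maximal open_ball subsetD)
  then show False using x by simp
qed

lemma face_subset_frontier: "face t \<subseteq> frontier K"
proof
  fix x assume x: "x \<in> face t"
  have "x \<notin> interior K"
  proof
    assume "x \<in> interior K"
    then obtain e where e: "e > 0" "cball x e \<subseteq> K" unfolding mem_interior_cball by auto
    have "x + e *\<^sub>R dir t \<in> K" using e by (intro subsetD[OF e(2)]) (auto simp: dist_norm)
    from inner_le_h[OF this, of t] show False using x e by (simp add: face_def inner_add_left)
  qed
  then show "x \<in> frontier K" using x closure_subset by (auto simp: face_def frontier_def)
qed

lemma pt_in_frontier: "pt t \<in> frontier K" using face_subset_frontier pt_in_face by blast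

lemma outer_normals_eq:
  assumes "x \<in> K" shows "outer_unit_normals K x = dir ` {t. 0 \<le> t \<and> t < 2 * pi \<and> x \<in> face t}"
proof (intro set_eqI iffI)
  fix v assume "v \<in> outer_unit_normals K x"
  then have v: "norm v = 1" "\<And>y. y \<in> K \<Longrightarrow> v \<bullet> (y - x) \<le> 0" by (auto simp: outer_unit_normals_def)
  obtain t where t: "0 \<le> t" "t < 2 * pi" "v = dir t" using unit_eq_dir v(1) by metis
  have "h t \<le> x \<bullet> dir t"
    using v(2)[OF pt_in_K[of t]] pt_dir[of t] by (simp add: t inner_diff_right inner_commute)
  then have "x \<in> face t" using assms inner_le_h[of x t] by (auto simp: face_def)
  then show "v \<in> dir ` {t. 0 \<le> t \<and> t < 2 * pi \<and> x \<in> face t}" using t by auto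
next
  fix v assume "v \<in> dir ` {t. 0 \<le> t \<and> t < 2 * pi \<and> x \<in> face t}"
  then show "v \<in> outer_unit_normals K x"
    using inner_le_h by (auto simp: outer_unit_normals_def face_def inner_diff_right inner_commute)
qed

text \<open>
  Every point of the face provides an admissible slope, and at a point of differentiability there is only one.
\<close>

lemma face_eq_singleton: "t \<notin> kinks \<Longrightarrow> face t = {pt t}"
proof -
  assume t: "t \<notin> kinks"
  have "y = pt t" if "y \<in> face t" for y
  proof -
    have "y \<in> K" "y \<bullet> dir t = h t" using that by (auto simp: face_def)
    then have "h t * cos (s - t) + (y \<bullet> tang t) * sin (s - t) \<le> h s" for s
      using inner_le_h[of y s] inner_dir_rotate[of y s t] by simp
    then have "y \<bullet> tang t = g t" by (rule h_deriv_unique[OF t])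
    then show ?thesis using frame_decomp[of y t] pt_eq[of t] \<open>y \<bullet> dir t = h t\<close> by simp
  qed
  then show ?thesis using pt_in_face by blast
qed

lemma pt_borel: "pt \<in> borel_measurable borel"
proof -
  have "(\<lambda>t. h t *\<^sub>R dir t + g t *\<^sub>R tang t) \<in> borel_measurable borel"
    by (intro borel_measurable_add borel_measurable_scaleR h_borel g_borel
        borel_measurable_continuous_onI continuous_on_dir continuous_on_tang)
  then show ?thesis unfolding pt_eq[symmetric] .
qed

abbreviation angles :: "real measure" where "angles \<equiv> restrict_space lborel {0..<2*pi}"

lemma pt_angles [measurable]: "pt \<in> borel_measurable angles"
  by (rule measurable_restrict_space1) (use pt_borel in simp)

text \<open>
  The angles \<open>T\<close> whose face meets \<open>A\<close> contain the angles \<open>X\<close> whose distinguished point lies in \<open>A\<close>, and the two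
  sets differ only at angles with a flat side, of which there are countably many. So \<open>T\<close> is measurable although
  the set of normals is an uncountable union, and its length is that of \<open>X\<close>.
\<close>

lemma hausdorff1_normals:
  assumes A: "A \<in> sets borel"
  shows "hausdorff1 (\<Union>x\<in>A \<inter> frontier K. outer_unit_normals K x) = emeasure (distr angles borel pt) A"
proof -
  define T where "T = {t. 0 \<le> t \<and> t < 2 * pi \<and> A \<inter> face t \<noteq> {}}"
  define X where "X = pt -` A \<inter> {0..<2*pi}"
  have fK: "frontier K \<subseteq> K" using compact_imp_closed[OF compact_K] by (simp add: frontier_subset_closed)
  have "(\<Union>x\<in>A \<inter> frontier K. outer_unit_normals K x)
      = (\<Union>x\<in>A \<inter> frontier K. dir ` {t. 0 \<le> t \<and> t < 2 * pi \<and> x \<in> face t})"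
    by (intro SUP_cong refl outer_normals_eq) (use fK in auto)
  also have "\<dots> = dir ` T" using face_subset_frontier by (auto simp: T_def)
  finally have S: "(\<Union>x\<in>A \<inter> frontier K. outer_unit_normals K x) = dir ` T" .
  have X: "X \<in> sets borel" unfolding X_def using pt_borel A by (auto simp: measurable_def)
  have XT: "X \<subseteq> T" using pt_in_face by (auto simp: X_def T_def)
  have TX: "T - X \<subseteq> kinks" using face_eq_singleton by (auto simp: X_def T_def)
  have "countable (T - X)" using countable_subset[OF TX countable_kinks] .
  then have null: "T - X \<in> null_sets lebesgue"
    by (intro null_sets_completionI countable_imp_null_set_lborel)
  have T: "T = X \<union> (T - X)" using XT by auto
  have "X \<union> (T - X) \<in> sets lebesgue" using X null by (intro sets.Un) auto
  then have mT: "T \<in> sets lebesgue" using T by metis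
  have "hausdorff1 (dir ` T) = emeasure lebesgue T"
    by (rule hausdorff1_dir_image[OF mT]) (auto simp: T_def)
  also have "\<dots> = emeasure lebesgue X"
    using emeasure_Un_null_set[of X lebesgue "T - X"] X null T by auto
  also have "\<dots> = emeasure lborel X" using X by simp
  also have "\<dots> = emeasure angles X"
    by (subst emeasure_restrict_space) (auto simp: X_def)
  also have "\<dots> = emeasure (distr angles borel pt) A"
    by (subst emeasure_distr) (use A pt_angles in \<open>auto simp: X_def\<close>)
  finally show ?thesis using S by simp
qed

lemma curvature_measure_eq: "curvature_measure K = distr angles borel pt"
proof -
  have "curvature_measure K = measure_of UNIV (sets borel) (emeasure (distr angles borel pt))"
    unfolding curvature_measure_def
    by (rule measure_of_eq) (auto simp: hausdorff1_normals sets.sigma_sets_eq[of borel, simplified])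
  also have "\<dots> = distr angles borel pt"
    using measure_of_of_measure[of "distr angles borel pt"] by simp
  finally show ?thesis .
qed

lemma integral_angles:
  fixes F :: "real \<Rightarrow> real"
  assumes "F \<in> borel_measurable borel" "\<And>t. \<bar>F t\<bar> \<le> B"
  shows "(LINT t|angles. F t) = integral {0..2*pi} F"
proof -
  have "(LINT t|angles. F t) = (LINT t:{0..<2*pi}|lborel. F t)"
    by (subst integral_restrict_space) (auto simp: set_lebesgue_integral_def)
  also have "\<dots> = (LINT t:{0..2*pi}|lborel. F t)"
  proof (rule set_integral_cong_set)
    show "set_borel_measurable lborel {0..<2*pi} F" "set_borel_measurable lborel {0..2*pi} F"
      using assms(1) by (auto simp: set_borel_measurable_def)
    show "AE x in lborel. (x \<in> {0..2*pi}) = (x \<in> {0..<2*pi})"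
      by (rule AE_mp[OF AE_lborel_singleton[of "2*pi"]]) (auto intro!: AE_I2)
  qed
  also have "\<dots> = integral {0..2*pi} F"
    by (rule set_borel_integral_eq_integral(2)) (rule bounded_borel_integrable(1)[OF assms])
  finally show ?thesis .
qed

lemma curvature_integral:
  "(LINT x|curvature_measure K. (norm (x - c))\<^sup>2) = moment c"
  "(LINT x:frontier K|curvature_measure K. (norm (x - c))\<^sup>2) = moment c"
proof -
  have eq: "(norm (pt t - c))\<^sup>2 = (h t - c \<bullet> dir t)\<^sup>2 + (g t - c \<bullet> tang t)\<^sup>2" for t
    using frame_norm[of "pt t - c" t] by (simp add: inner_diff_left pt_dir pt_tang)
  have m: "(\<lambda>t. (norm (pt t - c))\<^sup>2) \<in> borel_measurable borel" using pt_borel by measurable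
  have b: "\<bar>(norm (pt t - c))\<^sup>2\<bar> \<le> (radius + norm c)\<^sup>2" for t
  proof -
    have "norm (pt t - c) \<le> radius + norm c"
      using norm_triangle_ineq4[of "pt t" c] norm_le_radius[OF pt_in_K[of t]] by linarith
    then show ?thesis by (simp add: power_mono)
  qed
  have "(LINT x|curvature_measure K. (norm (x - c))\<^sup>2) = (LINT t|angles. (norm (pt t - c))\<^sup>2)"
    unfolding curvature_measure_eq by (rule integral_distr) auto
  also have "\<dots> = moment c"
    using integral_angles[OF m b] by (simp add: moment_def eq)
  finally show 1: "(LINT x|curvature_measure K. (norm (x - c))\<^sup>2) = moment c" .
  have "(LINT x:frontier K|curvature_measure K. (norm (x - c))\<^sup>2)
      = (LINT t|angles. indicator (frontier K) (pt t) *\<^sub>R (norm (pt t - c))\<^sup>2)"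
    unfolding curvature_measure_eq set_lebesgue_integral_def by (rule integral_distr) auto
  also have "\<dots> = (LINT t|angles. (norm (pt t - c))\<^sup>2)" using pt_in_frontier by simp
  also have "\<dots> = moment c"
    using integral_angles[OF m b] by (simp add: moment_def eq)
  finally show "(LINT x:frontier K|curvature_measure K. (norm (x - c))\<^sup>2) = moment c" .
qed

lemma width_pos: "h t + h (t + pi) > 0"
proof -
  obtain x where "x \<in> interior K" using interior_K by auto
  then obtain e where e: "e > 0" "cball x e \<subseteq> K" unfolding mem_interior_cball by auto
  have "x + e *\<^sub>R dir t \<in> K" "x - e *\<^sub>R dir t \<in> K"
    using e by (auto intro!: subsetD[OF e(2)] simp: dist_norm)
  moreover have "dir (t + pi) = - dir t" using dir_add[of t pi] by simp
  ultimately show ?thesis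
    using inner_le_h[of "x + e *\<^sub>R dir t" t] inner_le_h[of "x - e *\<^sub>R dir t" "t + pi"] e
    by (simp add: inner_add_left inner_diff_left)
qed

end

section \<open>Perimeter as the integral of the support function\<close>

context planar_body
begin

text \<open>
  Where all normals lie within an angle \<open>\<Delta>\<close> of \<open>dir \<theta>\<close>, the boundary is a graph over the tangent at \<open>\<theta>\<close> with
  slopes at most \<open>tan \<Delta>\<close>: each of the two points lies below the tangent line of the other.
\<close>

lemma dist_le_tangential:
  assumes \<Delta>: "0 < \<Delta>" "\<Delta> < pi/2" and a: "0 \<le> a" "a \<le> \<Delta>" "x \<in> face (\<theta> + a)"
    and b: "0 \<le> b" "b \<le> \<Delta>" "y \<in> face (\<theta> + b)"
  shows "dist x y \<le> (1 / cos \<Delta>) * \<bar>(y - x) \<bullet> tang \<theta>\<bar>"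
proof -
  define p q where "p = (y - x) \<bullet> dir \<theta>" and "q = (y - x) \<bullet> tang \<theta>"
  have cos: "cos \<Delta> > 0" "cos a > 0" "cos b > 0" using \<Delta> a b by (auto intro!: cos_gt_zero_pi)
  have tan: "0 \<le> tan a" "tan a \<le> tan \<Delta>" "0 \<le> tan b" "tan b \<le> tan \<Delta>"
    using \<Delta> a b by (auto simp: tan_pos_pi2_le intro!: tan_mono_le)
  have "(y - x) \<bullet> dir (\<theta> + a) \<le> 0"
    using a(3) b(3) inner_le_h[of y "\<theta> + a"] by (auto simp: face_def inner_diff_left)
  then have "p * cos a + q * sin a \<le> 0"
    using inner_dir_rotate[of "y - x" "\<theta> + a" \<theta>] by (simp add: p_def q_def)
  then have pa: "p \<le> - q * tan a" using cos by (simp add: tan_def field_simps)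
  have "(y - x) \<bullet> dir (\<theta> + b) \<ge> 0"
    using a(3) b(3) inner_le_h[of x "\<theta> + b"] by (auto simp: face_def inner_diff_left)
  then have "p * cos b + q * sin b \<ge> 0"
    using inner_dir_rotate[of "y - x" "\<theta> + b" \<theta>] by (simp add: p_def q_def)
  then have pb: "- q * tan b \<le> p" using cos by (simp add: tan_def field_simps)
  have "- (q * tan a) \<le> \<bar>q\<bar> * tan \<Delta>" "q * tan b \<le> \<bar>q\<bar> * tan \<Delta>"
    by (intro abs_mult_le; use tan in simp)+
  then have "\<bar>p\<bar> \<le> \<bar>q\<bar> * tan \<Delta>" using pa pb unfolding abs_le_iff by simp
  then have "p\<^sup>2 \<le> (\<bar>q\<bar> * tan \<Delta>)\<^sup>2" using tan by (simp add: abs_le_square_iff[symmetric] abs_mult)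
  then have "p\<^sup>2 + q\<^sup>2 \<le> q\<^sup>2 * (1 + (tan \<Delta>)\<^sup>2)" by (simp add: power_mult_distrib algebra_simps)
  also have "1 + (tan \<Delta>)\<^sup>2 = (1 / cos \<Delta>)\<^sup>2"
    using tan_sec[of \<Delta>] cos by (simp add: inverse_eq_divide power_one_over)
  finally have "p\<^sup>2 + q\<^sup>2 \<le> ((1 / cos \<Delta>) * \<bar>q\<bar>)\<^sup>2"
    by (simp only: power_mult_distrib power2_abs mult.commute)
  moreover have "(dist x y)\<^sup>2 = p\<^sup>2 + q\<^sup>2"
    unfolding p_def q_def frame_norm[symmetric] by (simp add: dist_norm norm_minus_commute)
  ultimately have "(dist x y)\<^sup>2 \<le> ((1 / cos \<Delta>) * \<bar>q\<bar>)\<^sup>2" by (simp only:)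
  then have "dist x y \<le> (1 / cos \<Delta>) * \<bar>q\<bar>"
    by (rule power2_le_imp_le) (use cos in simp)
  then show ?thesis by (simp only: q_def)
qed

definition proj_chord :: "real \<Rightarrow> real \<Rightarrow> real" where "proj_chord \<theta> \<Delta> = (pt (\<theta> + \<Delta>) - pt \<theta>) \<bullet> tang \<theta>"

text \<open>
  Excluding the initial angle and including the final one makes consecutive arcs cover the boundary while each
  flat side lies in a single arc up to its end points.
\<close>

definition arc :: "real \<Rightarrow> real \<Rightarrow> (real^2) set" where "arc \<theta> \<Delta> = {x. \<exists>a. 0 < a \<and> a \<le> \<Delta> \<and> x \<in> face (\<theta> + a)}"

lemma arc_coordinate:
  assumes \<Delta>: "0 < \<Delta>" "\<Delta> < pi/2" and x: "x \<in> arc \<theta> \<Delta>"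
  shows "0 \<le> (x - pt \<theta>) \<bullet> tang \<theta>" "(x - pt \<theta>) \<bullet> tang \<theta> \<le> proj_chord \<theta> \<Delta>"
proof -
  obtain a where a: "0 < a" "a \<le> \<Delta>" "x \<in> face (\<theta> + a)" using x by (auto simp: arc_def)
  have xK: "x \<in> K" using a by (auto simp: face_def)
  have sin: "sin a > 0" and cos: "cos a \<ge> 0" "cos \<Delta> \<ge> 0"
    using a \<Delta> by (auto intro!: sin_gt_zero cos_ge_zero)
  have p: "(x - pt \<theta>) \<bullet> dir \<theta> \<le> 0"
    using inner_le_h[OF xK, of \<theta>] pt_dir[of \<theta>] by (simp add: inner_diff_left)
  have "0 \<le> (x - pt \<theta>) \<bullet> dir (\<theta> + a)"
    using inner_le_h[OF pt_in_K, of \<theta> "\<theta> + a"] a(3) by (simp add: inner_diff_left face_def)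
  also have "\<dots> = ((x - pt \<theta>) \<bullet> dir \<theta>) * cos a + ((x - pt \<theta>) \<bullet> tang \<theta>) * sin a"
    using inner_dir_rotate[of "x - pt \<theta>" "\<theta> + a" \<theta>] by simp
  finally have "0 \<le> ((x - pt \<theta>) \<bullet> tang \<theta>) * sin a"
    using mult_nonpos_nonneg[OF p cos(1)] by linarith
  then show "0 \<le> (x - pt \<theta>) \<bullet> tang \<theta>" using sin by (simp add: zero_le_mult_iff)
  define w where "w = pt (\<theta> + \<Delta>) - x"
  have w1: "w \<bullet> dir (\<theta> + a) \<le> 0"
    using inner_le_h[OF pt_in_K, of "\<theta> + \<Delta>" "\<theta> + a"] a(3) by (simp add: w_def inner_diff_left face_def)
  have w2: "0 \<le> w \<bullet> dir (\<theta> + \<Delta>)"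
    using inner_le_h[OF xK, of "\<theta> + \<Delta>"] pt_dir by (simp add: w_def inner_diff_left)
  have "0 \<le> w \<bullet> tang \<theta>"
  proof (cases "a = \<Delta>")
    case True
    have d: "w \<bullet> dir (\<theta> + \<Delta>) = 0" using w1 w2 True by simp
    have "0 \<le> w \<bullet> tang (\<theta> + \<Delta>)"
      using pt_extreme[of x "\<theta> + \<Delta>"] a(3) True by (simp add: w_def inner_diff_left pt_tang)
    moreover have "w \<bullet> tang \<theta> = (w \<bullet> tang (\<theta> + \<Delta>)) * cos \<Delta>"
      using frame_inner[of w "tang \<theta>" "\<theta> + \<Delta>"] d by (simp add: tang_add inner_diff_right)
    ultimately show ?thesis using cos by simp
  next
    case False
    have "w \<bullet> dir (\<theta> + a) = (w \<bullet> dir \<theta>) * cos a + (w \<bullet> tang \<theta>) * sin a"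
      "w \<bullet> dir (\<theta> + \<Delta>) = (w \<bullet> dir \<theta>) * cos \<Delta> + (w \<bullet> tang \<theta>) * sin \<Delta>"
      using inner_dir_rotate[of w "\<theta> + a" \<theta>] inner_dir_rotate[of w "\<theta> + \<Delta>" \<theta>] by auto
    then have "(w \<bullet> dir (\<theta> + \<Delta>)) * cos a - (w \<bullet> dir (\<theta> + a)) * cos \<Delta> = (w \<bullet> tang \<theta>) * sin (\<Delta> - a)"
      by (simp add: sin_diff algebra_simps)
    moreover have "0 \<le> (w \<bullet> dir (\<theta> + \<Delta>)) * cos a" "(w \<bullet> dir (\<theta> + a)) * cos \<Delta> \<le> 0"
      using w1 w2 cos by (auto intro: mult_nonpos_nonneg)
    ultimately have "0 \<le> (w \<bullet> tang \<theta>) * sin (\<Delta> - a)" by linarith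
    moreover have "sin (\<Delta> - a) > 0" using False a \<Delta> by (intro sin_gt_zero) auto
    ultimately show ?thesis by (simp add: zero_le_mult_iff)
  qed
  then show "(x - pt \<theta>) \<bullet> tang \<theta> \<le> proj_chord \<theta> \<Delta>"
    by (simp add: w_def proj_chord_def inner_diff_left)
qed

lemma proj_chord_nonneg: 
  assumes "0 < \<Delta>" "\<Delta> < pi/2" shows "0 \<le> proj_chord \<theta> \<Delta>"
proof -
  have "pt (\<theta> + \<Delta>) \<in> arc \<theta> \<Delta>" using pt_in_face assms by (auto simp: arc_def)
  from arc_coordinate[OF assms this] show ?thesis by linarith
qed

lemma hausdorff1_arc_le:
  assumes \<Delta>: "0 < \<Delta>" "\<Delta> < pi/2"
  shows "hausdorff1 (arc \<theta> \<Delta>) \<le> ennreal (proj_chord \<theta> \<Delta> / cos \<Delta>)"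
proof -
  define c where "c x = (x - pt \<theta>) \<bullet> tang \<theta>" for x
  have cos: "cos \<Delta> > 0" using \<Delta> by (intro cos_gt_zero_pi) auto
  have lip: "dist x y \<le> (1 / cos \<Delta>) * dist (c x) (c y)" if xy: "x \<in> arc \<theta> \<Delta>" "y \<in> arc \<theta> \<Delta>" for x y
  proof -
    obtain a b where "0 < a" "a \<le> \<Delta>" "x \<in> face (\<theta> + a)" "0 < b" "b \<le> \<Delta>" "y \<in> face (\<theta> + b)"
      using xy by (auto simp: arc_def)
    then have "dist x y \<le> (1 / cos \<Delta>) * \<bar>(y - x) \<bullet> tang \<theta>\<bar>"
      by (intro dist_le_tangential[OF \<Delta>, of a _ _ b]) auto
    moreover have "(y - x) \<bullet> tang \<theta> = c y - c x" by (simp add: c_def inner_diff_left)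
    ultimately show ?thesis by (simp add: dist_real_def abs_minus_commute)
  qed
  have inj: "inj_on c (arc \<theta> \<Delta>)"
  proof (rule inj_onI)
    fix x y assume "x \<in> arc \<theta> \<Delta>" "y \<in> arc \<theta> \<Delta>" "c x = c y"
    then show "x = y" using lip[of x y] by simp
  qed
  have inv: "inv_into (arc \<theta> \<Delta>) c ` (c ` arc \<theta> \<Delta>) = arc \<theta> \<Delta>"
    using inj by (simp add: inv_into_image_cancel)
  have "hausdorff1 (c ` arc \<theta> \<Delta>) \<le> hausdorff1 {0..proj_chord \<theta> \<Delta>}"
    using arc_coordinate[OF \<Delta>] by (intro hausdorff1_mono) (auto simp: c_def)
  also have "hausdorff1 {0..proj_chord \<theta> \<Delta>} = ennreal (proj_chord \<theta> \<Delta>)"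
    using proj_chord_nonneg[OF \<Delta>] by (subst hausdorff1_eq_emeasure[of _ 0 "proj_chord \<theta> \<Delta>"]) auto
  finally have proj: "hausdorff1 (c ` arc \<theta> \<Delta>) \<le> ennreal (proj_chord \<theta> \<Delta>)" .
  have "hausdorff1 (inv_into (arc \<theta> \<Delta>) c ` (c ` arc \<theta> \<Delta>)) \<le> ennreal (1 / cos \<Delta>) * hausdorff1 (c ` arc \<theta> \<Delta>)"
  proof (rule hausdorff1_image_le[of _ 1])
    fix u v assume "u \<in> c ` arc \<theta> \<Delta>" "v \<in> c ` arc \<theta> \<Delta>"
    then obtain x y where "x \<in> arc \<theta> \<Delta>" "y \<in> arc \<theta> \<Delta>" "u = c x" "v = c y" by blast
    then show "dist (inv_into (arc \<theta> \<Delta>) c u) (inv_into (arc \<theta> \<Delta>) c v) \<le> 1 / cos \<Delta> * dist u v"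
      using lip[of x y] inj by (simp only: inv_into_f_f)
  qed (use cos in auto)
  also have "\<dots> \<le> ennreal (1 / cos \<Delta>) * ennreal (proj_chord \<theta> \<Delta>)"
    using proj by (rule mult_left_mono) simp
  also have "\<dots> = ennreal (proj_chord \<theta> \<Delta> / cos \<Delta>)"
    using cos proj_chord_nonneg[OF \<Delta>] by (subst ennreal_mult[symmetric]) auto
  finally show ?thesis unfolding inv .
qed

text \<open>
  Both projections of this set are used: compactness in the angle gives a connectedness argument, and compactness
  in the point gives compact arcs.
\<close>

lemma compact_normal_bundle: "compact {(a, x). a \<in> {0..\<Delta>} \<and> x \<in> face (\<theta> + a)}"
proof -
  have 1: "continuous_on UNIV (\<lambda>z :: real \<times> (real^2). dir (\<theta> + fst z))"
    by (rule continuous_on_compose2[OF continuous_on_dir[of UNIV]]) (auto intro!: continuous_intros)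
  have 2: "continuous_on UNIV (\<lambda>z :: real \<times> (real^2). h (\<theta> + fst z))"
    by (rule continuous_on_compose2[OF h_continuous[of UNIV]]) (auto intro!: continuous_intros)
  have 3: "closed {z :: real \<times> (real^2). snd z \<bullet> dir (\<theta> + fst z) = h (\<theta> + fst z)}"
    by (intro closed_Collect_eq continuous_intros 1 2)
  have eq: "{(a, x). a \<in> {0..\<Delta>} \<and> x \<in> face (\<theta> + a)}
      = ({0..\<Delta>} \<times> K) \<inter> {z. snd z \<bullet> dir (\<theta> + fst z) = h (\<theta> + fst z)}"
    by (auto simp: face_def)
  show ?thesis
    unfolding eq by (rule compact_Int_closed[OF compact_Times[OF compact_Icc compact_K] 3])
qed

lemma convex_face: "convex (face t)"
proof -
  have "face t = K \<inter> {x. dir t \<bullet> x = h t}" by (auto simp: face_def inner_commute)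
  then show ?thesis using convex_Int[OF convex_K convex_hyperplane] by metis
qed

text \<open>
  The angles at which the face has a point with coordinate at most \<open>s\<close>, and those with a point of coordinate at
  least \<open>s\<close>, are closed sets that cover the interval of angles. A common angle exists by connectedness, and its face
  is convex.
\<close>

lemma arc_coordinate_surj:
  assumes \<Delta>: "0 < \<Delta>" and s: "0 \<le> s" "s \<le> proj_chord \<theta> \<Delta>"
  shows "\<exists>a\<in>{0..\<Delta>}. \<exists>x\<in>face (\<theta> + a). (x - pt \<theta>) \<bullet> tang \<theta> = s"
proof -
  define c where "c x = (x - pt \<theta>) \<bullet> tang \<theta>" for x
  define G where "G = {(a, x). a \<in> {0..\<Delta>} \<and> x \<in> face (\<theta> + a)}"
  have G: "compact G" unfolding G_def by (rule compact_normal_bundle)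
  have cl: "closed {z :: real \<times> (real^2). c (snd z) \<le> s}" "closed {z :: real \<times> (real^2). s \<le> c (snd z)}"
    unfolding c_def by (intro closed_Collect_le continuous_intros)+
  define P Q where "P = fst ` (G \<inter> {z. c (snd z) \<le> s})" and "Q = fst ` (G \<inter> {z. s \<le> c (snd z)})"
  have "closed P" "closed Q" unfolding P_def Q_def
    by (intro compact_imp_closed compact_continuous_image continuous_intros compact_Int_closed G cl)+
  moreover have "(0, pt \<theta>) \<in> G" using pt_in_face[of \<theta>] \<Delta> by (auto simp: G_def)
  then have "0 \<in> P" unfolding P_def using s by (force simp: c_def)
  moreover have "(\<Delta>, pt (\<theta> + \<Delta>)) \<in> G" using pt_in_face \<Delta> by (auto simp: G_def)
  then have "\<Delta> \<in> Q" unfolding Q_def using s by (force simp: c_def proj_chord_def)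
  moreover have "{0..\<Delta>} \<subseteq> P \<union> Q"
  proof
    fix a assume "a \<in> {0..\<Delta>}"
    then have "(a, pt (\<theta> + a)) \<in> G" using pt_in_face by (auto simp: G_def)
    moreover have "c (pt (\<theta> + a)) \<le> s \<or> s \<le> c (pt (\<theta> + a))" by linarith
    ultimately show "a \<in> P \<union> Q" unfolding P_def Q_def by force
  qed
  moreover have "0 \<in> {0..\<Delta>}" "\<Delta> \<in> {0..\<Delta>}" using \<Delta> by auto
  ultimately have "P \<inter> Q \<inter> {0..\<Delta>} \<noteq> {}"
    using connected_closedD[OF connected_Icc[of 0 \<Delta>], of P Q] by blast
  then obtain a where aP: "a \<in> P" and aQ: "a \<in> Q" by blast
  obtain x where x: "(a, x) \<in> G" "c x \<le> s" using aP unfolding P_def by auto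
  obtain y where y: "(a, y) \<in> G" "s \<le> c y" using aQ unfolding Q_def by auto
  have a: "a \<in> {0..\<Delta>}" and xy: "x \<in> face (\<theta> + a)" "c x \<le> s" "y \<in> face (\<theta> + a)" "s \<le> c y"
    using x y by (auto simp: G_def)
  show ?thesis
  proof (cases "c x = c y")
    case False
    define u where "u = (s - c x) / (c y - c x)"
    have cxy: "c x < c y" using xy False by linarith
    have u: "0 \<le> u" "u \<le> 1" using xy cxy by (auto simp: u_def field_simps)
    have "(1 - u) *\<^sub>R x + u *\<^sub>R y \<in> face (\<theta> + a)"
      using convexD_alt[OF convex_face xy(1,3) u] .
    moreover have "c ((1 - u) *\<^sub>R x + u *\<^sub>R y) = (1 - u) * c x + u * c y"
      by (simp add: c_def inner_add_left inner_diff_left algebra_simps)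
    moreover have "u * (c y - c x) = s - c x" using cxy by (simp add: u_def)
    then have "(1 - u) * c x + u * c y = s" by (simp add: algebra_simps)
    ultimately show ?thesis using a unfolding c_def by (intro bexI[of _ a] bexI[of _ "(1 - u) *\<^sub>R x + u *\<^sub>R y"]) auto
  qed (use a xy in \<open>auto simp: c_def\<close>)
qed

text \<open>
  Cutting off a margin \<open>\<epsilon>\<close> at the beginning excludes the whole face at the initial angle, which makes arcs over
  nonoverlapping angle intervals disjoint compact sets.
\<close>

definition inner_arc :: "real \<Rightarrow> real \<Rightarrow> real \<Rightarrow> (real^2) set" where
  "inner_arc \<epsilon> \<theta> \<Delta> = {x. \<epsilon> \<le> (x - pt \<theta>) \<bullet> tang \<theta> \<and> (\<exists>a. 0 \<le> a \<and> a \<le> \<Delta> \<and> x \<in> face (\<theta> + a))}"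

lemma compact_inner_arc: "compact (inner_arc \<epsilon> \<theta> \<Delta>)"
proof -
  define G where "G = {(a, x). a \<in> {0..\<Delta>} \<and> x \<in> face (\<theta> + a)}"
  have "closed {z :: real \<times> (real^2). \<epsilon> \<le> (snd z - pt \<theta>) \<bullet> tang \<theta>}"
    by (intro closed_Collect_le continuous_intros)
  then have "compact (snd ` (G \<inter> {z. \<epsilon> \<le> (snd z - pt \<theta>) \<bullet> tang \<theta>}))"
    unfolding G_def by (intro compact_continuous_image continuous_intros compact_Int_closed compact_normal_bundle)
  moreover have "snd ` (G \<inter> {z. \<epsilon> \<le> (snd z - pt \<theta>) \<bullet> tang \<theta>}) = inner_arc \<epsilon> \<theta> \<Delta>"
    unfolding G_def inner_arc_def by force
  ultimately show ?thesis by simp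
qed

lemma hausdorff1_inner_arc_ge:
  assumes \<Delta>: "0 < \<Delta>" and \<epsilon>: "0 \<le> \<epsilon>"
  shows "ennreal (proj_chord \<theta> \<Delta> - \<epsilon>) \<le> hausdorff1 (inner_arc \<epsilon> \<theta> \<Delta>)"
proof (cases "\<epsilon> \<le> proj_chord \<theta> \<Delta>")
  case True
  define c where "c x = (x - pt \<theta>) \<bullet> tang \<theta>" for x
  have "{\<epsilon>..proj_chord \<theta> \<Delta>} \<subseteq> c ` inner_arc \<epsilon> \<theta> \<Delta>"
  proof
    fix s assume s: "s \<in> {\<epsilon>..proj_chord \<theta> \<Delta>}"
    then obtain a x where "a \<in> {0..\<Delta>}" "x \<in> face (\<theta> + a)" "c x = s"
      using arc_coordinate_surj[OF \<Delta>, of s \<theta>] \<epsilon> unfolding c_def by auto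
    then have "x \<in> inner_arc \<epsilon> \<theta> \<Delta>" using s by (auto simp: inner_arc_def c_def)
    then show "s \<in> c ` inner_arc \<epsilon> \<theta> \<Delta>" using \<open>c x = s\<close> by auto
  qed
  then have "hausdorff1 {\<epsilon>..proj_chord \<theta> \<Delta>} \<le> hausdorff1 (c ` inner_arc \<epsilon> \<theta> \<Delta>)"
    by (rule hausdorff1_mono)
  also have "\<dots> \<le> ennreal 1 * hausdorff1 (inner_arc \<epsilon> \<theta> \<Delta>)"
  proof (rule hausdorff1_image_le[of 1 1])
    fix x y :: "real^2"
    have "c x - c y = (x - y) \<bullet> tang \<theta>" by (simp add: c_def inner_diff_left)
    then show "dist (c x) (c y) \<le> 1 * dist x y"
      using Cauchy_Schwarz_ineq2[of "x - y" "tang \<theta>"] by (simp add: dist_real_def dist_norm)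
  qed auto
  finally show ?thesis
    using True hausdorff1_eq_emeasure[of "{\<epsilon>..proj_chord \<theta> \<Delta>}" \<epsilon> "proj_chord \<theta> \<Delta>"] by simp
qed (simp add: ennreal_neg)

text \<open>
  The normal directions at a point form a convex cone.
\<close>

lemma face_cone:
  assumes "x \<in> face s" "x \<in> face u" "s \<le> t" "t \<le> u" "u < s + pi"
  shows "x \<in> face t"
proof (cases "s = u")
  case False
  have sin: "sin (u - s) > 0" "sin (u - t) \<ge> 0" "sin (t - s) \<ge> 0"
    using assms False by (auto intro!: sin_gt_zero sin_ge_zero)
  have comb: "sin (u - s) * (y \<bullet> dir t) = sin (u - t) * (y \<bullet> dir s) + sin (t - s) * (y \<bullet> dir u)" for y
  proof -
    have "sin (u - s) * cos t = sin (u - t) * cos s + sin (t - s) * cos u"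
      "sin (u - s) * sin t = sin (u - t) * sin s + sin (t - s) * sin u"
      using sin_cos_squared_add3[of s] sin_cos_squared_add3[of t] sin_cos_squared_add3[of u]
      unfolding sin_diff by algebra+
    then show ?thesis unfolding inner_dir_eq by algebra
  qed
  have x: "x \<in> K" "x \<bullet> dir s = h s" "x \<bullet> dir u = h u" using assms by (auto simp: face_def)
  have "sin (u - s) * (pt t \<bullet> dir t) \<le> sin (u - s) * (x \<bullet> dir t)"
    unfolding comb x(2,3) using sin inner_le_h[OF pt_in_K, of t] by (intro add_mono mult_left_mono) auto
  then have "h t \<le> x \<bullet> dir t" using sin by (simp add: pt_dir)
  then show ?thesis using inner_le_h[OF x(1), of t] x by (auto simp: face_def)
qed (use assms in auto)

lemma face_periodic: "face (t + 2 * pi) = face t"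
  by (simp add: face_def h_periodic)

text \<open>
  A common point has a normal in each of the two angle intervals. The normals in between, on whichever side the
  angle is below \<open>pi\<close>, include the initial angle of one of the arcs, which the margin forbids. The angle cannot
  be exactly \<open>pi\<close> because the body has positive width.
\<close>

lemma inner_arc_disjoint:
  assumes \<epsilon>: "0 < \<epsilon>" and order: "0 \<le> \<theta>" "\<theta> + \<Delta> \<le> \<theta>'" "\<theta>' + \<Delta>' \<le> 2 * pi"
  shows "inner_arc \<epsilon> \<theta> \<Delta> \<inter> inner_arc \<epsilon> \<theta>' \<Delta>' = {}"
proof (rule equals0I)
  fix x assume x: "x \<in> inner_arc \<epsilon> \<theta> \<Delta> \<inter> inner_arc \<epsilon> \<theta>' \<Delta>'"
  then obtain a b where ab: "0 \<le> a" "a \<le> \<Delta>" "x \<in> face (\<theta> + a)" "0 \<le> b" "b \<le> \<Delta>'" "x \<in> face (\<theta>' + b)"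
    by (auto simp: inner_arc_def)
  have no: "x \<notin> face \<theta>" "x \<notin> face \<theta>'"
    using x \<epsilon> pt_extreme[of x \<theta>] pt_extreme[of x \<theta>'] by (auto simp: inner_arc_def inner_diff_left pt_tang)
  consider "\<theta>' + b < \<theta> + a + pi" | "\<theta>' + b = \<theta> + a + pi" | "\<theta>' + b > \<theta> + a + pi" by linarith
  then show False
  proof cases
    case 1
    have "x \<in> face \<theta>'"
      by (rule face_cone[OF ab(3,6)]) (use 1 ab order in auto)
    then show False using no by simp
  next
    case 2
    have "dir (\<theta> + a + pi) = - dir (\<theta> + a)" using dir_add[of "\<theta> + a" pi] by simp
    then show False using width_pos[of "\<theta> + a"] ab 2 by (simp add: face_def)
  next
    case 3
    have "x \<in> face (\<theta> + 2 * pi)"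
      by (rule face_cone[OF ab(6), of "\<theta> + a + 2 * pi"]) (use 3 ab order face_periodic in auto)
    then show False using no face_periodic by simp
  qed
qed

lemma proj_chord_eq: "proj_chord \<theta> \<Delta> = h (\<theta> + \<Delta>) * sin \<Delta> + g (\<theta> + \<Delta>) * cos \<Delta> - g \<theta>"
proof -
  have "pt (\<theta> + \<Delta>) \<bullet> tang \<theta> = h (\<theta> + \<Delta>) * sin \<Delta> + g (\<theta> + \<Delta>) * cos \<Delta>"
    unfolding pt_eq[of "\<theta> + \<Delta>"] by (simp add: inner_add_left dir_add tang_add inner_diff_left)
  then show ?thesis by (simp add: proj_chord_def inner_diff_left pt_tang)
qed

definition mesh :: "nat \<Rightarrow> real" where "mesh n = 2 * pi / real n"
definition proj_chord_sum :: "nat \<Rightarrow> real" where "proj_chord_sum n = (\<Sum>i<n. proj_chord (real i * mesh n) (mesh n))"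

lemma mesh_bounds: "n \<ge> 5 \<Longrightarrow> 0 < mesh n \<and> mesh n < pi / 2"
  using pi_gt_zero by (auto simp: mesh_def field_simps)

text \<open>
  The arcs cover the boundary, and each is a Lipschitz image of an interval of length \<open>proj_chord\<close>.
\<close>

lemma hausdorff1_frontier_le:
  assumes n: "n \<ge> 5"
  shows "hausdorff1 (frontier K) \<le> ennreal (proj_chord_sum n / cos (mesh n))"
proof -
  have m: "0 < mesh n" "mesh n < pi / 2" using mesh_bounds[OF n] by auto
  have cos: "cos (mesh n) > 0" using m by (intro cos_gt_zero_pi) auto
  have nm: "real n * mesh n = 2 * pi" using n by (simp add: mesh_def)
  have "frontier K \<subseteq> (\<Union>i<n. arc (real i * mesh n) (mesh n))"
  proof
    fix x assume "x \<in> frontier K"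
    then obtain t0 where t0: "0 \<le> t0" "t0 < 2 * pi" "x \<in> face t0" using exists_normal by blast
    define t where "t = (if t0 = 0 then 2 * pi else t0)"
    have t: "0 < t" "t \<le> 2 * pi" "x \<in> face t" using t0 face_periodic[of 0] by (auto simp: t_def)
    \<comment> \<open>Rounding up places \<open>t\<close> in a half-open interval that contains its right end, as in the definition of \<open>arc\<close>.\<close>
    define i where "i = nat (\<lceil>t / mesh n\<rceil> - 1)"
    have "0 < t / mesh n" using t m by simp
    then have "1 \<le> \<lceil>t / mesh n\<rceil>" by linarith
    then have ri: "real i = of_int \<lceil>t / mesh n\<rceil> - 1" by (simp add: i_def)
    have "real i < t / mesh n" "t / mesh n \<le> real i + 1" unfolding ri by linarith+
    then have i1: "real i * mesh n < t" "t \<le> (real i + 1) * mesh n" using m by (auto simp: field_simps)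
    then have "real i * mesh n < real n * mesh n" using t nm by linarith
    then have "i < n" using m by simp
    moreover have "x \<in> arc (real i * mesh n) (mesh n)"
      unfolding arc_def using i1 t by (intro CollectI exI[of _ "t - real i * mesh n"]) (auto simp: algebra_simps)
    ultimately show "x \<in> (\<Union>i<n. arc (real i * mesh n) (mesh n))" by auto
  qed
  then have "hausdorff1 (frontier K) \<le> hausdorff1 (\<Union>i<n. arc (real i * mesh n) (mesh n))"
    by (rule hausdorff1_mono)
  also have "\<dots> \<le> (\<Sum>i<n. hausdorff1 (arc (real i * mesh n) (mesh n)))"
    by (rule hausdorff1_UN_le) simp
  also have "\<dots> \<le> (\<Sum>i<n. ennreal (proj_chord (real i * mesh n) (mesh n) / cos (mesh n)))"
    by (intro sum_mono hausdorff1_arc_le m)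
  also have "\<dots> = ennreal (proj_chord_sum n / cos (mesh n))"
    using cos proj_chord_nonneg[OF m] by (subst sum_ennreal) (auto simp: proj_chord_sum_def sum_divide_distrib)
  finally show ?thesis .
qed

text \<open>
  Disjoint compact arcs add up, and projection to the tangent line does not increase length.
\<close>

lemma hausdorff1_frontier_ge:
  assumes n: "n \<ge> 5"
  shows "ennreal (proj_chord_sum n) \<le> hausdorff1 (frontier K)"
proof (rule ennreal_le_epsilon)
  fix e :: real assume "e > 0"
  have m: "0 < mesh n" "mesh n < pi / 2" using mesh_bounds[OF n] by auto
  have nm: "real n * mesh n = 2 * pi" using n by (simp add: mesh_def)
  define \<epsilon> where "\<epsilon> = e / real n"
  have \<epsilon>: "\<epsilon> > 0" using \<open>e > 0\<close> n by (simp add: \<epsilon>_def)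
  let ?\<theta> = "\<lambda>i. real i * mesh n"
  have disj: "inner_arc \<epsilon> (?\<theta> i) (mesh n) \<inter> inner_arc \<epsilon> (?\<theta> j) (mesh n) = {}" if "i < j" "j < n" for i j
  proof (rule inner_arc_disjoint[OF \<epsilon>])
    have "(real i + 1) * mesh n \<le> real j * mesh n" "(real j + 1) * mesh n \<le> real n * mesh n"
      using that m by (auto intro!: mult_right_mono)
    then show "?\<theta> i + mesh n \<le> ?\<theta> j" "?\<theta> j + mesh n \<le> 2 * pi" using nm by (auto simp: algebra_simps)
  qed (use m in auto)
  have "ennreal (\<Sum>i<n. max 0 (proj_chord (?\<theta> i) (mesh n) - \<epsilon>)) = (\<Sum>i<n. ennreal (max 0 (proj_chord (?\<theta> i) (mesh n) - \<epsilon>)))"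
    by (rule sum_ennreal[symmetric]) simp
  also have "\<dots> = (\<Sum>i<n. ennreal (proj_chord (?\<theta> i) (mesh n) - \<epsilon>))"
    by (intro sum.cong refl) (simp add: max_def ennreal_neg)
  also have "\<dots> \<le> (\<Sum>i<n. hausdorff1 (inner_arc \<epsilon> (?\<theta> i) (mesh n)))"
    using m \<epsilon> by (intro sum_mono hausdorff1_inner_arc_ge) auto
  also have "\<dots> \<le> hausdorff1 (\<Union>i<n. inner_arc \<epsilon> (?\<theta> i) (mesh n))"
  proof (rule sum_hausdorff1_le_UN_compact)
    show "inner_arc \<epsilon> (?\<theta> i) (mesh n) \<inter> inner_arc \<epsilon> (?\<theta> j) (mesh n) = {}"
      if "i \<in> {..<n}" "j \<in> {..<n}" "i \<noteq> j" for i j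
      using disj[of i j] disj[of j i] that by (cases "i < j") auto
  qed (auto simp: compact_inner_arc)
  also have "\<dots> \<le> hausdorff1 (frontier K)"
    using face_subset_frontier by (intro hausdorff1_mono) (auto simp: inner_arc_def)
  finally have 1: "ennreal (\<Sum>i<n. max 0 (proj_chord (?\<theta> i) (mesh n) - \<epsilon>)) \<le> hausdorff1 (frontier K)" .
  have "proj_chord_sum n \<le> (\<Sum>i<n. max 0 (proj_chord (?\<theta> i) (mesh n) - \<epsilon>) + \<epsilon>)"
    unfolding proj_chord_sum_def by (intro sum_mono) auto
  also have "\<dots> = (\<Sum>i<n. max 0 (proj_chord (?\<theta> i) (mesh n) - \<epsilon>)) + e"
    using n by (simp add: sum.distrib \<epsilon>_def)
  finally have "ennreal (proj_chord_sum n) \<le> ennreal ((\<Sum>i<n. max 0 (proj_chord (?\<theta> i) (mesh n) - \<epsilon>)) + e)"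
    by (rule ennreal_leI)
  also have "\<dots> = ennreal (\<Sum>i<n. max 0 (proj_chord (?\<theta> i) (mesh n) - \<epsilon>)) + ennreal e"
    using \<open>e > 0\<close> by (intro ennreal_plus sum_nonneg) auto
  also have "\<dots> \<le> hausdorff1 (frontier K) + ennreal e" using 1 by (rule add_right_mono)
  finally show "ennreal (proj_chord_sum n) \<le> hausdorff1 (frontier K) + ennreal e" .
qed

lemma riemann_sum_bound:
  assumes \<Delta>: "\<Delta> \<ge> 0"
  shows "\<bar>integral {0..real n * \<Delta>} h - \<Delta> * (\<Sum>i<n. h (real (Suc i) * \<Delta>))\<bar> \<le> real n * (2 * radius * \<Delta> * \<Delta>)"
proof (induction n)
  case (Suc n)
  let ?a = "real n * \<Delta>" and ?b = "real (Suc n) * \<Delta>"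
  have ab: "0 \<le> ?a" "?a \<le> ?b" "?b - ?a = \<Delta>" using \<Delta> by (auto simp: algebra_simps)
  have comb: "integral {0..?b} h = integral {0..?a} h + integral {?a..?b} h"
    using ab h_pow_integrable(2) by (intro Henstock_Kurzweil_Integration.integral_combine[symmetric]) auto
  have "((\<lambda>y. h y - h ?b) has_integral integral {?a..?b} h - (?b - ?a) *\<^sub>R h ?b) {?a..?b}"
    using ab has_integral_const_real[of "h ?b" ?a ?b] by (intro has_integral_diff integrable_integral h_pow_integrable) auto
  moreover have "\<bar>h y - h ?b\<bar> \<le> 2 * radius * \<Delta>" if "y \<in> {?a..?b}" for y
  proof -
    have "\<bar>h y - h ?b\<bar> \<le> 2 * radius * \<bar>y - ?b\<bar>"
      using lipschitz_onD[OF h_lipschitz[of UNIV], of y ?b] by (simp add: dist_real_def)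
    also have "\<dots> \<le> 2 * radius * \<Delta>" using that ab R_nonneg by (intro mult_left_mono) auto
    finally show ?thesis .
  qed
  ultimately have "norm (integral {?a..?b} h - (?b - ?a) *\<^sub>R h ?b) \<le> (2 * radius * \<Delta>) * measure lborel {?a..?b}"
    using R_nonneg \<Delta> by (intro has_integral_bound_real[where f = "\<lambda>y. h y - h ?b"]) auto
  then have 1: "\<bar>integral {?a..?b} h - \<Delta> * h ?b\<bar> \<le> 2 * radius * \<Delta> * \<Delta>"
    using ab by simp
  have "integral {0..?b} h - \<Delta> * (\<Sum>i<Suc n. h (real (Suc i) * \<Delta>))
      = (integral {0..?a} h - \<Delta> * (\<Sum>i<n. h (real (Suc i) * \<Delta>))) + (integral {?a..?b} h - \<Delta> * h ?b)"
    unfolding comb sum.lessThan_Suc distrib_left by simp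
  also have "\<bar>\<dots>\<bar> \<le> real n * (2 * radius * \<Delta> * \<Delta>) + 2 * radius * \<Delta> * \<Delta>"
    using Suc.IH 1 abs_triangle_ineq by (meson add_mono order_trans)
  finally show ?case by (simp add: algebra_simps)
qed simp

text \<open>
  Abel summation: the values of \<open>g\<close> telescope over a period up to the factor \<open>1 - cos (mesh n)\<close>, which is
  quadratically small.
\<close>

lemma proj_chord_sum_eq:
  assumes n: "n > 0"
  shows "proj_chord_sum n = sin (mesh n) * (\<Sum>i<n. h (real (Suc i) * mesh n))
    - (1 - cos (mesh n)) * (\<Sum>i<n. g (real (Suc i) * mesh n))"
proof -
  have nm: "real n * mesh n = 2 * pi" using n by (simp add: mesh_def)
  have "(\<Sum>i<n. g (real (Suc i) * mesh n) - g (real i * mesh n)) = g (real n * mesh n) - g (real 0 * mesh n)"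
    by (rule sum_lessThan_telescope)
  also have "\<dots> = 0" using nm g_periodic[of 0] by simp
  finally have tele: "(\<Sum>i<n. g (real i * mesh n)) = (\<Sum>i<n. g (real (Suc i) * mesh n))"
    by (simp add: sum_subtractf)
  have "proj_chord_sum n = (\<Sum>i<n. h (real (Suc i) * mesh n) * sin (mesh n)
      + g (real (Suc i) * mesh n) * cos (mesh n) - g (real i * mesh n))"
    unfolding proj_chord_sum_def proj_chord_eq by (intro sum.cong) (auto simp: algebra_simps)
  also have "\<dots> = sin (mesh n) * (\<Sum>i<n. h (real (Suc i) * mesh n))
      + cos (mesh n) * (\<Sum>i<n. g (real (Suc i) * mesh n)) - (\<Sum>i<n. g (real i * mesh n))"
    by (simp add: sum.distrib sum_subtractf sum_distrib_right mult.commute sum_distrib_left)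
  finally show ?thesis unfolding tele by (simp add: algebra_simps)
qed

lemma mesh_tendsto: "mesh \<longlonglongrightarrow> 0"
  unfolding mesh_def by real_asymp

lemma proj_chord_sum_tendsto: "proj_chord_sum \<longlonglongrightarrow> len"
proof -
  define A B where "A n = mesh n * (\<Sum>i<n. h (real (Suc i) * mesh n))"
    and "B n = (1 - cos (mesh n)) * (\<Sum>i<n. g (real (Suc i) * mesh n))" for n
  have m: "mesh n \<ge> 0" for n by (simp add: mesh_def)
  have "(\<lambda>n. A n - len) \<longlonglongrightarrow> 0"
  proof (rule Lim_null_comparison[where g = "\<lambda>n. 4 * pi * radius * mesh n"])
    have "norm (A n - len) \<le> 4 * pi * radius * mesh n" if "n > 0" for n
    proof -
      have nm: "real n * mesh n = 2 * pi" using that by (simp add: mesh_def)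
      have "\<bar>A n - len\<bar> \<le> real n * (2 * radius * mesh n * mesh n)"
        using riemann_sum_bound[OF m[of n], of n] by (simp add: nm A_def len_def abs_minus_commute)
      also have "\<dots> = (real n * mesh n) * (2 * radius * mesh n)" by simp
      finally show ?thesis unfolding nm by simp
    qed
    then show "eventually (\<lambda>n. norm (A n - len) \<le> 4 * pi * radius * mesh n) sequentially"
      by (auto intro: eventually_sequentiallyI[of 1])
    show "(\<lambda>n. 4 * pi * radius * mesh n) \<longlonglongrightarrow> 0" by (intro tendsto_mult_right_zero mesh_tendsto)
  qed
  then have A: "A \<longlonglongrightarrow> len" by (rule LIM_zero_cancel)
  have B: "B \<longlonglongrightarrow> 0"
  proof (rule Lim_null_comparison[where g = "\<lambda>n. radius * (real n * (1 - cos (2 * pi / real n)))"])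
    have "\<bar>B n\<bar> \<le> radius * (real n * (1 - cos (2 * pi / real n)))" for n
    proof -
      have "\<bar>\<Sum>i<n. g (real (Suc i) * mesh n)\<bar> \<le> (\<Sum>i<n. radius)"
        by (rule order_trans[OF sum_abs]) (intro sum_mono g_bound)
      then have "\<bar>B n\<bar> \<le> (1 - cos (mesh n)) * (real n * radius)"
        unfolding B_def abs_mult by (intro mult_mono) auto
      then show ?thesis by (simp add: mesh_def mult_ac)
    qed
    then show "eventually (\<lambda>n. norm (B n) \<le> radius * (real n * (1 - cos (2 * pi / real n)))) sequentially"
      by simp
    have "(\<lambda>n. real n * (1 - cos (2 * pi / real n))) \<longlonglongrightarrow> 0" by real_asymp
    then show "(\<lambda>n. radius * (real n * (1 - cos (2 * pi / real n)))) \<longlonglongrightarrow> 0"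
      by (rule tendsto_mult_right_zero)
  qed
  have "(\<lambda>n. sin (mesh n) / mesh n) \<longlonglongrightarrow> 1" unfolding mesh_def by real_asymp
  then have "(\<lambda>n. sin (mesh n) / mesh n * A n - B n) \<longlonglongrightarrow> 1 * len - 0"
    by (intro tendsto_intros A B)
  moreover have "eventually (\<lambda>n. sin (mesh n) / mesh n * A n - B n = proj_chord_sum n) sequentially"
    by (rule eventually_sequentiallyI[of 1]) (auto simp: proj_chord_sum_eq A_def B_def mesh_def)
  ultimately show ?thesis by (simp add: tendsto_cong)
qed

text \<open>
  The lower bound \<open>proj_chord_sum n\<close> and the upper bound \<open>proj_chord_sum n / cos (mesh n)\<close> have the same limit.
\<close>

lemma hausdorff1_frontier: "hausdorff1 (frontier K) = ennreal len" and len_nonneg: "len \<ge> 0"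
proof -
  have "proj_chord_sum n \<ge> 0" if "n \<ge> 5" for n
    unfolding proj_chord_sum_def using mesh_bounds[OF that] by (intro sum_nonneg proj_chord_nonneg) auto
  then show "len \<ge> 0" using proj_chord_sum_tendsto by (intro LIMSEQ_le_const) auto
  have "ennreal len \<le> hausdorff1 (frontier K)"
    using tendsto_ennrealI[OF proj_chord_sum_tendsto] hausdorff1_frontier_ge by (intro LIMSEQ_le_const2) blast+
  moreover have "hausdorff1 (frontier K) \<le> ennreal (len / cos 0)"
    using tendsto_ennrealI[OF tendsto_divide[OF proj_chord_sum_tendsto tendsto_cos[OF mesh_tendsto]]]
      hausdorff1_frontier_le by (intro LIMSEQ_le_const) auto
  ultimately show "hausdorff1 (frontier K) = ennreal len" by simp
qed

end

section \<open>Area through tangential coordinates\<close>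

lemma lborel_real2_eq_distr:
  "(lborel :: (real^2) measure) = distr (lborel :: (real \<times> real) measure) borel (\<lambda>z. vector [fst z, snd z])"
    (is "_ = distr _ _ ?v")
proof (rule lborel_eqI)
  have v_eq: "?v z = fst z *\<^sub>R axis 1 1 + snd z *\<^sub>R axis 2 1" for z
    by (simp add: vec_eq_iff forall_2 axis_def)
  have v: "?v \<in> borel_measurable borel"
    unfolding v_eq[abs_def] by (intro borel_measurable_continuous_onI continuous_intros)
  fix l u :: "real^2" assume lu: "\<And>b. b \<in> Basis \<Longrightarrow> l \<bullet> b \<le> u \<bullet> b"
  have le: "l$1 \<le> u$1" "l$2 \<le> u$2"
    using lu[of "axis 1 1"] lu[of "axis 2 1"] by (auto simp: inner_axis axis_in_Basis_iff)
  have "emeasure (distr (lborel :: (real \<times> real) measure) borel ?v) (box l u)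
      = emeasure (lborel :: (real \<times> real) measure) (?v -` box l u \<inter> space lborel)"
    by (rule emeasure_distr) (use v in auto)
  also have "?v -` box l u \<inter> space lborel = box (l$1, l$2) (u$1, u$2)"
    by (auto simp: mem_box_cart forall_2 mem_box Basis_prod_def)
  also have "emeasure lborel \<dots> = ennreal ((u$1 - l$1) * (u$2 - l$2))"
    using le by (subst emeasure_lborel_box) (auto simp: Basis_prod_def prod.union_disjoint)
  also have "(u$1 - l$1) * (u$2 - l$2) = (\<Prod>b\<in>Basis. (u - l) \<bullet> b)"
  proof -
    have B: "(Basis :: (real^2) set) = {axis 1 1, axis 2 1}"
      by (auto simp: Basis_vec_def UNIV_2)
    have ne: "axis 1 1 \<noteq> (axis 2 1 :: real^2)" by (simp add: axis_eq_axis)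
    show ?thesis unfolding B using ne by (simp add: inner_axis)
  qed
  finally show "emeasure (distr (lborel :: (real \<times> real) measure) borel ?v) (box l u) = ennreal (\<Prod>b\<in>Basis. (u - l) \<bullet> b)" .
qed simp

text \<open>
  The linear isometry from pairs to vectors transports the theorem of Tonelli.
\<close>

lemma nn_integral_real2:
  assumes F: "F \<in> borel_measurable (borel :: (real^2) measure)"
  shows "(\<integral>\<^sup>+v. F v \<partial>lborel) = (\<integral>\<^sup>+a. \<integral>\<^sup>+b. F (vector [a, b]) \<partial>lborel \<partial>lborel)"
proof -
  have v_eq: "vector [fst z, snd z] = (fst z *\<^sub>R axis 1 1 + snd z *\<^sub>R axis 2 1 :: real^2)" for z
    by (simp add: vec_eq_iff forall_2 axis_def)
  have v: "(\<lambda>z. vector [fst z, snd z] :: real^2) \<in> borel_measurable borel"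
    unfolding v_eq[abs_def] by (intro borel_measurable_continuous_onI continuous_intros)
  have "(\<integral>\<^sup>+v. F v \<partial>lborel) = (\<integral>\<^sup>+z. F (vector [fst z, snd z]) \<partial>(lborel :: (real \<times> real) measure))"
    by (subst lborel_real2_eq_distr, subst nn_integral_distr) (use v F in auto)
  also have "\<dots> = (\<integral>\<^sup>+z. F (vector [fst z, snd z]) \<partial>(lborel \<Otimes>\<^sub>M lborel))"
    unfolding lborel_prod ..
  also have "\<dots> = (\<integral>\<^sup>+a. \<integral>\<^sup>+b. F (vector [a, b]) \<partial>lborel \<partial>lborel)"
    using measurable_compose[OF v F] by (subst lborel.nn_integral_fst[symmetric]) (auto simp: lborel_prod)
  finally show ?thesis .
qed

lemma dir_has_derivative: "(dir has_derivative (\<lambda>d. d *\<^sub>R tang t)) (at t)"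
  and tang_has_derivative: "(tang has_derivative (\<lambda>d. - d *\<^sub>R dir t)) (at t)"
  unfolding dir_eq_axis[abs_def] tang_eq_axis[abs_def]
  by (auto intro!: derivative_eq_intros simp: algebra_simps)

context planar_body
begin

text \<open>
  Every \<open>y\<close> outside \<open>K\<close> lies on exactly one half-line that starts at a boundary point \<open>pt t\<close> in the direction
  \<open>tang t\<close>. In the coordinates \<open>(t, y \<bullet> tang t)\<close> the points of such half-lines inside the disc of radius
  \<open>outer_radius\<close> have second coordinate between \<open>g t\<close> and \<open>half_chord t\<close>, where \<open>half_chord t\<close> is half the chord
  that the tangent line cuts out of the disc.
\<close>

definition outer_radius :: real where "outer_radius = radius + 1"
definition half_chord :: "real \<Rightarrow> real" where "half_chord t = sqrt (outer_radius\<^sup>2 - (h t)\<^sup>2)"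
definition tangent_point :: "real^2 \<Rightarrow> real^2" where
  "tangent_point v = h (v$1) *\<^sub>R dir (v$1) + (v$2) *\<^sub>R tang (v$1)"
definition tangent_dom :: "(real^2) set" where
  "tangent_dom = {v. 0 < v$1 \<and> v$1 < 2 * pi \<and> v$1 \<notin> kinks \<and> g (v$1) < v$2 \<and> v$2 \<le> half_chord (v$1)}"

lemma outer_radius_pos: "outer_radius > 0" and radius_less_outer_radius: "radius < outer_radius" and h_less_outer_radius: "\<bar>h t\<bar> < outer_radius"
  using R_nonneg h_bound[of t] by (auto simp: outer_radius_def)

lemma half_chord_sq: "(half_chord t)\<^sup>2 = outer_radius\<^sup>2 - (h t)\<^sup>2" "half_chord t \<ge> 0"
proof -
  have "(h t)\<^sup>2 \<le> outer_radius\<^sup>2" using h_less_outer_radius[of t] by (simp add: abs_le_square_iff[symmetric])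
  then show "(half_chord t)\<^sup>2 = outer_radius\<^sup>2 - (h t)\<^sup>2" "half_chord t \<ge> 0" by (auto simp: half_chord_def)
qed

lemma g_less_half_chord: "\<bar>g t\<bar> < half_chord t"
proof -
  have "(norm (pt t))\<^sup>2 < outer_radius\<^sup>2"
    using norm_le_radius[OF pt_in_K[of t]] radius_less_outer_radius by (intro power_strict_mono) auto
  then have "\<bar>g t\<bar>\<^sup>2 < (half_chord t)\<^sup>2" by (simp add: norm_pt half_chord_sq(1))
  then show ?thesis using half_chord_sq(2) by (rule power2_less_imp_less)
qed

lemma tangent_point_frame:
  "tangent_point v \<bullet> dir (v$1) = h (v$1)" "tangent_point v \<bullet> tang (v$1) = v$2"
  by (simp_all add: tangent_point_def inner_add_left)

text \<open>
  If two tangent half-lines meet, \<open>supp\<close> at either of them shows that the angle between them has nonnegative sine.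
  So the angles are equal or opposite, and opposite parallel tangents do not meet because the body has positive
  width.
\<close>

lemma tangent_point_inj: "inj_on tangent_point tangent_dom"
proof (rule inj_onI)
  fix v w assume vw: "v \<in> tangent_dom" "w \<in> tangent_dom" "tangent_point v = tangent_point w"
  have key: "0 \<le> sin (w$1 - v$1)" if "v \<in> tangent_dom" "tangent_point v = tangent_point w" for v w
  proof (rule ccontr)
    assume "\<not> 0 \<le> sin (w$1 - v$1)"
    then have neg: "sin (w$1 - v$1) < 0" by simp
    have "h (w$1) = tangent_point v \<bullet> dir (w$1)" using that(2) by (simp add: tangent_point_frame)
    also have "\<dots> = h (v$1) * cos (w$1 - v$1) + v$2 * sin (w$1 - v$1)"
      using inner_dir_rotate[of "tangent_point v" "w$1" "v$1"] by (simp add: tangent_point_frame)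
    also have "v$2 * sin (w$1 - v$1) < g (v$1) * sin (w$1 - v$1)"
      using that(1) neg by (intro mult_strict_right_mono_neg) (auto simp: tangent_dom_def)
    finally show False using supp[of "v$1" "w$1"] by simp
  qed
  have "0 \<le> sin (w$1 - v$1)" "0 \<le> sin (v$1 - w$1)"
    using key[OF vw(1,3)] key[OF vw(2) vw(3)[symmetric]] by simp_all
  moreover have "sin (v$1 - w$1) = - sin (w$1 - v$1)" using sin_minus[of "w$1 - v$1"] by simp
  ultimately have s0: "sin (w$1 - v$1) = 0" by linarith
  have rot: "dir (w$1) = cos (w$1 - v$1) *\<^sub>R dir (v$1)"
    using dir_add[of "v$1" "w$1 - v$1"] s0 by simp
  have "(cos (w$1 - v$1))\<^sup>2 = 1" using sin_cos_squared_add[of "w$1 - v$1"] s0 by simp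
  moreover have "cos (w$1 - v$1) \<noteq> -1"
  proof
    assume "cos (w$1 - v$1) = -1"
    then have op: "dir (w$1) = - dir (v$1)" using rot by simp
    then have "h (v$1 + pi) = h (w$1)" using dir_add[of "v$1" pi] by (simp add: h_def)
    also have "\<dots> = - h (v$1)"
      using tangent_point_frame(1)[of w] tangent_point_frame(1)[of v] vw(3) op by simp
    finally show False using width_pos[of "v$1"] by simp
  qed
  ultimately have "dir (w$1) = dir (v$1)" using rot by (simp add: power2_eq_1_iff)
  then have eq1: "v$1 = w$1"
    using vw(1,2) by (intro inj_onD[OF dir_inj_on]) (auto simp: tangent_dom_def)
  have "v$2 = w$2" using tangent_point_frame(2)[of v] tangent_point_frame(2)[of w] vw(3) eq1 by simp
  then show "v = w" using eq1 by (simp add: vec_eq_iff forall_2)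
qed

lemma tangent_point_image_subset: "tangent_point ` tangent_dom \<subseteq> cball 0 outer_radius - K"
proof (rule image_subsetI)
  fix v assume v: "v \<in> tangent_dom"
  have "- half_chord (v$1) < g (v$1)" using g_less_half_chord[of "v$1"] by auto
  moreover have "g (v$1) < v$2" "v$2 \<le> half_chord (v$1)" using v by (simp_all add: tangent_dom_def)
  ultimately have "\<bar>v$2\<bar> \<le> \<bar>half_chord (v$1)\<bar>" by linarith
  then have "(v$2)\<^sup>2 \<le> (half_chord (v$1))\<^sup>2" by (rule abs_le_square_iff[THEN iffD1])
  then have "(v$2)\<^sup>2 \<le> outer_radius\<^sup>2 - (h (v$1))\<^sup>2" unfolding half_chord_sq(1) .
  then have "(norm (tangent_point v))\<^sup>2 \<le> outer_radius\<^sup>2"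
    unfolding frame_norm[of "tangent_point v" "v$1"] tangent_point_frame by linarith
  then have "norm (tangent_point v) \<le> outer_radius" by (rule power2_le_imp_le) (use outer_radius_pos in simp)
  moreover have "tangent_point v \<notin> K"
  proof
    assume "tangent_point v \<in> K"
    then have "tangent_point v \<in> face (v$1)" by (simp add: face_def tangent_point_frame)
    then show False using pt_extreme[of "tangent_point v" "v$1"] v by (simp add: tangent_point_frame tangent_dom_def)
  qed
  ultimately show "tangent_point v \<in> cball 0 outer_radius - K" by simp
qed

text \<open>
  The tangent lines omitted from \<open>tangent_dom\<close>: those along flat sides, and the one at the cut of the angle
  interval.
\<close>

definition kink_lines :: "(real^2) set" where
  "kink_lines = \<Union>((\<lambda>t. {y. dir t \<bullet> y = h t}) ` (insert 0 kinks))"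

lemma negligible_kink_lines: "negligible kink_lines"
  unfolding kink_lines_def
proof (rule negligible_countable_Union)
  show "countable ((\<lambda>t. {y. dir t \<bullet> y = h t}) ` insert 0 kinks)"
    using countable_kinks by auto
  show "negligible S" if "S \<in> (\<lambda>t. {y. dir t \<bullet> y = h t}) ` insert 0 kinks" for S
  proof -
    have "dir t \<noteq> 0" for t using norm_dir(1)[of t] by (metis norm_zero zero_neq_one)
    then show ?thesis using that by (auto intro!: negligible_hyperplane)
  qed
qed

text \<open>
  For \<open>y\<close> outside \<open>K\<close>, the gap \<open>k t = y \<bullet> dir t - h t\<close> is positive at some angle \<open>t1\<close> and negative at \<open>t1 - pi\<close>. At
  the last zero before \<open>t1\<close> the point \<open>y\<close> lies on the tangent line, and since \<open>k\<close> becomes positive there, \<open>y\<close>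
  lies beyond the point of contact.
\<close>

lemma exterior_subset_image: "cball 0 outer_radius - K - tangent_point ` tangent_dom \<subseteq> kink_lines"
proof (rule subsetI, rule ccontr)
  fix y assume y: "y \<in> cball 0 outer_radius - K - tangent_point ` tangent_dom" "y \<notin> kink_lines"
  define k where "k t = y \<bullet> dir t - h t" for t
  have kc: "continuous_on A k" for A unfolding k_def by (intro continuous_intros h_continuous)
  obtain t1 where t1: "k t1 > 0"
    using y mem_iff_inner_le[of y] unfolding k_def by (auto simp: not_le)
  have kper: "k (t + 2 * pi) = k t" for t by (simp add: k_def h_periodic)
  have dpi: "dir (t1 - pi + pi) = - dir (t1 - pi)" using dir_add[of "t1 - pi" pi] by simp
  have "k (t1 - pi) < 0"
    using width_pos[of "t1 - pi"] t1 dpi by (simp add: k_def)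
  define Z where "Z = {t \<in> {t1 - pi..t1}. k t \<le> 0}"
  have Z: "Z \<noteq> {}" "bdd_above Z"
    using \<open>k (t1 - pi) < 0\<close> by (auto simp: Z_def intro!: exI[of _ "t1 - pi"] bdd_aboveI[of _ t1])
  have "closed Z"
  proof -
    have "Z = {t1 - pi..t1} \<inter> {t. k t \<le> 0}" by (auto simp: Z_def)
    moreover have "closed {t. k t \<le> 0}" by (intro closed_Collect_le kc continuous_intros)
    ultimately show ?thesis by (simp add: closed_Int)
  qed
  define \<theta> where "\<theta> = Sup Z"
  have \<theta>Z: "\<theta> \<in> Z" unfolding \<theta>_def using Z \<open>closed Z\<close> by (rule closed_contains_Sup)
  then have \<theta>: "t1 - pi \<le> \<theta>" "\<theta> \<le> t1" "k \<theta> \<le> 0" by (auto simp: Z_def)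
  have above: "k t > 0" if "\<theta> < t" "t \<le> t1" for t
  proof (rule ccontr)
    assume "\<not> k t > 0"
    then have "t \<in> Z" using that \<theta> by (auto simp: Z_def)
    then have "t \<le> \<theta>" unfolding \<theta>_def using Z by (intro cSup_upper)
    then show False using that by simp
  qed
  have "\<theta> < t1" using \<theta> t1 by (cases "\<theta> = t1") auto
  have k0: "k \<theta> = 0"
  proof (rule ccontr)
    assume "k \<theta> \<noteq> 0"
    then have "k \<theta> < 0" using \<theta> by simp
    then obtain s where "\<theta> \<le> s" "s \<le> t1" "k s = 0"
      using IVT'[of k \<theta> 0 t1] kc t1 \<theta> by auto
    then show False using above[of s] \<open>k \<theta> \<noteq> 0\<close> by (cases "s = \<theta>") auto
  qed
  have yd: "y \<bullet> dir \<theta> = h \<theta>" using k0 by (simp add: k_def)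
  have gu: "g \<theta> < y \<bullet> tang \<theta>"
  proof -
    define d where "d = min (t1 - \<theta>) 1"
    have d: "d > 0" "\<theta> + d \<le> t1" "d \<le> 1" using \<open>\<theta> < t1\<close> by (auto simp: d_def)
    then have sin: "sin d > 0" using pi_gt3 by (intro sin_gt_zero) auto
    have "h \<theta> * cos d + g \<theta> * sin d \<le> h (\<theta> + d)" using supp[of \<theta> "\<theta> + d"] by simp
    also have "\<dots> < y \<bullet> dir (\<theta> + d)" using above[of "\<theta> + d"] d by (simp add: k_def)
    also have "\<dots> = h \<theta> * cos d + (y \<bullet> tang \<theta>) * sin d"
      using inner_dir_rotate[of y "\<theta> + d" \<theta>] yd by simp
    finally show ?thesis using sin by simp
  qed
  obtain s where s: "0 \<le> s" "s < 2 * pi" "dir \<theta> = dir s" using unit_eq_dir norm_dir by metis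
  have "tang \<theta> = tang s"
    using s(3) by (simp add: vec_eq_iff forall_2)
  have hs: "h \<theta> = h s" using s(3) by (simp add: h_def)
  have gs: "g \<theta> = g s"
    using s(3) \<open>tang \<theta> = tang s\<close> hs by (simp add: g_def pt_def face_def)
  define v :: "real^2" where "v = vector [s, y \<bullet> tang s]"
  have v: "v$1 = s" "v$2 = y \<bullet> tang s" by (simp_all add: v_def)
  have "s \<noteq> 0 \<and> s \<notin> kinks"
    using y(2) yd s(3) hs by (auto simp: kink_lines_def inner_commute)
  moreover have "y \<bullet> tang s \<le> half_chord s"
  proof -
    have "(norm y)\<^sup>2 \<le> outer_radius\<^sup>2" using y(1) by (intro power_mono) auto
    then have "(y \<bullet> tang s)\<^sup>2 \<le> (half_chord s)\<^sup>2"
      using frame_norm[of y s] yd s(3) hs by (simp add: half_chord_sq(1))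
    then show ?thesis using half_chord_sq(2)[of s] by (rule power2_le_imp_le)
  qed
  ultimately have "v \<in> tangent_dom"
    using s gu gs \<open>tang \<theta> = tang s\<close> by (auto simp: tangent_dom_def v)
  moreover have "tangent_point v = y"
    using frame_decomp[of y s] yd s(3) hs by (simp add: tangent_point_def v)
  ultimately show False using y(1) by blast
qed

definition tangent_deriv :: "real^2 \<Rightarrow> real^2 \<Rightarrow> real^2" where
  "tangent_deriv v w = (w$1 * (g (v$1) - v$2)) *\<^sub>R dir (v$1) + (w$1 * h (v$1) + w$2) *\<^sub>R tang (v$1)"

lemma tangent_point_deriv:
  assumes "v \<in> tangent_dom"
  shows "(tangent_point has_derivative tangent_deriv v) (at v within tangent_dom)"
proof -
  have n1: "((\<lambda>v::real^2. v$1) has_derivative (\<lambda>w. w$1)) (at v within tangent_dom)"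
    and n2: "((\<lambda>v::real^2. v$2) has_derivative (\<lambda>w. w$2)) (at v within tangent_dom)"
    by (auto intro!: bounded_linear_imp_has_derivative bounded_linear_vec_nth)
  have "((\<lambda>v. h (v$1)) has_derivative (\<lambda>w. w$1 * g (v$1))) (at v within tangent_dom)"
    by (rule DERIV_compose_FDERIV[OF h_deriv n1]) (use assms in \<open>auto simp: tangent_dom_def\<close>)
  moreover have "((\<lambda>v. dir (v$1)) has_derivative (\<lambda>w. (w$1) *\<^sub>R tang (v$1))) (at v within tangent_dom)"
    by (rule has_derivative_compose[OF n1 dir_has_derivative])
  moreover have "((\<lambda>v. tang (v$1)) has_derivative (\<lambda>w. - (w$1) *\<^sub>R dir (v$1))) (at v within tangent_dom)"
    by (rule has_derivative_compose[OF n1 tang_has_derivative])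
  ultimately have "((\<lambda>v. h (v$1) *\<^sub>R dir (v$1) + (v$2) *\<^sub>R tang (v$1)) has_derivative
      (\<lambda>w. (h (v$1) *\<^sub>R ((w$1) *\<^sub>R tang (v$1)) + (w$1 * g (v$1)) *\<^sub>R dir (v$1))
        + ((v$2) *\<^sub>R (- (w$1) *\<^sub>R dir (v$1)) + (w$2) *\<^sub>R tang (v$1)))) (at v within tangent_dom)"
    by (intro has_derivative_add has_derivative_scaleR n2)
  moreover have "(\<lambda>w. (h (v$1) *\<^sub>R ((w$1) *\<^sub>R tang (v$1)) + (w$1 * g (v$1)) *\<^sub>R dir (v$1))
        + ((v$2) *\<^sub>R (- (w$1) *\<^sub>R dir (v$1)) + (w$2) *\<^sub>R tang (v$1))) = tangent_deriv v"
    by (rule ext) (simp add: tangent_deriv_def algebra_simps)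
  ultimately show ?thesis by (simp add: tangent_point_def[abs_def])
qed

lemma det_tangent_deriv: "det (matrix (tangent_deriv v)) = g (v$1) - v$2"
proof -
  have cs: "cos (v$1) * cos (v$1) + sin (v$1) * sin (v$1) = 1" by (rule sin_cos_squared_add3)
  show ?thesis
    unfolding det_2 matrix_def tangent_deriv_def
    by (simp add: axis_def) (use cs in algebra)
qed

lemma tangent_dom_borel: "tangent_dom \<in> sets borel"
proof -
  have nth: "(\<lambda>v::real^2. v $ i) \<in> borel_measurable borel" for i
    by (intro borel_measurable_continuous_onI continuous_intros)
  have k: "kinks \<in> sets borel" using countable_imp_null_set_lborel[OF countable_kinks] by auto
  have half_chord: "half_chord \<in> borel_measurable borel"
    unfolding half_chord_def[abs_def] using h_borel by measurable
  have [measurable]: "(\<lambda>v::real^2. g (v$1)) \<in> borel_measurable borel" "(\<lambda>v::real^2. half_chord (v$1)) \<in> borel_measurable borel"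
    using measurable_compose[OF nth g_borel] measurable_compose[OF nth half_chord] by auto
  have [measurable]: "(\<lambda>v::real^2. v $ 1) \<in> borel_measurable borel" "(\<lambda>v::real^2. v $ 2) \<in> borel_measurable borel"
    using nth by auto
  have "{v :: real^2. v$1 \<in> kinks} \<in> sets borel"
    using measurable_sets[OF nth k, of 1] by (simp add: vimage_def)
  moreover have "{v :: real^2. 0 < v$1 \<and> v$1 < 2 * pi \<and> g (v$1) < v$2 \<and> v$2 \<le> half_chord (v$1)} \<in> sets borel"
    by measurable
  moreover have "tangent_dom = {v. 0 < v$1 \<and> v$1 < 2 * pi \<and> g (v$1) < v$2 \<and> v$2 \<le> half_chord (v$1)} - {v. v$1 \<in> kinks}"
    by (auto simp: tangent_dom_def)
  ultimately show ?thesis by (simp add: sets.Diff)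
qed

lemma half_chord_continuous: "continuous_on A half_chord"
  unfolding half_chord_def[abs_def] by (intro continuous_intros h_continuous)

lemma half_chord_borel: "half_chord \<in> borel_measurable borel"
  by (intro borel_measurable_continuous_onI half_chord_continuous)

text \<open>
  \<open>half_chord\<close> is a function of \<open>h\<close> alone, so the integrand is the derivative of a periodic function. This removes
  the mixed term when the sectors are added up.
\<close>

lemma integral_half_chord_g: "((\<lambda>t. half_chord t * g t) has_integral 0) {0..2*pi}"
proof -
  define q where "q y = sqrt (outer_radius\<^sup>2 - y\<^sup>2)" for y
  have qc: "continuous_on A q" for A unfolding q_def by (intro continuous_intros)
  define P where "P y = integral {-outer_radius..y} q" for y
  have P: "(P has_real_derivative q y) (at y)" if "\<bar>y\<bar> < outer_radius" for y
  proof -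
    have "(P has_real_derivative q y) (at y within {-outer_radius..outer_radius})"
      unfolding P_def by (rule integral_has_real_derivative[OF qc]) (use that in auto)
    then show ?thesis using that by (subst (asm) at_within_interior) (auto simp: interior_atLeastAtMost_real)
  qed
  have "lipschitz_fun_on {-radius..radius} P"
    by (rule lipschitz_fun_on_C1[OF P qc]) (use radius_less_outer_radius in auto)
  then obtain L where L: "L-lipschitz_on {-radius..radius} P" by (auto simp: lipschitz_fun_on_def)
  have "h ` {0..2*pi} \<subseteq> {-radius..radius}" using h_bound by (auto simp: abs_le_iff minus_le_iff)
  then have "L-lipschitz_on (h ` {0..2*pi}) P" by (rule lipschitz_on_subset[OF L])
  then have "(L * (2 * radius))-lipschitz_on {0..2*pi} (\<lambda>t. P (h t))"
    by (rule lipschitz_on_compose2[OF h_lipschitz])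
  from fundamental_theorem_of_calculus_lipschitz[OF _ this negligible_kinks, of "\<lambda>t. q (h t) * g t"]
  have "((\<lambda>t. q (h t) * g t) has_integral P (h (2 * pi)) - P (h 0)) {0..2*pi}"
    by (auto intro!: DERIV_chain2[OF P h_deriv] h_less_outer_radius)
  then show ?thesis using h_periodic[of 0] by (simp add: q_def half_chord_def)
qed

lemma has_integral_sector: 
  "((\<lambda>t. (half_chord t - g t)\<^sup>2 / 2) has_integral pi * outer_radius\<^sup>2 - (int_h2 - int_g2) / 2) {0..2*pi}"
proof -
  have "((\<lambda>t. (outer_radius\<^sup>2 - (h t)\<^sup>2 + (g t)\<^sup>2) / 2 - half_chord t * g t) has_integral
      ((2 * pi - 0) *\<^sub>R outer_radius\<^sup>2 - int_h2 + int_g2) / 2 - 0) {0..2*pi}"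
    by (intro has_integral_diff has_integral_divide has_integral_add integral_half_chord_g has_integral_h2
        has_integral_g2 has_integral_const_real[THEN has_integral_eq_rhs]) auto
  moreover have "(outer_radius\<^sup>2 - (h t)\<^sup>2 + (g t)\<^sup>2) / 2 - half_chord t * g t = (half_chord t - g t)\<^sup>2 / 2" for t
    unfolding half_chord_sq(1)[symmetric] by (simp add: power2_diff field_simps)
  ultimately have "((\<lambda>t. (half_chord t - g t)\<^sup>2 / 2) has_integral
      ((2 * pi - 0) *\<^sub>R outer_radius\<^sup>2 - int_h2 + int_g2) / 2 - 0) {0..2*pi}" by (simp only:)
  then show ?thesis by (rule has_integral_eq_rhs) (simp add: field_simps)
qed

text \<open>
  On each tangent line the distance to the point of contact integrates to half the square of its maximum.
\<close>

lemma has_integral_jacobian: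
  "((\<lambda>v. \<bar>det (matrix (tangent_deriv v))\<bar>) has_integral pi * outer_radius\<^sup>2 - (int_h2 - int_g2) / 2) tangent_dom"
    (is "(_ has_integral ?r) _")
proof -
  define F where "F v = indicator tangent_dom v * (v$2 - g (v$1))" for v :: "real^2"
  have nth: "(\<lambda>v::real^2. v $ i) \<in> borel_measurable borel" for i
    by (intro borel_measurable_continuous_onI continuous_intros)
  have F: "F \<in> borel_measurable borel"
    unfolding F_def[abs_def]
    by (intro borel_measurable_times borel_measurable_diff borel_measurable_indicator tangent_dom_borel nth
        measurable_compose[OF nth g_borel])
  have F0: "0 \<le> F v" for v by (auto simp: F_def indicator_def tangent_dom_def)
  have r0: "0 \<le> ?r" using has_integral_nonneg[OF has_integral_sector] by simp
  have inner: "(\<integral>\<^sup>+b. ennreal (F (vector [a, b])) \<partial>lborel)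
      = ennreal (if a \<in> {0<..<2*pi} - kinks then (half_chord a - g a)\<^sup>2 / 2 else 0)" for a
  proof (cases "a \<in> {0<..<2*pi} - kinks")
    case True
    have gc: "g a \<le> half_chord a" using g_less_half_chord[of a] by auto
    have "(\<integral>\<^sup>+b. ennreal (F (vector [a, b])) \<partial>lborel) = (\<integral>\<^sup>+b. ennreal (b - g a) * indicator {g a..half_chord a} b \<partial>lborel)"
      by (rule nn_integral_cong) (use True in \<open>auto simp: F_def tangent_dom_def indicator_def\<close>)
    also have "\<dots> = ennreal ((half_chord a - g a)\<^sup>2 / 2 - (g a - g a)\<^sup>2 / 2)"
      by (rule nn_integral_FTC_Icc) (use gc in \<open>auto intro!: derivative_eq_intros\<close>)
    finally show ?thesis using True by simp
  next
    case False
    have "F (vector [a, b]) = 0" for b using False by (auto simp: F_def tangent_dom_def indicator_def)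
    then show ?thesis unfolding if_not_P[OF False] by simp
  qed
  have "(\<integral>\<^sup>+v. ennreal (F v) \<partial>lborel) = (\<integral>\<^sup>+a. ennreal (if a \<in> {0<..<2*pi} - kinks then (half_chord a - g a)\<^sup>2 / 2 else 0) \<partial>lborel)"
    using F by (subst nn_integral_real2) (auto simp: inner)
  also have "\<dots> = ennreal ?r"
  proof (rule nn_integral_has_integral_lborel)
    have "{0<..<2*pi} - kinks \<in> sets borel"
      using countable_imp_null_set_lborel[OF countable_kinks] by auto
    then show "(\<lambda>a. if a \<in> {0<..<2*pi} - kinks then (half_chord a - g a)\<^sup>2 / 2 else 0) \<in> borel_measurable borel"
      using half_chord_borel g_borel by (intro measurable_If_set borel_measurable_divide borel_measurable_power borel_measurable_diff) auto
    have "((\<lambda>a. if a \<in> {0..2*pi} then (half_chord a - g a)\<^sup>2 / 2 else 0) has_integral ?r) UNIV"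
      using has_integral_sector by (simp only: has_integral_restrict_UNIV)
    then show "((\<lambda>a. if a \<in> {0<..<2*pi} - kinks then (half_chord a - g a)\<^sup>2 / 2 else 0) has_integral ?r) UNIV"
      by (rule has_integral_spike[rotated 2, of _ _ _ "kinks \<union> {0, 2*pi}"])
        (auto simp: negligible_kinks)
  qed auto
  finally have nn: "(\<integral>\<^sup>+v. ennreal (F v) \<partial>lborel) = ennreal ?r" .
  have int: "integrable lborel F"
    by (rule integrableI_nn_integral_finite[OF _ _ nn]) (use F F0 in auto)
  moreover have "integral\<^sup>L lborel F = ?r"
    using F F0 r0 nn by (subst integral_eq_nn_integral) auto
  ultimately have "(F has_integral ?r) UNIV"
    using has_integral_integral_lborel by metis
  moreover have "F = (\<lambda>v. if v \<in> tangent_dom then \<bar>det (matrix (tangent_deriv v))\<bar> else 0)"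
    by (rule ext) (auto simp: F_def det_tangent_deriv tangent_dom_def)
  ultimately have "((\<lambda>v. if v \<in> tangent_dom then \<bar>det (matrix (tangent_deriv v))\<bar> else 0) has_integral ?r) UNIV"
    by (simp only:)
  then show ?thesis by (simp only: has_integral_restrict_UNIV)
qed

text \<open>
  The disc without \<open>K\<close> is, up to the null set \<open>kink_lines\<close>, the injective image of \<open>tangent_dom\<close>.
\<close>

lemma area_eq: "measure lebesgue K = (int_h2 - int_g2) / 2"
proof -
  have "measure lebesgue (tangent_point ` tangent_dom)
      = integral tangent_dom (\<lambda>v. \<bar>det (matrix (tangent_deriv v))\<bar>)"
    by (rule measure_differentiable_image_eq[OF _ tangent_point_deriv tangent_point_inj])
      (use tangent_dom_borel has_integral_jacobian in \<open>auto simp: integrable_on_def\<close>)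
  also have "\<dots> = pi * outer_radius\<^sup>2 - (int_h2 - int_g2) / 2"
    using has_integral_jacobian by (rule integral_unique)
  finally have 1: "measure lebesgue (tangent_point ` tangent_dom) = pi * outer_radius\<^sup>2 - (int_h2 - int_g2) / 2" .
  have m: "(cball 0 outer_radius :: (real^2) set) \<in> lmeasurable" "K \<in> lmeasurable" using compact_K by (auto intro: lmeasurable_compact)
  have sub: "K \<subseteq> cball 0 outer_radius" using norm_le_radius radius_less_outer_radius by force
  have "negligible ((cball 0 outer_radius - K) - tangent_point ` tangent_dom \<union> (tangent_point ` tangent_dom - (cball 0 outer_radius - K)))"
    by (rule negligible_subset[OF negligible_kink_lines])
      (use exterior_subset_image tangent_point_image_subset in auto)
  then have 2: "measure lebesgue (tangent_point ` tangent_dom) = measure lebesgue (cball 0 outer_radius - K)"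
    using m by (intro measure_negligible_symdiff) (auto intro: fmeasurable_Diff)
  have 3: "measure lebesgue (cball 0 outer_radius - K) = measure lebesgue (cball 0 outer_radius :: (real^2) set) - measure lebesgue K"
    using m sub by (simp add: measurable_measure_Diff fmeasurableD)
  have "measure lebesgue (cball (0 :: real^2) outer_radius) = measure lborel (cball (0 :: real^2) outer_radius)"
    by (intro measure_completion) auto
  also have "\<dots> = pi * outer_radius\<^sup>2"
    using outer_radius_pos by (subst content_cball) (auto simp: unit_ball_vol_2)
  finally show ?thesis using 1 2 3 by simp
qed

end

section \<open>Sharp inequalities and their thresholds\<close>

context planar_body
begin

lemma moment_nonneg: "0 \<le> moment x"
proof -
  interpret T: support_pair "\<lambda>t. h t - x \<bullet> dir t" "\<lambda>t. g t - x \<bullet> tang t" "radius + norm x"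
    by (rule translate)
  have "moment x = T.int_h2 + T.int_g2" using T.moment_0 by (simp add: moment_def T.moment_def)
  moreover have "0 \<le> T.int_h2" using T.variance_nonneg[of 0] T.variance_eq[of 0] by simp
  ultimately show ?thesis using T.int_g2_nonneg by simp
qed

lemma INF_moment_le: "(INF x. moment x) \<le> moment x"
  by (rule cINF_lower) (auto intro!: bdd_belowI2[of _ 0] moment_nonneg)

text \<open>
  A convex body is determined by its support function; positivity of \<open>r\<close> comes from the positive width.
\<close>

lemma eq_cball_of_support:
  assumes "\<And>t. h t = c \<bullet> dir t + r"
  shows "0 < r" "K = cball c r"
proof -
  have "dir (0 + pi) = - dir 0" using dir_add[of 0 pi] by simp
  then show r: "0 < r" using width_pos[of 0] assms by simp
  show "K = cball c r"
  proof (intro set_eqI iffI)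
    fix y assume "y \<in> K"
    show "y \<in> cball c r"
    proof (cases "y = c")
      case False
      then have "norm ((1 / norm (y - c)) *\<^sub>R (y - c)) = 1" by simp
      then obtain t where t: "(1 / norm (y - c)) *\<^sub>R (y - c) = dir t" using unit_eq_dir by metis
      have "(y - c) \<bullet> dir t \<le> r" using inner_le_h[OF \<open>y \<in> K\<close>, of t] assms by (simp add: inner_diff_left)
      also have "(y - c) \<bullet> dir t = norm (y - c)"
        unfolding t[symmetric] using False by (simp add: power2_norm_eq_inner[symmetric] power2_eq_square)
      finally show ?thesis by (simp add: dist_norm norm_minus_commute)
    qed (use r in simp)
  next
    fix y assume y: "y \<in> cball c r"
    show "y \<in> K" unfolding mem_iff_inner_le
    proof
      fix t
      have "(y - c) \<bullet> dir t \<le> norm (y - c)" using Cauchy_Schwarz_ineq2[of "y - c" "dir t"] by simp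
      then show "y \<bullet> dir t \<le> h t" using y assms by (simp add: inner_diff_left dist_norm norm_minus_commute)
    qed
  qed
qed

lemma support_of_cball:
  assumes K: "K = cball c r" and r: "0 < r"
  shows "h t = c \<bullet> dir t + r"
proof (rule antisym)
  have "c + r *\<^sub>R dir t \<in> K" using r by (simp add: K dist_norm)
  from inner_le_h[OF this, of t] show "c \<bullet> dir t + r \<le> h t" by (simp add: inner_add_left)
  have "(pt t - c) \<bullet> dir t \<le> norm (pt t - c)" using Cauchy_Schwarz_ineq2[of "pt t - c" "dir t"] by simp
  also have "\<dots> \<le> r" using pt_in_K[of t] by (simp add: K dist_norm norm_minus_commute)
  finally show "h t \<le> c \<bullet> dir t + r" by (simp add: inner_diff_left pt_dir)
qed

end

lemma planar_body_closure: "bounded_convex_body E \<Longrightarrow> planar_body (closure E)"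
  unfolding bounded_convex_body_def
  by unfold_locales (auto simp: compact_closure convex_interior_closure intro: convex_closure)

lemma frontier_closure_eq: "bounded_convex_body E \<Longrightarrow> frontier (closure E) = frontier E"
  by (simp add: bounded_convex_body_def frontier_def convex_interior_closure)

lemma outer_unit_normals_closure: "outer_unit_normals (closure E) x = outer_unit_normals E x"
proof -
  have "(\<forall>y\<in>closure E. v \<bullet> (y - x) \<le> 0) \<longleftrightarrow> (\<forall>y\<in>E. v \<bullet> (y - x) \<le> 0)" for v
  proof
    assume *: "\<forall>y\<in>E. v \<bullet> (y - x) \<le> 0"
    have "closed {y. v \<bullet> (y - x) \<le> 0}" by (intro closed_Collect_le continuous_intros)
    then have "closure E \<subseteq> {y. v \<bullet> (y - x) \<le> 0}" by (rule closure_minimal[rotated]) (use * in auto)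
    then show "\<forall>y\<in>closure E. v \<bullet> (y - x) \<le> 0" by auto
  qed (use closure_subset in auto)
  then show ?thesis by (simp add: outer_unit_normals_def)
qed

lemma curvature_measure_closure:
  "bounded_convex_body E \<Longrightarrow> curvature_measure (closure E) = curvature_measure E"
  by (simp add: curvature_measure_def frontier_closure_eq outer_unit_normals_closure)

lemma measure_closure_eq:
  assumes "bounded_convex_body E" shows "measure lebesgue (closure E) = measure lebesgue E"
proof -
  have E: "bounded E" "convex E" using assms by (auto simp: bounded_convex_body_def)
  have "negligible (frontier E)" using E(2) by (rule negligible_convex_frontier)
  then show ?thesis using E(1) by (intro measure_closure)
qed

lemma is_ball_iff_closure:
  assumes E: "bounded_convex_body E" and r: "0 < r"
  shows "is_ball E c r \<longleftrightarrow> closure E = cball c r"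
proof
  assume "is_ball E c r"
  then have "ball c r \<subseteq> E" "E \<subseteq> cball c r" by (auto simp: is_ball_def)
  then have "closure (ball c r) \<subseteq> closure E" "closure E \<subseteq> cball c r"
    by (simp_all add: closure_mono closure_minimal)
  then show "closure E = cball c r" using r by (simp add: closure_ball)
next
  assume *: "closure E = cball c r"
  have "interior E = ball c r"
    using E convex_interior_closure[of E] * by (simp add: bounded_convex_body_def)
  then show "is_ball E c r"
    unfolding is_ball_def using * interior_subset[of E] closure_subset[of E] by simp
qed

text \<open>
  Frontier, outer normals and area of a convex body agree with those of its closure, so the formulas for compact
  bodies apply to every body.
\<close>

lemma functionals_eq:
  assumes E: "bounded_convex_body E"
  defines "K \<equiv> closure E"
  shows "lhs_L \<beta> E = support_pair.moment (planar_body.h K) (planar_body.g K) 0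
      + \<beta> * (support_pair.int_h2 (planar_body.h K) - support_pair.int_g2 (planar_body.g K))"
    and "lhs_U \<beta> E = (INF x. support_pair.moment (planar_body.h K) (planar_body.g K) x)
      + \<beta> * (support_pair.int_h2 (planar_body.h K) - support_pair.int_g2 (planar_body.g K))"
    and "rhs_LU \<beta> E = (1 + \<beta>) * ((support_pair.len (planar_body.h K))\<^sup>2 / (2 * pi))"
proof -
  interpret planar_body K unfolding K_def by (rule planar_body_closure[OF E])
  have c: "curvature_measure E = curvature_measure K" "frontier E = frontier K"
    "measure lebesgue E = measure lebesgue K"
    unfolding K_def curvature_measure_closure[OF E] frontier_closure_eq[OF E] measure_closure_eq[OF E] by simp_all
  show "lhs_L \<beta> E = moment 0 + \<beta> * (int_h2 - int_g2)"
    using curvature_integral(1)[of 0] by (simp add: lhs_L_def c area_eq)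
  show "lhs_U \<beta> E = (INF x. moment x) + \<beta> * (int_h2 - int_g2)"
    by (simp add: lhs_U_def c area_eq curvature_integral(2))
  show "rhs_LU \<beta> E = (1 + \<beta>) * (len\<^sup>2 / (2 * pi))"
    by (simp add: rhs_LU_def perimeter_def c hausdorff1_frontier len_nonneg)
qed

lemma lower_bound:
  assumes E: "bounded_convex_body E" and \<beta>: "0 < \<beta>" "\<beta> \<le> 1"
  shows "rhs_LU \<beta> E \<le> lhs_L \<beta> E"
proof -
  interpret planar_body "closure E" by (rule planar_body_closure[OF E])
  show ?thesis unfolding functionals_eq[OF E] using moment_lower_bound[OF \<beta>] .
qed

lemma lower_bound_eq_iff:
  assumes E: "bounded_convex_body E" and \<beta>: "0 < \<beta>" "\<beta> < 1"
  shows "lhs_L \<beta> E = rhs_LU \<beta> E \<longleftrightarrow> (\<exists>r>0. is_ball E 0 r)"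
proof -
  interpret planar_body "closure E" by (rule planar_body_closure[OF E])
  show ?thesis
  proof
    assume "lhs_L \<beta> E = rhs_LU \<beta> E"
    then have "h t = 0 \<bullet> dir t + len / (2 * pi)" for t
      using moment_lower_bound_eq[of \<beta> t] \<beta> unfolding functionals_eq[OF E] by simp
    from eq_cball_of_support[OF this] show "\<exists>r>0. is_ball E 0 r"
      using is_ball_iff_closure[OF E] by blast
  next
    assume "\<exists>r>0. is_ball E 0 r"
    then obtain r where r: "r > 0" "closure E = cball 0 r" using is_ball_iff_closure[OF E] by blast
    have "h t = 0 \<bullet> dir t + r" for t using support_of_cball[OF r(2,1)] by simp
    note b = ball_functionals[OF this]
    show "lhs_L \<beta> E = rhs_LU \<beta> E"
      unfolding functionals_eq[OF E] b by (simp add: power2_eq_square field_simps)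
  qed
qed

lemma upper_bound:
  assumes E: "bounded_convex_body E" and \<beta>: "5/3 \<le> \<beta>"
  shows "lhs_U \<beta> E \<le> rhs_LU \<beta> E"
proof -
  interpret planar_body "closure E" by (rule planar_body_closure[OF E])
  obtain x where "moment x + \<beta> * (int_h2 - int_g2) \<le> (1 + \<beta>) * (len\<^sup>2 / (2 * pi))"
    using moment_upper_bound_weak[OF \<beta>] .
  then show ?thesis unfolding functionals_eq[OF E] using INF_moment_le[of x] by linarith
qed

lemma upper_bound_eq_iff:
  assumes E: "bounded_convex_body E" and \<beta>: "5/3 < \<beta>"
  shows "lhs_U \<beta> E = rhs_LU \<beta> E \<longleftrightarrow> (\<exists>r>0. \<exists>c. is_ball E c r)"
proof -
  interpret planar_body "closure E" by (rule planar_body_closure[OF E])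
  show ?thesis
  proof
    assume "lhs_U \<beta> E = rhs_LU \<beta> E"
    then have "(1 + \<beta>) * (len\<^sup>2 / (2 * pi)) \<le> moment x + \<beta> * (int_h2 - int_g2)" for x
      unfolding functionals_eq[OF E] using INF_moment_le[of x] by linarith
    then obtain x k where "\<And>t. h t = x \<bullet> dir t + k" using moment_upper_bound_eq[OF \<beta>] by blast
    from eq_cball_of_support[OF this] show "\<exists>r>0. \<exists>c. is_ball E c r"
      using is_ball_iff_closure[OF E] by blast
  next
    assume "\<exists>r>0. \<exists>c. is_ball E c r"
    then obtain r c where r: "r > 0" "closure E = cball c r" using is_ball_iff_closure[OF E] by blast
    note b = ball_functionals[OF support_of_cball[OF r(2,1)]]
    have "(INF x. moment x) = 2 * pi * r\<^sup>2"
    proof (rule antisym)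
      show "(INF x. moment x) \<le> 2 * pi * r\<^sup>2" using INF_moment_le[of c] by (simp add: b)
      show "2 * pi * r\<^sup>2 \<le> (INF x. moment x)" by (rule cINF_greatest) (auto simp: b)
    qed
    then show "lhs_U \<beta> E = rhs_LU \<beta> E"
      unfolding functionals_eq[OF E] b(1,2) by (simp add: power2_eq_square field_simps)
  qed
qed

lemma abs_sin_mult_le: "\<bar>sin (real k * x)\<bar> \<le> real k * \<bar>sin x\<bar>"
proof (induction k)
  case (Suc k)
  have "sin (real (Suc k) * x) = sin (real k * x) * cos x + cos (real k * x) * sin x"
    by (simp add: distrib_right sin_add add.commute)
  also have "\<bar>\<dots>\<bar> \<le> \<bar>sin (real k * x)\<bar> * \<bar>cos x\<bar> + \<bar>cos (real k * x)\<bar> * \<bar>sin x\<bar>"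
    by (metis abs_mult abs_triangle_ineq)
  also have "\<dots> \<le> (real k * \<bar>sin x\<bar>) * 1 + 1 * \<bar>sin x\<bar>"
    by (intro add_mono mult_mono Suc.IH) auto
  finally show ?case by (simp add: algebra_simps)
qed simp

lemma one_minus_cos_mult_le: "1 - cos (real k * x) \<le> (real k)\<^sup>2 * (1 - cos x)"
proof -
  have d: "1 - cos y = 2 * (sin (y / 2))\<^sup>2" for y :: real using cos_double_sin[of "y / 2"] by simp
  have "\<bar>sin (real k * (x / 2))\<bar>\<^sup>2 \<le> (real k * \<bar>sin (x / 2)\<bar>)\<^sup>2"
    by (intro power_mono abs_sin_mult_le) auto
  then have "(sin (real k * x / 2))\<^sup>2 \<le> (real k)\<^sup>2 * (sin (x / 2))\<^sup>2"
    by (simp add: power_mult_distrib)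
  then show ?thesis unfolding d by simp
qed

text \<open>
  Both sides are periodic. At \<open>x = 0\<close> the left-hand side vanishes to third order and \<open>1 - cos x\<close> only to second
  order, and \<open>1 - cos x\<close> has no other zero in a period.
\<close>

lemma sin_mult_defect: "\<exists>C\<ge>0. \<forall>x. \<bar>real k * sin x - sin (real k * x)\<bar> \<le> C * (1 - cos x)"
proof (induction k)
  case (Suc k)
  then obtain C where C: "C \<ge> 0" "\<And>x. \<bar>real k * sin x - sin (real k * x)\<bar> \<le> C * (1 - cos x)" by auto
  have "\<bar>real (Suc k) * sin x - sin (real (Suc k) * x)\<bar> \<le> (C + 1 + (real k)\<^sup>2) * (1 - cos x)" for x
  proof -
    have "real (Suc k) * sin x - sin (real (Suc k) * x)
        = (real k * sin x - sin (real k * x)) + sin (real k * x) * (1 - cos x) + sin x * (1 - cos (real k * x))"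
      by (simp add: distrib_right sin_add algebra_simps)
    moreover have "sin (real k * x) * (1 - cos x) \<le> 1 * (1 - cos x)" "- (sin (real k * x) * (1 - cos x)) \<le> 1 * (1 - cos x)"
      by (intro abs_mult_le; simp)+
    moreover have "sin x * (1 - cos (real k * x)) \<le> 1 * ((real k)\<^sup>2 * (1 - cos x))"
      "- (sin x * (1 - cos (real k * x))) \<le> 1 * ((real k)\<^sup>2 * (1 - cos x))"
      using one_minus_cos_mult_le[of k x] by (intro abs_mult_le; simp)+
    ultimately show ?thesis using C(2)[of x] unfolding abs_le_iff by (simp add: algebra_simps)
  qed
  then show ?case using C(1) by (intro exI[of _ "C + 1 + (real k)\<^sup>2"]) auto
qed (auto intro: exI[of _ 0])

text \<open>
  For the unit disc the inequality has the slack \<open>1 - cos (s - t)\<close>. The perturbation changes it by at most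
  \<open>\<epsilon> D (1 - cos (s - t))\<close>, so a small \<open>\<epsilon>\<close> preserves it.
\<close>

lemma support_perturbation:
  fixes k :: nat
  obtains \<epsilon> where "0 < \<epsilon>" "\<epsilon> < 1"
    "\<And>s t. (1 + \<epsilon> * cos (real k * t)) * cos (s - t) + (- \<epsilon> * real k * sin (real k * t)) * sin (s - t)
      \<le> 1 + \<epsilon> * cos (real k * s)"
proof -
  obtain C where C: "C \<ge> 0" "\<And>x. \<bar>real k * sin x - sin (real k * x)\<bar> \<le> C * (1 - cos x)"
    using sin_mult_defect by blast
  define D where "D = C + (real k)\<^sup>2 + 1"
  define \<epsilon> where "\<epsilon> = 1 / (D + 1)"
  have D: "D \<ge> 1" using C by (simp add: D_def)
  have \<epsilon>: "0 < \<epsilon>" "\<epsilon> < 1" "\<epsilon> * D \<le> 1" using D by (auto simp: \<epsilon>_def field_simps)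
  have "(1 + \<epsilon> * cos (real k * t)) * cos d + (- \<epsilon> * real k * sin (real k * t)) * sin d
      \<le> 1 + \<epsilon> * cos (real k * (t + d))" for t d
  proof -
    have c: "cos (real k * t) * (cos d - cos (real k * d)) \<le> 1 * (((real k)\<^sup>2 + 1) * (1 - cos d))"
    proof (rule abs_mult_le)
      show "\<bar>cos d - cos (real k * d)\<bar> \<le> ((real k)\<^sup>2 + 1) * (1 - cos d)"
      proof -
        have "0 \<le> (real k)\<^sup>2 * (1 - cos d)" by simp
        then show ?thesis
          using one_minus_cos_mult_le[of k d] cos_le_one[of d] cos_le_one[of "real k * d"]
          unfolding abs_le_iff by (intro conjI; simp only: distrib_right mult_1_left; linarith)
      qed
    qed simp
    have s: "- (sin (real k * t) * (real k * sin d - sin (real k * d))) \<le> 1 * (C * (1 - cos d))"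
      by (rule abs_mult_le) (use C in auto)
    have "(1 + \<epsilon> * cos (real k * t)) * cos d + (- \<epsilon> * real k * sin (real k * t)) * sin d - (1 + \<epsilon> * cos (real k * (t + d)))
        = - (1 - cos d) + \<epsilon> * (cos (real k * t) * (cos d - cos (real k * d))
          + - (sin (real k * t) * (real k * sin d - sin (real k * d))))"
      by (simp add: distrib_left cos_add algebra_simps)
    also have "\<dots> \<le> - (1 - cos d) + \<epsilon> * (1 * (((real k)\<^sup>2 + 1) * (1 - cos d)) + 1 * (C * (1 - cos d)))"
      using \<epsilon> c s by (intro add_left_mono mult_left_mono add_mono) auto
    also have "\<dots> = (\<epsilon> * D - 1) * (1 - cos d)" by (simp add: D_def algebra_simps)
    also have "\<dots> \<le> 0" using \<epsilon> by (intro mult_nonpos_nonneg) auto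
    finally show ?thesis by simp
  qed
  note le = this
  show ?thesis
  proof (rule that[OF \<epsilon>(1,2)])
    fix s t :: real
    show "(1 + \<epsilon> * cos (real k * t)) * cos (s - t) + (- \<epsilon> * real k * sin (real k * t)) * sin (s - t)
      \<le> 1 + \<epsilon> * cos (real k * s)"
      using le[of t "s - t"] by simp
  qed
qed

lemma has_integral_cos_mult:
  assumes "k > 0"
  shows "((\<lambda>t. cos (real k * t)) has_integral 0) {0..2*pi}"
    and "((\<lambda>t. (cos (real k * t))\<^sup>2) has_integral pi) {0..2*pi}"
    and "((\<lambda>t. (sin (real k * t))\<^sup>2) has_integral pi) {0..2*pi}"
proof -
  have s0: "sin (real k * (2 * pi)) = 0" "cos (real k * (2 * pi)) = 1"
    using sin_npi[of "2 * k"] cos_npi[of "2 * k"] by (simp_all add: mult_ac)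
  show "((\<lambda>t. cos (real k * t)) has_integral 0) {0..2*pi}"
    by (rule has_integral_periodic_derivative[of "\<lambda>t. sin (real k * t) / real k"])
      (use assms s0 in \<open>auto intro!: derivative_eq_intros\<close>)
  have d: "((\<lambda>t. (cos (real k * t))\<^sup>2 - (sin (real k * t))\<^sup>2) has_integral 0) {0..2*pi}"
    by (rule has_integral_periodic_derivative[of "\<lambda>t. sin (real k * t) * cos (real k * t) / real k"])
      (use assms s0 in \<open>auto intro!: derivative_eq_intros simp: power2_eq_square field_simps\<close>)
  have one: "((\<lambda>t. 1) has_integral 2 * pi) {0..2*pi}"
    using has_integral_const_real[of "1::real" 0 "2*pi"] by simp
  have "((\<lambda>t. (1 + ((cos (real k * t))\<^sup>2 - (sin (real k * t))\<^sup>2)) / 2) has_integral (2 * pi + 0) / 2) {0..2*pi}"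
    by (intro has_integral_divide has_integral_add one d)
  moreover have "(1 + ((cos x)\<^sup>2 - (sin x)\<^sup>2)) / 2 = (cos x)\<^sup>2" for x :: real
    using sin_cos_squared_add[of x] by (simp add: field_simps)
  ultimately show "((\<lambda>t. (cos (real k * t))\<^sup>2) has_integral pi) {0..2*pi}" by simp
  have "((\<lambda>t. (1 - ((cos (real k * t))\<^sup>2 - (sin (real k * t))\<^sup>2)) / 2) has_integral (2 * pi - 0) / 2) {0..2*pi}"
    by (intro has_integral_divide has_integral_diff one d)
  moreover have "(1 - ((cos x)\<^sup>2 - (sin x)\<^sup>2)) / 2 = (sin x)\<^sup>2" for x :: real
    using sin_cos_squared_add[of x] by (simp add: field_simps)
  ultimately show "((\<lambda>t. (sin (real k * t))\<^sup>2) has_integral pi) {0..2*pi}" by simp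
qed

text \<open>
  The body is the intersection of the half-planes \<open>{y. y \<bullet> dir t \<le> H t}\<close>. The inequality of
  \<open>support_perturbation\<close> puts the point \<open>H t dir t + G t tang t\<close> into it, so each of the half-planes is supporting
  and \<open>H\<close> is the support function.
\<close>

lemma perturbed_disc:
  fixes k :: nat
  assumes k: "k > 0"
  obtains E \<epsilon> where "bounded_convex_body E" "closure E = E" "\<epsilon> > 0"
    "\<And>t. planar_body.h E t = 1 + \<epsilon> * cos (real k * t)"
    "support_pair.len (planar_body.h E) = 2 * pi"
    "support_pair.int_h2 (planar_body.h E) = 2 * pi + \<epsilon>\<^sup>2 * pi"
    "support_pair.int_g2 (planar_body.g E) = \<epsilon>\<^sup>2 * (real k)\<^sup>2 * pi"
proof -
  obtain \<epsilon> where \<epsilon>: "0 < \<epsilon>" "\<epsilon> < 1" and bound: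
    "\<And>s t. (1 + \<epsilon> * cos (real k * t)) * cos (s - t) + (- \<epsilon> * real k * sin (real k * t)) * sin (s - t)
      \<le> 1 + \<epsilon> * cos (real k * s)"
    using support_perturbation[of k] by blast
  define H G where "H t = 1 + \<epsilon> * cos (real k * t)" and "G t = - \<epsilon> * real k * sin (real k * t)" for t
  define E where "E = {y. \<forall>t. y \<bullet> dir t \<le> H t}"
  have E_Int: "E = (\<Inter>t. {y. dir t \<bullet> y \<le> H t})" by (auto simp: E_def inner_commute)
  have H: "1 - \<epsilon> \<le> H t" "H t \<le> 2" for t
  proof -
    have "\<epsilon> * cos (real k * t) \<le> \<epsilon> * 1" "- (\<epsilon> * cos (real k * t)) \<le> \<epsilon> * 1"
      using \<epsilon> by (intro abs_mult_le; simp)+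
    then have "\<epsilon> * cos (real k * t) \<le> \<epsilon>" "- (\<epsilon> * cos (real k * t)) \<le> \<epsilon>" by (simp_all only: mult_1_right)
    then show "1 - \<epsilon> \<le> H t" "H t \<le> 2" unfolding H_def using \<epsilon> by linarith+
  qed
  have conv: "convex E" unfolding E_Int by (intro convex_INT convex_halfspace_le)
  have clos: "closed E" unfolding E_Int by (intro closed_INT ballI closed_halfspace_le)
  have bdd: "bounded E"
  proof (rule boundedI)
    fix y assume y: "y \<in> E"
    have "\<bar>y \<bullet> dir t\<bar> \<le> 2" for t
    proof -
      have "dir (t + pi) = - dir t" using dir_add[of t pi] by simp
      moreover have "y \<bullet> dir t \<le> H t" "y \<bullet> dir (t + pi) \<le> H (t + pi)" using y by (auto simp: E_def)
      ultimately show ?thesis using H(2)[of t] H(2)[of "t + pi"] by simp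
    qed
    then have "\<bar>y \<bullet> dir 0\<bar> \<le> 2" "\<bar>y \<bullet> dir (pi/2)\<bar> \<le> 2" by auto
    moreover have "norm y \<le> \<bar>y \<bullet> dir 0\<bar> + \<bar>y \<bullet> dir (pi/2)\<bar>"
      using norm_le_l1_cart[of y] by (simp add: sum_2 inner_dir_eq)
    ultimately show "norm y \<le> 4" by linarith
  qed
  have "ball 0 (1 - \<epsilon>) \<subseteq> E"
  proof
    fix y :: "real^2" assume "y \<in> ball 0 (1 - \<epsilon>)"
    then have y: "norm y < 1 - \<epsilon>" by simp
    have "y \<bullet> dir t \<le> H t" for t
      using H(1)[of t] Cauchy_Schwarz_ineq2[of y "dir t"] y by simp
    then show "y \<in> E" by (simp add: E_def)
  qed
  then have "ball 0 (1 - \<epsilon>) \<subseteq> interior E" by (intro interior_maximal) auto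
  moreover have "0 \<in> ball (0 :: real^2) (1 - \<epsilon>)" using \<epsilon> by simp
  ultimately have int: "interior E \<noteq> {}" by blast
  have body: "bounded_convex_body E" using bdd conv int by (simp add: bounded_convex_body_def)
  have cE: "closure E = E" using clos by (rule closure_closed)
  interpret planar_body E using planar_body_closure[OF body] cE by simp
  have hH: "h t = H t" for t
  proof (rule antisym)
    have "x \<in> E \<Longrightarrow> x \<bullet> dir t \<le> H t" for x by (simp add: E_def)
    from this[OF pt_in_K[of t]] show "h t \<le> H t" by (simp only: pt_dir)
    define p where "p = H t *\<^sub>R dir t + G t *\<^sub>R tang t"
    have p: "p \<bullet> dir t = H t" "p \<bullet> tang t = G t" by (simp_all add: p_def inner_add_left)
    have "p \<bullet> dir s \<le> H s" for s
      using bound[of t s] inner_dir_rotate[of p s t] unfolding p by (simp add: H_def G_def)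
    then have "p \<in> E" by (simp add: E_def)
    from inner_le_h[OF this, of t] show "H t \<le> h t" using p by simp
  qed
  have gG: "g t = G t" if "t \<notin> kinks" for t
  proof -
    have "(H has_real_derivative G t) (at t)"
      unfolding H_def[abs_def] G_def by (auto intro!: derivative_eq_intros)
    moreover have "h = H" using hH by auto
    ultimately show ?thesis using DERIV_unique[OF h_deriv[OF that]] by simp
  qed
  have one: "((\<lambda>t. 1) has_integral 2 * pi) {0..2*pi}"
    using has_integral_const_real[of "1::real" 0 "2*pi"] by simp
  note I = has_integral_cos_mult[OF k]
  have "(H has_integral 2 * pi + \<epsilon> * 0) {0..2*pi}"
    unfolding H_def[abs_def] by (intro has_integral_add has_integral_mult_right one I)
  moreover have "h = H" using hH by (rule ext)
  ultimately have "(h has_integral 2 * pi) {0..2*pi}" by simp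
  then have len: "len = 2 * pi" by (rule has_integral_unique[OF has_integral_h])
  have "((\<lambda>t. 1 + 2 * \<epsilon> * cos (real k * t) + \<epsilon>\<^sup>2 * (cos (real k * t))\<^sup>2) has_integral 2 * pi + 2 * \<epsilon> * 0 + \<epsilon>\<^sup>2 * pi) {0..2*pi}"
    by (intro has_integral_add has_integral_mult_right one I)
  then have "((\<lambda>t. (h t)\<^sup>2) has_integral 2 * pi + \<epsilon>\<^sup>2 * pi) {0..2*pi}"
    by (simp add: hH H_def power2_eq_square algebra_simps)
  then have h2: "int_h2 = 2 * pi + \<epsilon>\<^sup>2 * pi" by (rule has_integral_unique[OF has_integral_h2])
  have "((\<lambda>t. \<epsilon>\<^sup>2 * (real k)\<^sup>2 * (sin (real k * t))\<^sup>2) has_integral \<epsilon>\<^sup>2 * (real k)\<^sup>2 * pi) {0..2*pi}"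
    by (intro has_integral_mult_right I)
  then have "((\<lambda>t. (g t)\<^sup>2) has_integral \<epsilon>\<^sup>2 * (real k)\<^sup>2 * pi) {0..2*pi}"
    by (rule has_integral_spike[OF negligible_kinks, rotated]) (simp add: gG G_def power_mult_distrib)
  then have g2: "int_g2 = \<epsilon>\<^sup>2 * (real k)\<^sup>2 * pi" by (rule has_integral_unique[OF has_integral_g2])
  show ?thesis
    by (rule that[OF body cE \<epsilon>(1) _ len h2 g2]) (simp add: hH H_def)
qed

text \<open>
  For \<open>k = 2\<close> the first harmonics of \<open>h\<close> vanish, so the moment is smallest about the origin and the infimum
  causes no loss.
\<close>

lemma upper_threshold_sharp:
  assumes \<beta>: "0 < \<beta>" "\<beta> < 5/3"
  shows "\<exists>E. bounded_convex_body E \<and> \<not> lhs_U \<beta> E \<le> rhs_LU \<beta> E"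
proof -
  obtain E \<epsilon> where E: "bounded_convex_body E" "closure E = E" "\<epsilon> > 0"
    "\<And>t. planar_body.h E t = 1 + \<epsilon> * cos (real 2 * t)"
    "support_pair.len (planar_body.h E) = 2 * pi"
    "support_pair.int_h2 (planar_body.h E) = 2 * pi + \<epsilon>\<^sup>2 * pi"
    "support_pair.int_g2 (planar_body.g E) = \<epsilon>\<^sup>2 * (real 2)\<^sup>2 * pi"
    using perturbed_disc[of 2] by auto
  interpret planar_body E using planar_body_closure[OF E(1)] E(2) by simp
  have "moment x \<ge> 2 * pi + 5 * \<epsilon>\<^sup>2 * pi" for x
  proof -
    have s: "sin (4 * pi) = 0" "cos (4 * pi) = 1" using sin_npi[of 4] cos_npi[of 4] by simp_all
    have "((\<lambda>t. cos (2 * t) * (x \<bullet> dir t)) has_integral 0) {0..2*pi}"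
      \<comment> \<open>The derivatives of \<open>cos (2 t) (x \<bullet> tang t)\<close> and \<open>2 sin (2 t) (x \<bullet> dir t)\<close> add up to three times the integrand.\<close>
      by (rule has_integral_periodic_derivative[of "\<lambda>t. (cos (2 * t) * (x \<bullet> tang t) + 2 * sin (2 * t) * (x \<bullet> dir t)) / 3"])
        (use s in \<open>auto intro!: derivative_eq_intros inner_dir_deriv inner_tang_deriv simp: dir_2pi dir_2pi[unfolded mult.commute[of 2]] field_simps\<close>)
    then have "((\<lambda>t. x \<bullet> dir t + \<epsilon> * (cos (2 * t) * (x \<bullet> dir t))) has_integral 0 + \<epsilon> * 0) {0..2*pi}"
      by (intro has_integral_add has_integral_mult_right has_integral_inner_dir)
    then have "((\<lambda>t. h t * (x \<bullet> dir t)) has_integral 0) {0..2*pi}"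
      by (simp add: E(4) algebra_simps)
    from moment_expand[OF this] show ?thesis by (simp add: E(6,7))
  qed
  then have "2 * pi + 5 * \<epsilon>\<^sup>2 * pi \<le> (INF x. moment x)" by (intro cINF_greatest) auto
  moreover have "0 < (5 - 3 * \<beta>) * (\<epsilon>\<^sup>2 * pi)" using \<beta> E(3) by simp
  moreover have "(1 + \<beta>) * ((2 * pi)\<^sup>2 / (2 * pi)) = 2 * pi + 2 * \<beta> * pi"
    by (simp add: power2_eq_square field_simps)
  moreover have "\<beta> * (2 * pi + \<epsilon>\<^sup>2 * pi - \<epsilon>\<^sup>2 * (real 2)\<^sup>2 * pi) = 2 * \<beta> * pi - 3 * \<beta> * (\<epsilon>\<^sup>2 * pi)"
    by (simp add: algebra_simps)
  moreover have "(5 - 3 * \<beta>) * (\<epsilon>\<^sup>2 * pi) = 5 * \<epsilon>\<^sup>2 * pi - 3 * \<beta> * (\<epsilon>\<^sup>2 * pi)"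
    by (simp add: algebra_simps)
  ultimately have "\<not> (INF x. moment x) + \<beta> * (int_h2 - int_g2) \<le> (1 + \<beta>) * (len\<^sup>2 / (2 * pi))"
    unfolding E(5,6,7) by linarith
  then show ?thesis using functionals_eq(2,3)[OF E(1), of \<beta>] E(1,2) by auto
qed

lemma lower_threshold_sharp:
  assumes \<beta>: "1 < \<beta>"
  shows "\<exists>E. bounded_convex_body E \<and> \<not> lhs_L \<beta> E \<ge> rhs_LU \<beta> E"
proof -
  obtain k :: nat where k: "(1 + \<beta>) / (\<beta> - 1) < real k" using reals_Archimedean2 by blast
  have "1 \<le> (1 + \<beta>) / (\<beta> - 1)" using \<beta> by (simp add: field_simps)
  then have k1: "1 \<le> real k" using k by linarith
  then have "real k \<le> (real k)\<^sup>2" by (simp add: power2_eq_square)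
  then have "(1 + \<beta>) / (\<beta> - 1) < (real k)\<^sup>2" using k by linarith
  then have neg: "1 + \<beta> < (\<beta> - 1) * (real k)\<^sup>2" using \<beta> by (simp add: field_simps)
  obtain E \<epsilon> where E: "bounded_convex_body E" "closure E = E" "\<epsilon> > 0"
    "\<And>t. planar_body.h E t = 1 + \<epsilon> * cos (real k * t)"
    "support_pair.len (planar_body.h E) = 2 * pi"
    "support_pair.int_h2 (planar_body.h E) = 2 * pi + \<epsilon>\<^sup>2 * pi"
    "support_pair.int_g2 (planar_body.g E) = \<epsilon>\<^sup>2 * (real k)\<^sup>2 * pi"
    using perturbed_disc[of k] k1 by auto
  interpret planar_body E using planar_body_closure[OF E(1)] E(2) by simp
  have "(1 + \<beta>) * (\<epsilon>\<^sup>2 * pi) < ((\<beta> - 1) * (real k)\<^sup>2) * (\<epsilon>\<^sup>2 * pi)"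
    using neg E(3) by (intro mult_strict_right_mono) auto
  then have "\<not> (1 + \<beta>) * (len\<^sup>2 / (2 * pi)) \<le> moment 0 + \<beta> * (int_h2 - int_g2)"
    unfolding moment_0 E(5,6,7) by (simp add: power2_eq_square algebra_simps not_le)
  then show ?thesis using functionals_eq(1,3)[OF E(1), of \<beta>] E(1,2) by auto
qed

lemma bounded_convex_body_translate: "bounded_convex_body ((+) a ` E) \<longleftrightarrow> bounded_convex_body E"
proof -
  have "bounded_convex_body ((+) a ` E)" if "bounded_convex_body E" for a E
    using that unfolding bounded_convex_body_def
    by (simp add: bounded_translation convex_translation interior_translation)
  from this[of E a] this[of "(+) a ` E" "- a"] show ?thesis by (auto simp: image_image)
qed

lemma is_ball_translate: "is_ball ((+) a ` E) c r \<longleftrightarrow> is_ball E (c - a) r"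
proof -
  have b: "ball c r = (+) a ` ball (c - a) r"
    using ball_translation[of a "c - a" r] by simp
  have cb: "cball c r = (+) a ` cball (c - a) r"
    using cball_translation[of a "c - a" r] by simp
  have inc: "(+) a ` A \<subseteq> (+) a ` B \<longleftrightarrow> A \<subseteq> B" for A B
    by (rule inj_image_subset_iff) simp
  show ?thesis by (simp only: is_ball_def b cb inc)
qed

text \<open>
  The moment in the lower bound is taken about the origin, so equality detects balls centred there; translating
  the body moves the centre.
\<close>

lemma lower_bound_eq_translate_iff:
  assumes E: "bounded_convex_body E" and \<beta>: "0 < \<beta>" "\<beta> < 1"
  shows "(\<exists>a. lhs_L \<beta> ((+) a ` E) = rhs_LU \<beta> ((+) a ` E)) \<longleftrightarrow> (\<exists>r>0. \<exists>c. is_ball E c r)"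
proof -
  have "lhs_L \<beta> ((+) a ` E) = rhs_LU \<beta> ((+) a ` E) \<longleftrightarrow> (\<exists>r>0. is_ball E (- a) r)" for a
    using lower_bound_eq_iff[OF _ \<beta>, of "(+) a ` E"] E by (simp add: bounded_convex_body_translate is_ball_translate)
  then have "(\<exists>a. lhs_L \<beta> ((+) a ` E) = rhs_LU \<beta> ((+) a ` E)) \<longleftrightarrow> (\<exists>a. \<exists>r>0. is_ball E (- a) r)" by simp
  also have "\<dots> \<longleftrightarrow> (\<exists>r>0. \<exists>c. is_ball E c r)" by (metis minus_minus)
  finally show ?thesis .
qed

theorem corollary3p8:
  shows
    "(\<forall>\<beta>>0. \<forall>E. bounded_convex_body E \<longrightarrow>
        (\<beta> \<le> 1 \<longrightarrow> lhs_L \<beta> E \<ge> rhs_LU \<beta> E) \<and>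
        (\<beta> \<ge> 5/3 \<longrightarrow> lhs_U \<beta> E \<le> rhs_LU \<beta> E)) \<and>
     (\<forall>\<beta>. 0 < \<beta> \<and> \<beta> < 5/3 \<longrightarrow>
        (\<exists>E. bounded_convex_body E \<and> \<not> lhs_U \<beta> E \<le> rhs_LU \<beta> E)) \<and>
     (\<forall>\<beta>>1. \<exists>E. bounded_convex_body E \<and> \<not> lhs_L \<beta> E \<ge> rhs_LU \<beta> E) \<and>
     (\<forall>\<beta>>5/3. \<forall>E. bounded_convex_body E \<longrightarrow>
        (lhs_U \<beta> E = rhs_LU \<beta> E \<longleftrightarrow> (\<exists>r>0. \<exists>c. is_ball E c r))) \<and>
     (\<forall>\<beta> E. 0 < \<beta> \<and> \<beta> < 1 \<and> bounded_convex_body E \<longrightarrow>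
        (lhs_L \<beta> E = rhs_LU \<beta> E \<longleftrightarrow> (\<exists>r>0. is_ball E 0 r)) \<and>
        ((\<exists>a. lhs_L \<beta> ((+) a ` E) = rhs_LU \<beta> ((+) a ` E)) \<longleftrightarrow> (\<exists>r>0. \<exists>c. is_ball E c r)))"
  by (intro conjI allI impI)
    (simp_all add: lower_bound upper_bound upper_threshold_sharp lower_threshold_sharp upper_bound_eq_iff
      lower_bound_eq_iff lower_bound_eq_translate_iff del: not_le)

end
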